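(* Let $\omega:\mathbb T\to\mathbb R$ be a non-constant real-valued function with $\omega\in L^1(\mathbb T)$ and $\operatorname{ess\,inf}\omega>-\infty$, and let $T=T(\omega)$ be the self-adjoint Toeplitz operator with symbol $\omega$. Then for any compact interval $X\subset\mathbb R$ and any $z\in\mathbb D$ there exists a number $p>1$ such that $$\sup_{\varepsilon\in(0,1]}\int_X \big|\big((T(\omega)-\lambda-i\varepsilon)^{-1}K_z,K_z\big)\big|^p\,d\lambda<\infty .$$
   Context: $\mathbb D$ is the open unit disk, $\mathbb T$ the unit circle with normalized Lebesgue measure $d\mathbf m(\zeta)=(2\pi i\zeta)^{-1}d\zeta$. $\mathbb H^2\subset L^2(\mathbb T)$ is the Hardy space with inner product $(f,g)=\int_{\mathbb T}f\overline g\,d\mathbf m$. For $u\in\mathbb D$, $K_u(z)=(1-\overline u z)^{-1}$. Definition of $T(\omega)$: let $\gamma_1=\operatorname{ess\,inf}\omega$, $H(z)=\frac{1+z}{1-z}$, and for $\lambda<\gamma_1$ let $F_\lambda(z)=\exp\big(\frac12\int_{\mathbb T}\ln(\omega(\zeta)-\lambda)H(z\overline\zeta)\,d\mathbf m(\zeta)\big)$, $z\in\mathbb D$; this is an outer function in $\mathbb H^2$ with $|F_\lambda(\zeta)|^2=\omega(\zeta)-\lambda$ a.e. on $\mathbb T$. The form $T[f,g]=\int_{\mathbb T}\omega f\overline g\,d\mathbf m$ on the domain $D[T]=\{f\in\mathbb H^2: F_\lambda f\in\mathbb H^2\}$ (independent of $\lambda<\gamma_1$) is densely defined, closed and bounded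 below by $\gamma_1$; $T=T(\omega)$ is the associated self-adjoint operator in $\mathbb H^2$, i.e. $(Tf,g)=T[f,g]$ for $f\in D(T)$, $g\in D[T]$. (If $\omega$ is bounded, $Tf=\mathbb P(\omega f)$ with $\mathbb P$ the orthogonal projection of $L^2(\mathbb T)$ onto $\mathbb H^2$.) *)

theory Defs
  imports "HOL-Probability.Probability"
begin

definition circle_measure :: "complex measure" where
  "circle_measure =
     completion (distr (uniform_measure lborel {0..<2 * pi}) (restrict_space borel (sphere 0 1)) cis)"

text \<open>
  Elements of \<open>L\<^sup>2\<close> and of the Hardy space are represented by functions on the unit circle; two
  functions represent the same element iff they agree almost everywhere. Values off the circle are
  irrelevant.
\<close>

definition L2_circle :: "(complex \<Rightarrow> complex) set" where
  "L2_circle = {f \<in> borel_measurable circle_measure.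
     integrable circle_measure (\<lambda>\<zeta>. (cmod (f \<zeta>))\<^sup>2)}"

definition circle_inner :: "(complex \<Rightarrow> complex) \<Rightarrow> (complex \<Rightarrow> complex) \<Rightarrow> complex" where
  "circle_inner f g = (\<integral>\<zeta>. f \<zeta> * cnj (g \<zeta>) \<partial>circle_measure)"

text \<open>The integral below is the Fourier coefficient of \<open>f\<close> of index \<open>-n\<close>, as \<open>cnj \<zeta> = 1 / \<zeta>\<close>.\<close>

definition hardy2 :: "(complex \<Rightarrow> complex) set" where
  "hardy2 = {f \<in> L2_circle. \<forall>n\<ge>1. (\<integral>\<zeta>. f \<zeta> * \<zeta> ^ n \<partial>circle_measure) = 0}"

definition szego_kernel :: "complex \<Rightarrow> complex \<Rightarrow> complex" where
  "szego_kernel u z = 1 / (1 - cnj u * z)"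

text \<open>
  The analytic function in the unit disk whose boundary function is \<open>f \<in> hardy2\<close>, given by
  the reproducing (Cauchy) formula. Its Taylor coefficients are the Fourier coefficients of \<open>f\<close>.
\<close>

definition disk_extension :: "(complex \<Rightarrow> complex) \<Rightarrow> complex \<Rightarrow> complex" where
  "disk_extension f z = circle_inner f (szego_kernel z)"

definition ess_inf :: "(complex \<Rightarrow> real) \<Rightarrow> ereal" where
  "ess_inf \<omega> = - esssup circle_measure (\<lambda>\<zeta>. - ereal (\<omega> \<zeta>))"

definition herglotz_kernel :: "complex \<Rightarrow> complex" where
  "herglotz_kernel z = (1 + z) / (1 - z)"

definition outer_function :: "(complex \<Rightarrow> real) \<Rightarrow> real \<Rightarrow> complex \<Rightarrow> complex" where
  "outer_function \<omega> t z =
     exp (1 / 2 * (\<integral>\<zeta>. complex_of_real (ln (\<omega> \<zeta> - t)) * herglotz_kernel (z * cnj \<zeta>) \<partial>circle_measure))"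

text \<open>
  The condition that the product of the outer function and \<open>f\<close> lies in the Hardy space is read in
  the disk: the product is the analytic extension of some element of the Hardy space. The condition
  does not depend on the choice of \<open>t\<close> below the essential infimum.
\<close>

definition toeplitz_form_domain :: "(complex \<Rightarrow> real) \<Rightarrow> (complex \<Rightarrow> complex) set" where
  "toeplitz_form_domain \<omega> = {f \<in> hardy2. \<exists>t. ereal t < ess_inf \<omega> \<and>
     (\<exists>g\<in>hardy2. \<forall>z\<in>ball 0 1. disk_extension g z = outer_function \<omega> t z * disk_extension f z)}"

definition toeplitz_form ::
    "(complex \<Rightarrow> real) \<Rightarrow> (complex \<Rightarrow> complex) \<Rightarrow> (complex \<Rightarrow> complex) \<Rightarrow> complex" where
  "toeplitz_form \<omega> f g = (\<integral>\<zeta>. complex_of_real (\<omega> \<zeta>) * f \<zeta> * cnj (g \<zeta>) \<partial>circle_measure)"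

text \<open>
  The operator associated with the closed semibounded form (first representation theorem): \<open>f\<close> lies
  in its domain, with image \<open>h\<close>, iff \<open>h\<close> represents the form at \<open>f\<close>. Since the form domain is
  dense, \<open>h\<close> is unique up to a null set, and \<open>SOME\<close> merely selects a representative.
\<close>

definition toeplitz_represents ::
    "(complex \<Rightarrow> real) \<Rightarrow> (complex \<Rightarrow> complex) \<Rightarrow> (complex \<Rightarrow> complex) \<Rightarrow> bool" where
  "toeplitz_represents \<omega> f h \<longleftrightarrow> h \<in> hardy2 \<and>
     (\<forall>g\<in>toeplitz_form_domain \<omega>. circle_inner h g = toeplitz_form \<omega> f g)"

definition toeplitz_domain :: "(complex \<Rightarrow> real) \<Rightarrow> (complex \<Rightarrow> complex) set" where
  "toeplitz_domain \<omega> = {f \<in> toeplitz_form_domain \<omega>. \<exists>h. toeplitz_represents \<omega> f h}"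

definition toeplitz :: "(complex \<Rightarrow> real) \<Rightarrow> (complex \<Rightarrow> complex) \<Rightarrow> complex \<Rightarrow> complex" where
  "toeplitz \<omega> f = (SOME h. toeplitz_represents \<omega> f h)"

text \<open>
  \<open>toeplitz_resolvent \<omega> \<mu> g\<close> is the value at \<open>g\<close> of the inverse of \<open>T(\<omega>) - \<mu>\<close>. For nonreal \<open>\<mu>\<close> a
  preimage exists and is unique up to a null set, because \<open>T(\<omega>)\<close> is self-adjoint.
\<close>

definition toeplitz_resolvent ::
    "(complex \<Rightarrow> real) \<Rightarrow> complex \<Rightarrow> (complex \<Rightarrow> complex) \<Rightarrow> complex \<Rightarrow> complex" where
  "toeplitz_resolvent \<omega> \<mu> g = (SOME f. f \<in> toeplitz_domain \<omega> \<and>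
     (AE \<zeta> in circle_measure. toeplitz \<omega> f \<zeta> - \<mu> * f \<zeta> = g \<zeta>))"

end

theory Submission
  imports Defs "HOL-Complex_Analysis.Complex_Analysis"
begin

text \<open>
  Put \<open>\<mu> = t + i \<epsilon>\<close>. The symbol factors on the circle as \<open>\<omega> - \<mu> = -i F * cnj F'\<close>, where \<open>F\<close> and
  \<open>F'\<close> are the exponentials of half the Herglotz integrals of a logarithm of \<open>i (\<omega> - \<mu>)\<close> and of its
  conjugate. A Toeplitz operator with co-analytic symbol has the Szego kernel \<open>K\<^sub>z\<close> as an eigenvector,
  so a multiple of \<open>K\<^sub>z / F\<close> solves \<open>(T - \<mu>) f = K\<^sub>z\<close>; it lies in the form domain because
  \<open>arg (\<omega> - \<mu>)\<close> varies in an interval shorter than \<open>\<pi>\<close>. Evaluating at \<open>z\<close> gives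
  \<open>|((T - \<mu>)\<^sup>-\<^sup>1 K\<^sub>z, K\<^sub>z)| = K\<^sub>z(z) exp (- \<integral> ln |\<omega> - \<mu>| P\<^sub>z dm)\<close> with the Poisson kernel \<open>P\<^sub>z\<close>.

  As \<open>\<omega>\<close> is not constant, there are \<open>c < d\<close> such that \<open>\<omega> \<le> c\<close> and \<open>\<omega> \<ge> d\<close> both have positive measure.
  For \<open>t\<close> to the left of the midpoint the part \<open>\<omega> \<ge> d\<close> contributes a bounded factor, and Jensen's
  inequality on the part \<open>\<omega> < d\<close>, of \<open>P\<^sub>z\<close>-mass \<open>w < 1\<close>, bounds the \<open>p\<close>-th power by an average of
  \<open>|\<omega> - t| powr (- p w)\<close>, which is integrable in \<open>t\<close> if \<open>p w < 1\<close>. The other half is symmetric.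
\<close>

section \<open>Normalized Lebesgue measure on the circle\<close>

text \<open>The factor \<open>\<i>\<close> turns \<open>\<omega> - \<mu>\<close> into a number of
  the right half-plane, where \<open>arctan\<close> supplies a logarithm. That logarithm is complex,
  so the Herglotz integrals of it and of its conjugate are different holomorphic functions; this is
  why there are two factors \<open>F\<close> and \<open>F'\<close>. Since \<open>\<omega>\<close> is
  only integrable, a test function \<open>g\<close> is controlled only through its product with an
  outer function, whose parameter belongs to \<open>g\<close>. The product of \<open>F'\<close> and
  \<open>g\<close> is therefore rewritten as a product of two elements of \<open>hardy2\<close>
  before the Cauchy formula is used. Square integrability of the logarithm rests on
  \<open>(ln y)\<^sup>2\<close> being dominated by \<open>y\<close>. Operator and resolvent are
  chosen by \<open>SOME\<close>, hence known only almost everywhere: a solution is constructed and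
  then identified with the chosen one by uniqueness. Identities in the disk reach the circle without
  Fatou's theorem: dilates converge in L2 by Parseval, so almost everywhere along one sequence of
  radii common to the finitely many functions involved.\<close>

abbreviation circle_borel :: "complex measure" where
  "circle_borel \<equiv> distr (uniform_measure lborel {0..<2 * pi}) (restrict_space borel (sphere 0 1)) cis"

lemma measurable_cis:
  "cis \<in> uniform_measure lborel A \<rightarrow>\<^sub>M restrict_space borel (sphere 0 1)"
  by (intro measurable_restrict_space2) (auto simp: uniform_measure_def intro!: borel_measurable_continuous_onI continuous_intros)

lemma prob_space_circle_borel: "prob_space circle_borel"
proof (rule prob_space.prob_space_distr)
  have "emeasure lborel {0..<2 * pi} = ennreal (2 * pi)"
    by (rule emeasure_lborel_Ico[THEN trans]) simp_all
  then show "prob_space (uniform_measure lborel {0..<2 * pi})"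
    by (intro prob_space_uniform_measure) (simp_all add: ennreal_eq_0_iff not_le)
qed (rule measurable_cis)

lemma space_circle [simp]: "space circle_measure = sphere 0 1"
  by (simp add: circle_measure_def space_restrict_space)

lemma prob_space_circle: "prob_space circle_measure"
proof (rule prob_spaceI)
  interpret prob_space circle_borel by (rule prob_space_circle_borel)
  have "emeasure circle_measure (space circle_measure) = emeasure circle_borel (space circle_borel)"
    unfolding circle_measure_def space_completion 
    by (rule emeasure_completion[OF sets_completionI_sets[OF sets.top], THEN trans]) (simp only: main_part[OF sets.top])
  then show "emeasure circle_measure (space circle_measure) = 1"
    by (simp only: emeasure_space_1)
qed

interpretation circle: prob_space circle_measure
  by (rule prob_space_circle)

lemma AE_circle_norm: "AE \<zeta> in circle_measure. norm \<zeta> = 1"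
  by (rule AE_I2) simp

lemma borel_measurable_circle_borel:
  "f \<in> borel_measurable borel \<Longrightarrow> f \<in> borel_measurable circle_borel"
  unfolding measurable_distr_eq1 by (rule measurable_restrict_space1)

lemma borel_measurable_circle:
  "f \<in> borel_measurable borel \<Longrightarrow> f \<in> borel_measurable circle_measure"
  unfolding circle_measure_def by (intro measurable_completion borel_measurable_circle_borel)

lemma measurable_circle_continuous_on:
  fixes f :: "complex \<Rightarrow> 'a::topological_space"
  assumes "continuous_on (sphere 0 1) f"
  shows "f \<in> borel_measurable circle_measure"
  unfolding circle_measure_def
  by (intro measurable_completion, unfold measurable_distr_eq1)
     (rule borel_measurable_continuous_on_restrict[OF assms])

text \<open>A continuous integrand is Borel, so the completion and the push-forward under
  \<open>cis\<close> can both be undone. The closed interval differs from the half-open one by a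
  null point and is the form that the fundamental theorem of calculus takes.\<close>

lemma integral_circle_borel:
  fixes f :: "complex \<Rightarrow> complex"
  assumes "continuous_on UNIV f"
  shows "(\<integral>\<zeta>. f \<zeta> \<partial>circle_measure) = (1 / (2 * pi)) *\<^sub>R (\<integral>\<theta>. indicator {0..2 * pi} \<theta> *\<^sub>R f (cis \<theta>) \<partial>lborel)"
proof -
  have f: "f \<in> borel_measurable borel"
    using assms by (rule borel_measurable_continuous_onI)
  have m [measurable]: "(\<lambda>\<theta>. f (cis \<theta>)) \<in> borel_measurable lborel"
    unfolding measurable_lborel2
    by (intro borel_measurable_continuous_onI continuous_on_compose2[OF assms] continuous_intros) auto
  have eq: "uniform_measure lborel {0..<2 * pi}
      = density lborel (\<lambda>x. ennreal (indicator {0..<2*pi} x / (2 * pi)))"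
    unfolding uniform_measure_def
    by (rule arg_cong[where f="density lborel"])
       (simp add: fun_eq_iff ennreal_indicator[symmetric] divide_ennreal)
  have "(\<integral>\<zeta>. f \<zeta> \<partial>circle_measure) = (\<integral>\<zeta>. f \<zeta> \<partial>circle_borel)"
    unfolding circle_measure_def
    by (intro integral_completion borel_measurable_circle_borel f)
  also have "\<dots> = (\<integral>\<theta>. f (cis \<theta>) \<partial>uniform_measure lborel {0..<2 * pi})"
    by (intro integral_distr measurable_cis measurable_restrict_space1 f)
  also have "\<dots> = (\<integral>\<theta>. (indicator {0..<2*pi} \<theta> / (2 * pi)) *\<^sub>R f (cis \<theta>) \<partial>lborel)"
    unfolding eq by (intro integral_density m) simp_all
  also have "\<dots> = (\<integral>\<theta>. (1 / (2 * pi)) *\<^sub>R (indicator {0..2*pi} \<theta> *\<^sub>R f (cis \<theta>)) \<partial>lborel)"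
  proof (rule integral_cong_AE)
    show "AE \<theta> in lborel. (indicator {0..<2*pi} \<theta> / (2 * pi)) *\<^sub>R f (cis \<theta>)
        = (1 / (2 * pi)) *\<^sub>R (indicator {0..2*pi} \<theta> *\<^sub>R f (cis \<theta>))"
      using AE_lborel_singleton[of "2*pi"] by eventually_elim (auto simp: indicator_def)
  qed (intro borel_measurable_scaleR m borel_measurable_divide borel_measurable_const borel_measurable_indicator; simp)+
  finally show ?thesis
    unfolding integral_scaleR_right .
qed

lemma integral_circle_power: "(\<integral>\<zeta>. \<zeta> ^ n \<partial>circle_measure) = (if n = 0 then 1 else 0)"
proof (cases "n = 0")
  case False
  define F where "F \<theta> = cis (n * \<theta>) / (\<i> * n)" for \<theta> :: real
  have "(\<integral>\<theta>. indicator {0..2 * pi} \<theta> *\<^sub>R (cis \<theta> ^ n) \<partial>lborel) = F (2 * pi) - F 0"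
  proof (rule integral_FTC_Icc)
    show "(F has_vector_derivative cis x ^ n) (at x within {0..2 * pi})" for x
    proof -
      have "((\<lambda>\<theta>. exp (\<i> * (n * of_real \<theta>)) / (\<i> * n)) has_vector_derivative exp (\<i> * (n * of_real x))) (at x within {0..2 * pi})"
        using False
        by (auto intro!: derivative_eq_intros has_vector_derivative_real_field[where f="\<lambda>t. exp (\<i> * (n * t)) / (\<i> * n)", unfolded o_def]
          simp: field_simps)
      then show ?thesis by (simp add: F_def[abs_def] cis_conv_exp exp_of_nat_mult[symmetric] mult_ac)
    qed
  qed (auto intro!: continuous_intros)
  also have "\<dots> = 0"
    using cis_multiple_2pi[of "of_nat n"] by (simp add: F_def mult_ac)
  finally show ?thesis using False by (subst integral_circle_borel) (auto intro!: continuous_intros)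
qed (use circle.prob_space in simp)

lemma measurable_circle_indicator:
  "B \<in> sets borel \<Longrightarrow> (\<lambda>\<zeta>. complex_of_real (indicator B \<zeta>)) \<in> borel_measurable circle_measure"
  by (intro borel_measurable_circle borel_measurable_of_real) simp

lemma integrable_circle_mult_bounded:
  fixes g k :: "complex \<Rightarrow> complex"
  assumes g: "integrable circle_measure g" and k: "k \<in> borel_measurable circle_measure"
    and bound: "AE \<zeta> in circle_measure. norm (k \<zeta>) \<le> B"
  shows "integrable circle_measure (\<lambda>\<zeta>. g \<zeta> * k \<zeta>)"
proof (rule Bochner_Integration.integrable_bound)
  show "integrable circle_measure (\<lambda>\<zeta>. B * norm (g \<zeta>))"
    using g by simp
  show "(\<lambda>\<zeta>. g \<zeta> * k \<zeta>) \<in> borel_measurable circle_measure"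
    by (intro borel_measurable_times borel_measurable_integrable[OF g] k)
  show "AE \<zeta> in circle_measure. norm (g \<zeta> * k \<zeta>) \<le> norm (B * norm (g \<zeta>))"
    using bound
  proof eventually_elim
    case (elim \<zeta>)
    then have "norm (g \<zeta> * k \<zeta>) \<le> B * norm (g \<zeta>)"
      by (simp add: norm_mult mult.commute[of B] mult_left_mono)
    then show ?case
      by (simp add: order_trans[OF _ abs_ge_self])
  qed
qed

section \<open>Vanishing moments under polynomial weights\<close>

lemma integrable_circle_monomial:
  fixes g :: "complex \<Rightarrow> complex"
  assumes "integrable circle_measure g"
  shows "integrable circle_measure (\<lambda>\<zeta>. g \<zeta> * (\<zeta> ^ i * cnj \<zeta> ^ j))"
  using assms
proof (rule integrable_circle_mult_bounded)
  show "(\<lambda>\<zeta>. \<zeta> ^ i * cnj \<zeta> ^ j) \<in> borel_measurable circle_measure"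
    by (intro measurable_circle_continuous_on continuous_intros)
  show "AE \<zeta> in circle_measure. norm (\<zeta> ^ i * cnj \<zeta> ^ j) \<le> 1"
    using AE_circle_norm by eventually_elim (simp add: norm_mult norm_power)
qed

text \<open>The vanishing of all moments is inherited by the weighted function, which lets the
  induction pass through products: \<open>f\<close> times the first factor is again an admissible
  \<open>f\<close> for the second.\<close>

lemma annihilate_circle_real_polynomial:
  fixes f :: "complex \<Rightarrow> complex"
  assumes "real_polynomial_function p" "integrable circle_measure f"
    "\<And>i j. (\<integral>\<zeta>. f \<zeta> * (\<zeta> ^ i * cnj \<zeta> ^ j) \<partial>circle_measure) = 0"
  shows "integrable circle_measure (\<lambda>\<zeta>. f \<zeta> * of_real (p \<zeta>)) \<and>
    (\<forall>i j. (\<integral>\<zeta>. (f \<zeta> * of_real (p \<zeta>)) * (\<zeta> ^ i * cnj \<zeta> ^ j) \<partial>circle_measure) = 0)"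
  using assms
proof (induction arbitrary: f rule: real_polynomial_function.induct)
  case (linear p)
  \<comment> \<open>A real-linear functional is determined by its values at \<open>1\<close> and
    \<open>\<i>\<close>; expressing \<open>Re\<close> and \<open>Im\<close> by
    \<open>\<zeta>\<close> and \<open>cnj \<zeta>\<close> yields this coefficient. Multiplication by
    \<open>p\<close> then merely raises one of the two exponents.\<close>
  define \<alpha> where "\<alpha> = Complex (p 1 / 2) (- p \<i> / 2)"
  have p: "of_real (p \<zeta>) = \<alpha> * \<zeta> + cnj \<alpha> * cnj \<zeta>" for \<zeta>
  proof -
    have "\<zeta> = Re \<zeta> *\<^sub>R 1 + Im \<zeta> *\<^sub>R \<i>"
      by (simp add: complex_eq_iff)
    then have "p \<zeta> = Re \<zeta> * p 1 + Im \<zeta> * p \<i>"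
      using linear_add[OF bounded_linear.linear[OF linear(1)]] linear_cmul[OF bounded_linear.linear[OF linear(1)]]
      by (metis real_scaleR_def)
    then show ?thesis
      by (simp add: \<alpha>_def complex_eq_iff)
  qed
  note mono = integrable_circle_monomial[OF linear(2)]
  have eq: "(f \<zeta> * of_real (p \<zeta>)) * (\<zeta> ^ i * cnj \<zeta> ^ j)
    = \<alpha> * (f \<zeta> * (\<zeta> ^ Suc i * cnj \<zeta> ^ j)) + cnj \<alpha> * (f \<zeta> * (\<zeta> ^ i * cnj \<zeta> ^ Suc j))" for \<zeta> i j
    by (simp add: p algebra_simps)
  have "integrable circle_measure (\<lambda>\<zeta>. f \<zeta> * of_real (p \<zeta>) * (\<zeta> ^ 0 * cnj \<zeta> ^ 0))"
    unfolding eq by (intro Bochner_Integration.integrable_add integrable_mult_right mono)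
  moreover have "(\<integral>\<zeta>. (f \<zeta> * of_real (p \<zeta>)) * (\<zeta> ^ i * cnj \<zeta> ^ j) \<partial>circle_measure) = 0" for i j
    unfolding eq by (subst Bochner_Integration.integral_add)
      (simp_all only: integrable_mult_right mono integral_mult_right_zero linear(3) mult_zero_right add_0)
  ultimately show ?case by simp
next
  case (const c)
  then show ?case
    by (simp add: mult.assoc mult.left_commute[of _ "complex_of_real c"])
next
  case (add p q)
  note 1 = add.IH(1)[OF add.prems] and 2 = add.IH(2)[OF add.prems]
  show ?case
    using 1 2 integrable_circle_monomial[OF conjunct1[OF 1]] integrable_circle_monomial[OF conjunct1[OF 2]]
    by (simp add: algebra_simps)
next
  case (mult p q)
  show ?case
    using mult.IH(2)[of "\<lambda>\<zeta>. f \<zeta> * of_real (p \<zeta>)"] mult.IH(1)[OF mult.prems]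
    by (simp add: mult.assoc)
qed

section \<open>Uniqueness of Fourier coefficients\<close>

text \<open>By Stone-Weierstrass a polynomial approximates \<open>\<phi>\<close> uniformly within
  \<open>e\<close>; its integral against \<open>f\<close> vanishes, and the error costs at most
  \<open>e\<close> times the L1 norm of \<open>f\<close>.\<close>

lemma annihilate_circle_continuous:
  fixes f :: "complex \<Rightarrow> complex" and \<phi> :: "complex \<Rightarrow> real"
  assumes f: "integrable circle_measure f"
    and f0: "\<And>i j. (\<integral>\<zeta>. f \<zeta> * (\<zeta> ^ i * cnj \<zeta> ^ j) \<partial>circle_measure) = 0"
    and \<phi>: "continuous_on (sphere 0 1) \<phi>"
  shows "(\<integral>\<zeta>. f \<zeta> * of_real (\<phi> \<zeta>) \<partial>circle_measure) = 0"
proof -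
  define I where "I = (\<integral>\<zeta>. norm (f \<zeta>) \<partial>circle_measure)"
  have "I \<ge> 0" by (simp add: I_def)
  have bound: "norm (\<integral>\<zeta>. f \<zeta> * of_real (\<phi> \<zeta>) \<partial>circle_measure) \<le> e * I" if "e > 0" for e
  proof -
    obtain p where p: "real_polynomial_function p" "\<And>x. x \<in> sphere 0 1 \<Longrightarrow> \<bar>\<phi> x - p x\<bar> < e"
      using Stone_Weierstrass_real_polynomial_function[OF compact_sphere \<phi> \<open>e > 0\<close>] by metis
    have pi: "integrable circle_measure (\<lambda>\<zeta>. f \<zeta> * of_real (p \<zeta>))"
      and p0: "(\<integral>\<zeta>. f \<zeta> * of_real (p \<zeta>) \<partial>circle_measure) = 0"
      using conjunct1[OF annihilate_circle_real_polynomial[OF p(1) f f0]]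
        conjunct2[OF annihilate_circle_real_polynomial[OF p(1) f f0], rule_format, of 0 0]
      by simp_all
    have m: "(\<lambda>\<zeta>. complex_of_real (\<phi> \<zeta> - p \<zeta>)) \<in> borel_measurable circle_measure"
      using p(1) by (intro measurable_circle_continuous_on continuous_intros \<phi> continuous_on_polymonial_function)
        (simp add: real_polynomial_function_eq)
    have b: "AE \<zeta> in circle_measure. norm (complex_of_real (\<phi> \<zeta> - p \<zeta>)) \<le> e"
      by (rule AE_I2) (use p(2) in \<open>simp add: less_imp_le flip: of_real_diff\<close>)
    have di: "integrable circle_measure (\<lambda>\<zeta>. f \<zeta> * of_real (\<phi> \<zeta> - p \<zeta>))"
      by (rule integrable_circle_mult_bounded[OF f m b])
    have "(\<integral>\<zeta>. f \<zeta> * of_real (\<phi> \<zeta>) \<partial>circle_measure)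
      = (\<integral>\<zeta>. f \<zeta> * of_real (\<phi> \<zeta> - p \<zeta>) + f \<zeta> * of_real (p \<zeta>) \<partial>circle_measure)"
      by (simp add: algebra_simps)
    also have "\<dots> = (\<integral>\<zeta>. f \<zeta> * of_real (\<phi> \<zeta> - p \<zeta>) \<partial>circle_measure)"
      by (subst Bochner_Integration.integral_add[OF di pi]) (simp add: p0)
    also have "norm \<dots> \<le> (\<integral>\<zeta>. e * norm (f \<zeta>) \<partial>circle_measure)"
    proof (rule Bochner_Integration.integral_norm_bound_integral[OF di])
      show "norm (f \<zeta> * of_real (\<phi> \<zeta> - p \<zeta>)) \<le> e * norm (f \<zeta>)" if "\<zeta> \<in> space circle_measure" for \<zeta>
        using p(2)[of \<zeta>] that mult_left_mono[of "\<bar>\<phi> \<zeta> - p \<zeta>\<bar>" e "norm (f \<zeta>)"]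
        by (simp add: norm_mult mult.commute del: of_real_diff)
    qed (use f in simp)
    finally show ?thesis by (simp add: I_def)
  qed
  have "norm (\<integral>\<zeta>. f \<zeta> * of_real (\<phi> \<zeta>) \<partial>circle_measure) \<le> 0"
  proof (rule field_le_epsilon)
    fix e :: real assume "e > 0"
    \<comment> \<open>The denominator \<open>I + 1\<close> covers \<open>I = 0\<close> as
      well.\<close>
    then have "e / (I + 1) * I \<le> e"
      using \<open>I \<ge> 0\<close> by (simp add: field_simps)
    then show "norm (\<integral>\<zeta>. f \<zeta> * of_real (\<phi> \<zeta>) \<partial>circle_measure) \<le> 0 + e"
      using bound[of "e / (I + 1)"] \<open>e > 0\<close> \<open>I \<ge> 0\<close> by simp
  qed
  then show ?thesis by simp
qed

lemma annihilate_circle_closed: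
  fixes f :: "complex \<Rightarrow> complex"
  assumes f: "integrable circle_measure f"
    and f0: "\<And>i j. (\<integral>\<zeta>. f \<zeta> * (\<zeta> ^ i * cnj \<zeta> ^ j) \<partial>circle_measure) = 0"
    and C: "closed C"
  shows "(\<integral>\<zeta>. f \<zeta> * of_real (indicator C \<zeta>) \<partial>circle_measure) = 0"
proof (cases "C = {}")
  case False
  \<comment> \<open>The base is 1 on \<open>C\<close> and lies in \<open>[0, 1)\<close> off
    \<open>C\<close>, so its powers tend to the indicator. The empty set is treated apart because
    \<open>infdist\<close> to it is 0 by convention.\<close>
  define \<phi> where "\<phi> n \<zeta> = (1 - min 1 (infdist \<zeta> C)) ^ n" for n :: nat and \<zeta>
  have lim: "(\<lambda>n. \<phi> n \<zeta>) \<longlonglongrightarrow> indicator C \<zeta>" for \<zeta>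
  proof (cases "\<zeta> \<in> C")
    case False
    then have "infdist \<zeta> C > 0"
      using in_closed_iff_infdist_zero[OF C \<open>C \<noteq> {}\<close>, of \<zeta>] infdist_nonneg[of \<zeta> C] by simp
    with False show ?thesis
      by (auto simp: \<phi>_def min_def intro!: LIMSEQ_realpow_zero)
  qed (simp add: \<phi>_def)
  have m: "(\<lambda>\<zeta>. complex_of_real (\<phi> n \<zeta>)) \<in> borel_measurable circle_measure" for n
    unfolding \<phi>_def by (intro measurable_circle_continuous_on continuous_intros)
  note mi = measurable_circle_indicator[OF borel_closed[OF C]]
  have "(\<lambda>n. \<integral>\<zeta>. f \<zeta> * of_real (\<phi> n \<zeta>) \<partial>circle_measure)
      \<longlonglongrightarrow> (\<integral>\<zeta>. f \<zeta> * of_real (indicator C \<zeta>) \<partial>circle_measure)"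
  proof (rule integral_dominated_convergence)
    show "integrable circle_measure (\<lambda>\<zeta>. norm (f \<zeta>))" using f by simp
    show "AE \<zeta> in circle_measure. (\<lambda>n. f \<zeta> * of_real (\<phi> n \<zeta>)) \<longlonglongrightarrow> f \<zeta> * of_real (indicator C \<zeta>)"
      by (intro AE_I2 tendsto_intros lim)
    show "AE \<zeta> in circle_measure. norm (f \<zeta> * of_real (\<phi> n \<zeta>)) \<le> norm (f \<zeta>)" for n
    proof (rule AE_I2)
      fix \<zeta>
      have "\<bar>\<phi> n \<zeta>\<bar> \<le> 1"
        using infdist_nonneg[of \<zeta> C] by (simp add: \<phi>_def power_abs power_le_one_iff)
      then show "norm (f \<zeta> * of_real (\<phi> n \<zeta>)) \<le> norm (f \<zeta>)"
        by (simp add: norm_mult mult_left_le)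
    qed
  qed (intro borel_measurable_times borel_measurable_integrable[OF f] m mi)+
  moreover have "(\<integral>\<zeta>. f \<zeta> * of_real (\<phi> n \<zeta>) \<partial>circle_measure) = 0" for n
    unfolding \<phi>_def by (intro annihilate_circle_continuous f f0 continuous_intros)
  ultimately show ?thesis
    by (simp add: LIMSEQ_const_iff)
qed simp

text \<open>Dynkin's argument: closed sets are stable under intersection and generate the Borel
  sets, and the vanishing survives complements and disjoint countable unions.\<close>

lemma annihilate_circle_borel:
  fixes f :: "complex \<Rightarrow> complex"
  assumes f: "integrable circle_measure f"
    and f0: "\<And>i j. (\<integral>\<zeta>. f \<zeta> * (\<zeta> ^ i * cnj \<zeta> ^ j) \<partial>circle_measure) = 0"
    and B: "B \<in> sets borel"
  shows "(\<integral>\<zeta>. f \<zeta> * of_real (indicator B \<zeta>) \<partial>circle_measure) = 0"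
proof -
  note m = measurable_circle_indicator
  have i: "integrable circle_measure (\<lambda>\<zeta>. f \<zeta> * of_real (indicator B \<zeta>))" if "B \<in> sets borel" for B
    using f m[OF that] by (rule integrable_circle_mult_bounded[where B=1]) (auto simp: indicator_def)
  have "Int_stable (Collect closed :: complex set set)" "Collect closed \<subseteq> Pow (UNIV :: complex set)" "B \<in> sigma_sets UNIV (Collect closed)"
    using B by (auto simp: borel_eq_closed Int_stable_def)
  then show ?thesis
  proof (rule sigma_sets_induct_disjoint)
    fix A assume "A \<in> sigma_sets UNIV (Collect closed)"
      and 0: "(\<integral>\<zeta>. f \<zeta> * of_real (indicator A \<zeta>) \<partial>circle_measure) = 0"
    then have A: "A \<in> sets borel" by (simp add: borel_eq_closed)
    have "(\<integral>\<zeta>. f \<zeta> \<partial>circle_measure) = 0" using f0[of 0 0] by simp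
    moreover have "f \<zeta> * of_real (indicator (UNIV - A) \<zeta>) = f \<zeta> - f \<zeta> * of_real (indicator A \<zeta>)" for \<zeta>
      by (simp add: indicator_def)
    ultimately show "(\<integral>\<zeta>. f \<zeta> * of_real (indicator (UNIV - A) \<zeta>) \<partial>circle_measure) = 0"
      by (simp only: Bochner_Integration.integral_diff[OF f i[OF A]] 0 diff_self)
  next
    fix A :: "nat \<Rightarrow> complex set" assume disj: "disjoint_family A"
      and "range A \<subseteq> sigma_sets UNIV (Collect closed)"
      and 0: "\<And>n. (\<integral>\<zeta>. f \<zeta> * of_real (indicator (A n) \<zeta>) \<partial>circle_measure) = 0"
    then have A: "A n \<in> sets borel" for n by (auto simp: borel_eq_closed)
    have "(\<lambda>n. \<integral>\<zeta>. f \<zeta> * of_real (indicator (\<Union>i<n. A i) \<zeta>) \<partial>circle_measure)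
        \<longlonglongrightarrow> (\<integral>\<zeta>. f \<zeta> * of_real (indicator (\<Union>i. A i) \<zeta>) \<partial>circle_measure)"
    proof (rule integral_dominated_convergence)
      show "integrable circle_measure (\<lambda>\<zeta>. norm (f \<zeta>))" using f by simp
      show "AE \<zeta> in circle_measure. (\<lambda>n. f \<zeta> * of_real (indicator (\<Union>i<n. A i) \<zeta>))
          \<longlonglongrightarrow> f \<zeta> * of_real (indicator (\<Union>i. A i) \<zeta>)"
        by (intro AE_I2 tendsto_intros LIMSEQ_indicator_UN)
      show "AE \<zeta> in circle_measure. norm (f \<zeta> * of_real (indicator (\<Union>i<n. A i) \<zeta>)) \<le> norm (f \<zeta>)" for n
        by (rule AE_I2) (simp add: indicator_def)
      show "(\<lambda>\<zeta>. f \<zeta> * of_real (indicator (\<Union>i. A i) \<zeta>)) \<in> borel_measurable circle_measure"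
        using A by (intro borel_measurable_times borel_measurable_integrable[OF f] m) blast
      show "(\<lambda>\<zeta>. f \<zeta> * of_real (indicator (\<Union>i<n. A i) \<zeta>)) \<in> borel_measurable circle_measure" for n
        using A by (intro borel_measurable_times borel_measurable_integrable[OF f] m) blast
    qed
    moreover have "(\<integral>\<zeta>. f \<zeta> * of_real (indicator (\<Union>i<n. A i) \<zeta>) \<partial>circle_measure) = 0" for n
    proof -
      have eq: "indicator (\<Union>i<n. A i) \<zeta> = (\<Sum>i<n. indicator (A i) \<zeta> :: real)" for \<zeta>
        using disj by (intro indicator_UN_disjoint) (auto simp: disjoint_family_on_def)
      have "(\<integral>\<zeta>. f \<zeta> * of_real (indicator (\<Union>i<n. A i) \<zeta>) \<partial>circle_measure)
        = (\<integral>\<zeta>. (\<Sum>i<n. f \<zeta> * of_real (indicator (A i) \<zeta>)) \<partial>circle_measure)"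
        by (simp only: eq sum_distrib_left of_real_sum)
      also have "\<dots> = (\<Sum>i<n. \<integral>\<zeta>. f \<zeta> * of_real (indicator (A i) \<zeta>) \<partial>circle_measure)"
        by (rule Bochner_Integration.integral_sum) (rule i[OF A])
      finally show ?thesis by (simp only: 0 sum.neutral_const)
    qed
    ultimately show "(\<integral>\<zeta>. f \<zeta> * of_real (indicator (\<Union>i. A i) \<zeta>) \<partial>circle_measure) = 0"
      by (simp only: LIMSEQ_const_iff)
  qed (simp_all add: annihilate_circle_closed[OF f f0])
qed

text \<open>Testing against the set where \<open>g\<close> is positive gives a vanishing integral of
  the positive part. As \<open>circle_measure\<close> is a completion, that set need not be Borel: a
  Borel version \<open>g'\<close> is used, whose positivity set is the trace on the circle of a
  Borel set \<open>B\<close> of the plane.\<close>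

lemma AE_circle_zeroI_real:
  fixes g :: "complex \<Rightarrow> real"
  assumes g: "integrable circle_measure g"
    and g0: "\<And>B. B \<in> sets borel \<Longrightarrow> (\<integral>\<zeta>. g \<zeta> * indicator B \<zeta> \<partial>circle_measure) = 0"
  shows "AE \<zeta> in circle_measure. g \<zeta> \<le> 0"
proof -
  obtain g' where g': "g' \<in> borel_measurable circle_borel" "AE \<zeta> in circle_borel. g \<zeta> = g' \<zeta>"
    using completion_ex_borel_measurable_real borel_measurable_integrable[OF g]
    unfolding circle_measure_def by blast
  have ae: "AE \<zeta> in circle_measure. g \<zeta> = g' \<zeta>"
    using g'(2) unfolding circle_measure_def by (rule AE_completion)
  have "g' -` {0<..} \<inter> space circle_borel \<in> sets circle_borel"
    using g'(1) by (rule measurable_sets) simp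
  then have "g' -` {0<..} \<inter> sphere 0 1 \<in> (\<inter>) (sphere 0 1) ` sets borel"
    by (simp only: sets_distr space_distr sets_restrict_space space_restrict_space space_borel Int_UNIV_right)
  then obtain B where B: "B \<in> sets borel" "g' -` {0<..} \<inter> sphere 0 1 = sphere 0 1 \<inter> B"
    by (rule imageE) (rule that; assumption)
  have eq: "AE \<zeta> in circle_measure. g \<zeta> * indicator B \<zeta> = max 0 (g \<zeta>)"
    using ae AE_circle_norm
  proof eventually_elim
    case (elim \<zeta>)
    have "\<zeta> \<in> g' -` {0<..} \<inter> sphere 0 1 \<longleftrightarrow> \<zeta> \<in> sphere 0 1 \<inter> B"
      by (simp only: B(2))
    with elim(2) have "\<zeta> \<in> B \<longleftrightarrow> g' \<zeta> > 0" by simp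
    with elim(1) show ?case by (auto simp add: indicator_def max_def)
  qed
  have "(\<integral>\<zeta>. max 0 (g \<zeta>) \<partial>circle_measure) = 0"
  proof -
    have "(\<integral>\<zeta>. g \<zeta> * indicator B \<zeta> \<partial>circle_measure) = (\<integral>\<zeta>. max 0 (g \<zeta>) \<partial>circle_measure)"
      using g B(1) by (intro integral_cong_AE eq borel_measurable_times borel_measurable_max
        borel_measurable_const borel_measurable_integrable borel_measurable_circle[OF borel_measurable_indicator])
    then show ?thesis using g0[OF B(1)] by simp
  qed
  then have "AE \<zeta> in circle_measure. max 0 (g \<zeta>) = 0"
    using integral_nonneg_eq_0_iff_AE[of circle_measure "\<lambda>\<zeta>. max 0 (g \<zeta>)"] g by simp
  then show ?thesis by eventually_elim (simp add: max_def split: if_splits)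
qed

lemma AE_circle_zeroI:
  fixes f :: "complex \<Rightarrow> complex"
  assumes f: "integrable circle_measure f"
    and f0: "\<And>i j. (\<integral>\<zeta>. f \<zeta> * (\<zeta> ^ i * cnj \<zeta> ^ j) \<partial>circle_measure) = 0"
  shows "AE \<zeta> in circle_measure. f \<zeta> = 0"
proof -
  have *: "(\<integral>\<zeta>. Re (c * f \<zeta>) * indicator B \<zeta> \<partial>circle_measure) = 0" if B: "B \<in> sets borel" for c B
  proof -
    note m = measurable_circle_indicator[OF B]
    have i: "integrable circle_measure (\<lambda>\<zeta>. c * (f \<zeta> * of_real (indicator B \<zeta>)))"
      using f m by (intro integrable_mult_right integrable_circle_mult_bounded[where B=1]) (auto simp: indicator_def)
    have "(\<integral>\<zeta>. Re (c * (f \<zeta> * of_real (indicator B \<zeta>))) \<partial>circle_measure) = 0"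
      by (subst integral_Re[OF i]) (simp add: annihilate_circle_borel[OF f f0 B])
    then show ?thesis by (simp add: algebra_simps)
  qed
  have "AE \<zeta> in circle_measure. Re (c * f \<zeta>) \<le> 0" for c
    using f * by (intro AE_circle_zeroI_real integrable_Re integrable_mult_right)
  \<comment> \<open>These four rotations bound the real and the imaginary part from both
    sides.\<close>
  from this[of 1] this[of "-1"] this[of \<i>] this[of "-\<i>"]
  show ?thesis
    by eventually_elim (simp add: complex_eq_iff)
qed

section \<open>The space L2 of the circle\<close>

lemma L2_measurable: "f \<in> L2_circle \<Longrightarrow> f \<in> borel_measurable circle_measure"
  by (simp add: L2_circle_def)

lemma L2_integrable_square: "f \<in> L2_circle \<Longrightarrow> integrable circle_measure (\<lambda>\<zeta>. (cmod (f \<zeta>))\<^sup>2)"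
  by (simp add: L2_circle_def)

lemma L2_bound:
  assumes "f \<in> borel_measurable circle_measure" "integrable circle_measure g"
    "AE \<zeta> in circle_measure. (cmod (f \<zeta>))\<^sup>2 \<le> g \<zeta>"
  shows "f \<in> L2_circle"
proof -
  have "integrable circle_measure (\<lambda>\<zeta>. (cmod (f \<zeta>))\<^sup>2)"
    by (rule Bochner_Integration.integrable_bound[OF assms(2)])
      (use assms(1,3) in \<open>auto intro: order_trans[OF _ abs_ge_self]\<close>)
  with assms(1) show ?thesis by (simp add: L2_circle_def)
qed

lemma L2_bounded:
  assumes "f \<in> borel_measurable circle_measure" "AE \<zeta> in circle_measure. cmod (f \<zeta>) \<le> B"
  shows "f \<in> L2_circle"
proof (rule L2_bound[OF assms(1)])
  show "integrable circle_measure (\<lambda>_. B\<^sup>2)" by simp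
  show "AE \<zeta> in circle_measure. (cmod (f \<zeta>))\<^sup>2 \<le> B\<^sup>2"
    using assms(2) by eventually_elim (simp add: power_mono)
qed

lemma AE_circle_bounded:
  fixes f :: "complex \<Rightarrow> complex"
  assumes "continuous_on (sphere 0 1) f"
  obtains B where "AE \<zeta> in circle_measure. cmod (f \<zeta>) \<le> B"
proof -
  have "compact (f ` sphere 0 1)"
    by (rule compact_continuous_image[OF assms compact_sphere])
  then obtain B where "\<And>\<zeta>. \<zeta> \<in> sphere 0 1 \<Longrightarrow> cmod (f \<zeta>) \<le> B"
    by (meson bounded_iff compact_imp_bounded imageI)
  then show ?thesis
    by (intro that[of B] AE_I2) simp
qed

lemma L2_continuous:
  assumes "continuous_on (sphere 0 1) f"
  shows "f \<in> L2_circle"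
proof -
  obtain B where "AE \<zeta> in circle_measure. cmod (f \<zeta>) \<le> B"
    using AE_circle_bounded[OF assms] .
  then show ?thesis
    by (intro L2_bounded measurable_circle_continuous_on assms)
qed

lemma cmod_add_square_le: "(cmod (x + y))\<^sup>2 \<le> 2 * (cmod x)\<^sup>2 + 2 * (cmod y)\<^sup>2"
proof -
  have "(cmod (x + y))\<^sup>2 \<le> (cmod x + cmod y)\<^sup>2"
    by (intro power_mono norm_triangle_ineq) simp
  also have "\<dots> \<le> 2 * (cmod x)\<^sup>2 + 2 * (cmod y)\<^sup>2"
    using sum_squares_bound[of "cmod x" "cmod y"] by (simp add: power2_sum)
  finally show ?thesis .
qed

lemma L2_add:
  assumes "f \<in> L2_circle" "g \<in> L2_circle"
  shows "(\<lambda>\<zeta>. f \<zeta> + g \<zeta>) \<in> L2_circle"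
  by (rule L2_bound[where g="\<lambda>\<zeta>. 2 * (cmod (f \<zeta>))\<^sup>2 + 2 * (cmod (g \<zeta>))\<^sup>2"])
    (use assms in \<open>auto simp: L2_circle_def intro!: cmod_add_square_le\<close>)

lemma L2_mult_bounded:
  assumes "f \<in> L2_circle" "k \<in> borel_measurable circle_measure" "AE \<zeta> in circle_measure. cmod (k \<zeta>) \<le> B"
  shows "(\<lambda>\<zeta>. f \<zeta> * k \<zeta>) \<in> L2_circle"
proof (rule L2_bound)
  show "(\<lambda>\<zeta>. f \<zeta> * k \<zeta>) \<in> borel_measurable circle_measure"
    by (intro borel_measurable_times L2_measurable assms)
  show "integrable circle_measure (\<lambda>\<zeta>. B\<^sup>2 * (cmod (f \<zeta>))\<^sup>2)"
    using assms by (simp add: L2_circle_def)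
  show "AE \<zeta> in circle_measure. (cmod (f \<zeta> * k \<zeta>))\<^sup>2 \<le> B\<^sup>2 * (cmod (f \<zeta>))\<^sup>2"
    using assms(3)
  proof eventually_elim
    case (elim \<zeta>)
    then have "(cmod (k \<zeta>))\<^sup>2 \<le> B\<^sup>2" by (simp add: power_mono)
    then show ?case
      by (simp add: norm_mult power_mult_distrib mult.commute[of "B\<^sup>2"] mult_left_mono)
  qed
qed

lemma L2_cmult: "f \<in> L2_circle \<Longrightarrow> (\<lambda>\<zeta>. c * f \<zeta>) \<in> L2_circle"
  using L2_mult_bounded[of f "\<lambda>_. c" "cmod c"] by (simp add: mult.commute)

lemma L2_diff: "f \<in> L2_circle \<Longrightarrow> g \<in> L2_circle \<Longrightarrow> (\<lambda>\<zeta>. f \<zeta> - g \<zeta>) \<in> L2_circle"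
  using L2_add[OF _ L2_cmult[of g "-1"]] by simp

lemma L2_cnj: "f \<in> L2_circle \<Longrightarrow> (\<lambda>\<zeta>. cnj (f \<zeta>)) \<in> L2_circle"
  using borel_measurable_continuous_on[OF continuous_on_cnj[OF continuous_on_id], of f circle_measure]
  by (simp add: L2_circle_def)

lemma L2_const: "(\<lambda>\<zeta>. c) \<in> L2_circle"
  by (simp add: L2_circle_def)

lemma L2_integrable:
  assumes "f \<in> L2_circle"
  shows "integrable circle_measure f"
proof -
  have "integrable circle_measure (\<lambda>\<zeta>. cmod (f \<zeta>))"
    by (rule circle.square_integrable_imp_integrable[OF measurable_compose[OF L2_measurable[OF assms] borel_measurable_norm]
        L2_integrable_square[OF assms]])
  then show ?thesis
    by (rule iffD1[OF integrable_norm_iff[OF L2_measurable[OF assms]]])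
qed

lemma L2_mult_integrable:
  assumes "f \<in> L2_circle" "g \<in> L2_circle"
  shows "integrable circle_measure (\<lambda>\<zeta>. f \<zeta> * g \<zeta>)"
proof (rule Bochner_Integration.integrable_bound)
  show "integrable circle_measure (\<lambda>\<zeta>. (cmod (f \<zeta>))\<^sup>2 + (cmod (g \<zeta>))\<^sup>2)"
    using assms by (simp add: L2_circle_def)
  show "(\<lambda>\<zeta>. f \<zeta> * g \<zeta>) \<in> borel_measurable circle_measure"
    by (intro borel_measurable_times L2_measurable assms)
  show "AE \<zeta> in circle_measure. norm (f \<zeta> * g \<zeta>) \<le> norm ((cmod (f \<zeta>))\<^sup>2 + (cmod (g \<zeta>))\<^sup>2)"
  proof (rule AE_I2)
    fix \<zeta>
    have "2 * (cmod (f \<zeta>) * cmod (g \<zeta>)) \<le> (cmod (f \<zeta>))\<^sup>2 + (cmod (g \<zeta>))\<^sup>2"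
      using sum_squares_bound[of "cmod (f \<zeta>)" "cmod (g \<zeta>)"] by simp
    moreover have "0 \<le> cmod (f \<zeta>) * cmod (g \<zeta>)" by simp
    ultimately show "norm (f \<zeta> * g \<zeta>) \<le> norm ((cmod (f \<zeta>))\<^sup>2 + (cmod (g \<zeta>))\<^sup>2)"
      unfolding norm_mult real_norm_def by linarith
  qed
qed

section \<open>Cauchy-Schwarz, convergence and completeness in L2\<close>

lemma L2_cauchy_schwarz:
  assumes "f \<in> L2_circle" "g \<in> L2_circle"
  shows "(cmod (\<integral>\<zeta>. f \<zeta> * g \<zeta> \<partial>circle_measure))\<^sup>2
    \<le> (\<integral>\<zeta>. (cmod (f \<zeta>))\<^sup>2 \<partial>circle_measure) * (\<integral>\<zeta>. (cmod (g \<zeta>))\<^sup>2 \<partial>circle_measure)"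
proof -
  have fm: "f \<in> borel_measurable circle_measure" "g \<in> borel_measurable circle_measure"
    using assms by (simp_all add: L2_circle_def)
  have i: "integrable circle_measure (\<lambda>\<zeta>. cmod (f \<zeta>) * cmod (g \<zeta>))"
    using integrable_norm[OF L2_mult_integrable[OF assms]] by (simp add: norm_mult)
  have "(\<integral>\<^sup>+\<zeta>. ennreal (cmod (f \<zeta>)) * ennreal (cmod (g \<zeta>)) \<partial>circle_measure)\<^sup>2
    \<le> (\<integral>\<^sup>+\<zeta>. (ennreal (cmod (f \<zeta>)))\<^sup>2 \<partial>circle_measure) * (\<integral>\<^sup>+\<zeta>. (ennreal (cmod (g \<zeta>)))\<^sup>2 \<partial>circle_measure)"
    using fm by (intro Cauchy_Schwarz_nn_integral) simp_all
  then have "ennreal ((\<integral>\<zeta>. cmod (f \<zeta>) * cmod (g \<zeta>) \<partial>circle_measure)\<^sup>2)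
    \<le> ennreal ((\<integral>\<zeta>. (cmod (f \<zeta>))\<^sup>2 \<partial>circle_measure) * (\<integral>\<zeta>. (cmod (g \<zeta>))\<^sup>2 \<partial>circle_measure))"
    using assms i
    by (simp add: nn_integral_eq_integral L2_integrable_square ennreal_power ennreal_mult[symmetric])
  then have "(\<integral>\<zeta>. cmod (f \<zeta>) * cmod (g \<zeta>) \<partial>circle_measure)\<^sup>2
    \<le> (\<integral>\<zeta>. (cmod (f \<zeta>))\<^sup>2 \<partial>circle_measure) * (\<integral>\<zeta>. (cmod (g \<zeta>))\<^sup>2 \<partial>circle_measure)"
    by (subst (asm) ennreal_le_iff) simp_all
  moreover have "cmod (\<integral>\<zeta>. f \<zeta> * g \<zeta> \<partial>circle_measure) \<le> (\<integral>\<zeta>. cmod (f \<zeta>) * cmod (g \<zeta>) \<partial>circle_measure)"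
    using integral_norm_bound[of circle_measure "\<lambda>\<zeta>. f \<zeta> * g \<zeta>"] by (simp add: norm_mult)
  ultimately show ?thesis
    using power_mono[OF _ norm_ge_zero, of _ _ 2] order_trans by blast
qed

definition L2_tendsto :: "(nat \<Rightarrow> complex \<Rightarrow> complex) \<Rightarrow> (complex \<Rightarrow> complex) \<Rightarrow> bool" where
  "L2_tendsto u f \<longleftrightarrow> (\<lambda>k. \<integral>\<zeta>. (cmod (u k \<zeta> - f \<zeta>))\<^sup>2 \<partial>circle_measure) \<longlonglongrightarrow> 0"

text \<open>With \<open>du\<close> and \<open>dv\<close> the errors,
  \<open>u v = du dv + du g + f dv + f g\<close>, and Cauchy-Schwarz sends the first three integrals
  to 0.\<close>

lemma L2_tendsto_integral_mult:
  assumes u: "\<And>k. u k \<in> L2_circle" "f \<in> L2_circle" "L2_tendsto u f"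
    and v: "\<And>k. v k \<in> L2_circle" "g \<in> L2_circle" "L2_tendsto v g"
  shows "(\<lambda>k. \<integral>\<zeta>. u k \<zeta> * v k \<zeta> \<partial>circle_measure) \<longlonglongrightarrow> (\<integral>\<zeta>. f \<zeta> * g \<zeta> \<partial>circle_measure)"
proof -
  have to0: "(\<lambda>k. \<integral>\<zeta>. a k \<zeta> * b k \<zeta> \<partial>circle_measure) \<longlonglongrightarrow> 0"
    if "\<And>k. a k \<in> L2_circle" "\<And>k. b k \<in> L2_circle" and lim: "(\<lambda>k. (\<integral>\<zeta>. (cmod (a k \<zeta>))\<^sup>2 \<partial>circle_measure) *
      (\<integral>\<zeta>. (cmod (b k \<zeta>))\<^sup>2 \<partial>circle_measure)) \<longlonglongrightarrow> 0" for a b :: "nat \<Rightarrow> complex \<Rightarrow> complex"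
  proof -
    have "(\<lambda>k. (cmod (\<integral>\<zeta>. a k \<zeta> * b k \<zeta> \<partial>circle_measure))\<^sup>2) \<longlonglongrightarrow> 0"
      by (rule tendsto_sandwich[OF _ _ tendsto_const lim]) (simp_all add: L2_cauchy_schwarz that)
    then have "(\<lambda>k. cmod (\<integral>\<zeta>. a k \<zeta> * b k \<zeta> \<partial>circle_measure)) \<longlonglongrightarrow> 0"
      using tendsto_real_sqrt by fastforce
    then show ?thesis by (simp add: tendsto_norm_zero_iff)
  qed
  define du dv where "du k \<zeta> = u k \<zeta> - f \<zeta>" and "dv k \<zeta> = v k \<zeta> - g \<zeta>" for k \<zeta>
  have du: "du k \<in> L2_circle" and dv: "dv k \<in> L2_circle" for k
    using u v by (auto simp: du_def[abs_def] dv_def[abs_def] intro: L2_diff)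
  have du0: "(\<lambda>k. \<integral>\<zeta>. (cmod (du k \<zeta>))\<^sup>2 \<partial>circle_measure) \<longlonglongrightarrow> 0"
    and dv0: "(\<lambda>k. \<integral>\<zeta>. (cmod (dv k \<zeta>))\<^sup>2 \<partial>circle_measure) \<longlonglongrightarrow> 0"
    using u v by (simp_all add: L2_tendsto_def du_def dv_def)
  have "(\<lambda>k. (\<integral>\<zeta>. du k \<zeta> * dv k \<zeta> \<partial>circle_measure) + (\<integral>\<zeta>. du k \<zeta> * g \<zeta> \<partial>circle_measure)
      + (\<integral>\<zeta>. f \<zeta> * dv k \<zeta> \<partial>circle_measure) + (\<integral>\<zeta>. f \<zeta> * g \<zeta> \<partial>circle_measure))
    \<longlonglongrightarrow> 0 + 0 + 0 + (\<integral>\<zeta>. f \<zeta> * g \<zeta> \<partial>circle_measure)"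
    using tendsto_mult[OF du0 dv0] tendsto_mult_right_zero[OF dv0] tendsto_mult_left_zero[OF du0]
    by (intro tendsto_add tendsto_const to0 du dv u v) simp_all
  moreover have "(\<integral>\<zeta>. du k \<zeta> * dv k \<zeta> \<partial>circle_measure) + (\<integral>\<zeta>. du k \<zeta> * g \<zeta> \<partial>circle_measure)
      + (\<integral>\<zeta>. f \<zeta> * dv k \<zeta> \<partial>circle_measure) + (\<integral>\<zeta>. f \<zeta> * g \<zeta> \<partial>circle_measure)
    = (\<integral>\<zeta>. u k \<zeta> * v k \<zeta> \<partial>circle_measure)" for k
  proof -
    have "(\<integral>\<zeta>. du k \<zeta> * dv k \<zeta> \<partial>circle_measure) + (\<integral>\<zeta>. du k \<zeta> * g \<zeta> \<partial>circle_measure)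
      + (\<integral>\<zeta>. f \<zeta> * dv k \<zeta> \<partial>circle_measure) + (\<integral>\<zeta>. f \<zeta> * g \<zeta> \<partial>circle_measure)
     = (\<integral>\<zeta>. du k \<zeta> * dv k \<zeta> + du k \<zeta> * g \<zeta> + f \<zeta> * dv k \<zeta> + f \<zeta> * g \<zeta> \<partial>circle_measure)"
      using u v du dv by (simp add: L2_mult_integrable)
    also have "\<dots> = (\<integral>\<zeta>. u k \<zeta> * v k \<zeta> \<partial>circle_measure)"
      by (simp add: du_def dv_def algebra_simps)
    finally show ?thesis .
  qed
  ultimately show ?thesis by simp
qed

lemma L2_tendsto_const [simp]: "L2_tendsto (\<lambda>_. f) f"
  by (simp add: L2_tendsto_def)

lemma L2_norm_le:
  assumes "f \<in> L2_circle"
  shows "(\<integral>\<zeta>. cmod (f \<zeta>) \<partial>circle_measure)\<^sup>2 \<le> (\<integral>\<zeta>. (cmod (f \<zeta>))\<^sup>2 \<partial>circle_measure)"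
proof -
  have f: "(\<lambda>\<zeta>. complex_of_real (cmod (f \<zeta>))) \<in> L2_circle"
    using assms L2_measurable[OF assms] by (simp add: L2_circle_def)
  have "(\<integral>\<zeta>. complex_of_real (cmod (f \<zeta>)) \<partial>circle_measure) = of_real (\<integral>\<zeta>. cmod (f \<zeta>) \<partial>circle_measure)"
    using L2_integrable[OF assms] by (intro integral_of_real) simp
  then show ?thesis
    using L2_cauchy_schwarz[OF f L2_const[of 1]] circle.prob_space by simp
qed

text \<open>On a probability space an L2-Cauchy sequence is L1-Cauchy, so a subsequence converges
  almost everywhere. Fatou's lemma along that subsequence, with the other index \<open>m\<close>
  fixed, bounds the L2 distance from \<open>u m\<close> to the limit.\<close>

lemma L2_complete:
  assumes u: "\<And>k. u k \<in> L2_circle"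
    and Cauchy: "\<And>e. e > 0 \<Longrightarrow> \<exists>N. \<forall>m\<ge>N. \<forall>n\<ge>N. (\<integral>\<zeta>. (cmod (u m \<zeta> - u n \<zeta>))\<^sup>2 \<partial>circle_measure) < e"
  obtains f where "f \<in> L2_circle" "L2_tendsto u f"
proof -
  have um: "u k \<in> borel_measurable circle_measure" for k by (rule L2_measurable[OF u])
  obtain r where r: "strict_mono r" and ae: "AE \<zeta> in circle_measure. Cauchy (\<lambda>i. u (r i) \<zeta>)"
  proof (rule cauchy_L1_AE_cauchy_subseq)
    show "integrable circle_measure (u n)" for n by (rule L2_integrable[OF u])
    fix e :: real assume "e > 0"
    then obtain N where N: "\<And>m n. m \<ge> N \<Longrightarrow> n \<ge> N \<Longrightarrow> (\<integral>\<zeta>. (cmod (u m \<zeta> - u n \<zeta>))\<^sup>2 \<partial>circle_measure) < e\<^sup>2"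
      using Cauchy[of "e\<^sup>2"] by auto
    have "(\<integral>\<zeta>. cmod (u m \<zeta> - u n \<zeta>) \<partial>circle_measure) < e" if "m \<ge> N" "n \<ge> N" for m n
    proof -
      have "(\<integral>\<zeta>. cmod (u m \<zeta> - u n \<zeta>) \<partial>circle_measure)\<^sup>2 < e\<^sup>2"
        using L2_norm_le[OF L2_diff[OF u u], of m n] N[OF that] by (rule le_less_trans)
      then show ?thesis using \<open>e > 0\<close> by (simp add: power_less_imp_less_base)
    qed
    then show "\<exists>N. \<forall>i\<ge>N. \<forall>j\<ge>N. (\<integral>\<zeta>. cmod (u i \<zeta> - u j \<zeta>) \<partial>circle_measure) < e" by blast
  qed
  define f where "f \<zeta> = lim (\<lambda>i. u (r i) \<zeta>)" for \<zeta>
  have fm: "f \<in> borel_measurable circle_measure"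
    unfolding f_def by (intro borel_measurable_lim_metric um)
  have lim: "AE \<zeta> in circle_measure. (\<lambda>i. u (r i) \<zeta>) \<longlonglongrightarrow> f \<zeta>"
    using ae by eventually_elim (simp add: f_def Cauchy_convergent convergent_LIMSEQ_iff[symmetric])
  have nn: "(\<integral>\<^sup>+\<zeta>. ennreal ((cmod (u m \<zeta> - u n \<zeta>))\<^sup>2) \<partial>circle_measure)
    = ennreal (\<integral>\<zeta>. (cmod (u m \<zeta> - u n \<zeta>))\<^sup>2 \<partial>circle_measure)" for m n
    by (rule nn_integral_eq_integral[OF L2_integrable_square[OF L2_diff[OF u u]]]) simp
  have close: "\<exists>N. \<forall>m\<ge>N. (\<integral>\<^sup>+\<zeta>. ennreal ((cmod (u m \<zeta> - f \<zeta>))\<^sup>2) \<partial>circle_measure) \<le> ennreal e" if "e > 0" for e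
  proof -
    obtain N where N: "\<And>m n. m \<ge> N \<Longrightarrow> n \<ge> N \<Longrightarrow> (\<integral>\<zeta>. (cmod (u m \<zeta> - u n \<zeta>))\<^sup>2 \<partial>circle_measure) < e"
      using Cauchy[OF \<open>e > 0\<close>] by auto
    have "(\<integral>\<^sup>+\<zeta>. ennreal ((cmod (u m \<zeta> - f \<zeta>))\<^sup>2) \<partial>circle_measure) \<le> ennreal e" if "m \<ge> N" for m
    proof -
      have "(\<integral>\<^sup>+\<zeta>. ennreal ((cmod (u m \<zeta> - f \<zeta>))\<^sup>2) \<partial>circle_measure)
        = (\<integral>\<^sup>+\<zeta>. liminf (\<lambda>i. ennreal ((cmod (u m \<zeta> - u (r i) \<zeta>))\<^sup>2)) \<partial>circle_measure)"
        using lim by (intro nn_integral_cong_AE, eventually_elim)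
          (intro lim_imp_Liminf[symmetric] trivial_limit_sequentially tendsto_ennrealI tendsto_intros)
      also have "\<dots> \<le> liminf (\<lambda>i. \<integral>\<^sup>+\<zeta>. ennreal ((cmod (u m \<zeta> - u (r i) \<zeta>))\<^sup>2) \<partial>circle_measure)"
        by (intro nn_integral_liminf measurable_compose[OF _ measurable_ennreal] borel_measurable_power
            measurable_compose[OF _ borel_measurable_norm] borel_measurable_diff um)
      also have "\<dots> \<le> ennreal e"
      proof (rule Liminf_le)
        show "\<forall>\<^sub>F i in sequentially. (\<integral>\<^sup>+\<zeta>. ennreal ((cmod (u m \<zeta> - u (r i) \<zeta>))\<^sup>2) \<partial>circle_measure) \<le> ennreal e"
          using eventually_ge_at_top[of N]
        proof eventually_elim
          case (elim i)
          then have "r i \<ge> N" using seq_suble[OF r, of i] by linarith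
          then show ?case unfolding nn using N[OF \<open>m \<ge> N\<close>, of "r i"] by (intro ennreal_leI less_imp_le)
        qed
      qed simp
      finally show ?thesis .
    qed
    then show ?thesis by blast
  qed
  have int: "integrable circle_measure (\<lambda>\<zeta>. (cmod (u m \<zeta> - f \<zeta>))\<^sup>2)"
    if "(\<integral>\<^sup>+\<zeta>. ennreal ((cmod (u m \<zeta> - f \<zeta>))\<^sup>2) \<partial>circle_measure) \<le> ennreal e" for m e
    using that um fm
    by (intro integrableI_bounded borel_measurable_power borel_measurable_norm borel_measurable_diff)
       (simp_all add: le_less_trans)
  obtain N1 where N1: "(\<integral>\<^sup>+\<zeta>. ennreal ((cmod (u N1 \<zeta> - f \<zeta>))\<^sup>2) \<partial>circle_measure) \<le> ennreal 1"
    using close[of 1] by auto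
  have "(\<lambda>\<zeta>. u N1 \<zeta> - f \<zeta>) \<in> L2_circle"
    using int[OF N1] um fm by (simp add: L2_circle_def)
  from L2_diff[OF u this, of N1] have f: "f \<in> L2_circle" by simp
  have "L2_tendsto u f"
    unfolding L2_tendsto_def
  proof (rule LIMSEQ_I)
    fix e :: real assume "e > 0"
    then obtain N where N: "\<And>m. m \<ge> N \<Longrightarrow> (\<integral>\<^sup>+\<zeta>. ennreal ((cmod (u m \<zeta> - f \<zeta>))\<^sup>2) \<partial>circle_measure) \<le> ennreal (e/2)"
      using close[of "e/2"] by auto
    have "(\<integral>\<zeta>. (cmod (u m \<zeta> - f \<zeta>))\<^sup>2 \<partial>circle_measure) \<le> e/2" if "m \<ge> N" for m
      using N[OF that] \<open>e > 0\<close> nn_integral_eq_integral[OF L2_integrable_square[OF L2_diff[OF u f]], of m]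
      by (simp add: ennreal_le_iff)
    then show "\<exists>no. \<forall>m\<ge>no. norm ((\<integral>\<zeta>. (cmod (u m \<zeta> - f \<zeta>))\<^sup>2 \<partial>circle_measure) - 0) < e"
      using \<open>e > 0\<close> by (intro exI[of _ N]) (fastforce intro: le_less_trans)
  qed
  with f show ?thesis by (rule that)
qed

section \<open>Fourier coefficients and the Hardy space\<close>

text \<open>Only nonnegative frequencies are indexed; the negative ones are the integrals against
  \<open>\<zeta> ^ n\<close> that occur in \<open>hardy2\<close>.\<close>

definition circle_coeff :: "(complex \<Rightarrow> complex) \<Rightarrow> nat \<Rightarrow> complex" where
  "circle_coeff f n = (\<integral>\<zeta>. f \<zeta> * cnj \<zeta> ^ n \<partial>circle_measure)"

lemma circle_monomial:
  assumes "cmod \<zeta> = 1"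
  shows "\<zeta> ^ i * cnj \<zeta> ^ j = (if j \<le> i then \<zeta> ^ (i - j) else cnj \<zeta> ^ (j - i))"
proof -
  have 1: "\<zeta> ^ k * cnj \<zeta> ^ k = 1" for k
    using assms by (simp add: power_mult_distrib[symmetric] complex_mult_cnj cmod_def)
  show ?thesis
  proof (cases "j \<le> i")
    case True
    then have "\<zeta> ^ i = \<zeta> ^ (i - j) * \<zeta> ^ j"
      by (simp add: power_add[symmetric])
    then show ?thesis
      using True 1[of j] by (simp add: mult.assoc)
  next
    case False
    then have "cnj \<zeta> ^ j = cnj \<zeta> ^ i * cnj \<zeta> ^ (j - i)"
      by (simp add: power_add[symmetric])
    then show ?thesis
      using False 1[of i] by (simp add: mult.assoc[symmetric])
  qed
qed

lemma integral_circle_cong: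
  fixes f g :: "complex \<Rightarrow> 'a::{banach,second_countable_topology}"
  shows "(\<And>\<zeta>. cmod \<zeta> = 1 \<Longrightarrow> f \<zeta> = g \<zeta>) \<Longrightarrow> (\<integral>\<zeta>. f \<zeta> \<partial>circle_measure) = (\<integral>\<zeta>. g \<zeta> \<partial>circle_measure)"
  by (intro Bochner_Integration.integral_cong) simp_all

lemma integral_circle_cnj_power: "(\<integral>\<zeta>. cnj \<zeta> ^ n \<partial>circle_measure) = (if n = 0 then 1 else 0)"
proof -
  have "(\<integral>\<zeta>. cnj \<zeta> ^ n \<partial>circle_measure) = cnj (\<integral>\<zeta>. \<zeta> ^ n \<partial>circle_measure)"
    by (simp flip: complex_cnj_power)
  then show ?thesis by (simp add: integral_circle_power)
qed

lemma integral_circle_monomial: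
  "(\<integral>\<zeta>. \<zeta> ^ i * cnj \<zeta> ^ j \<partial>circle_measure) = (if i = j then 1 else 0)"
proof (cases "j \<le> i")
  case True
  then have "(\<integral>\<zeta>. \<zeta> ^ i * cnj \<zeta> ^ j \<partial>circle_measure) = (\<integral>\<zeta>. \<zeta> ^ (i - j) \<partial>circle_measure)"
    by (intro integral_circle_cong) (simp add: circle_monomial)
  with True show ?thesis by (simp add: integral_circle_power)
next
  case False
  then have "(\<integral>\<zeta>. \<zeta> ^ i * cnj \<zeta> ^ j \<partial>circle_measure) = (\<integral>\<zeta>. cnj \<zeta> ^ (j - i) \<partial>circle_measure)"
    by (intro integral_circle_cong) (simp add: circle_monomial)
  with False show ?thesis by (simp add: integral_circle_cnj_power)
qed

text \<open>On the circle each mixed monomial collapses to a power of \<open>\<zeta>\<close> or of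
  \<open>cnj \<zeta>\<close>, so these coefficients are all the moments required by
  \<open>AE_circle_zeroI\<close>.\<close>

lemma circle_fourier_unique:
  assumes f: "integrable circle_measure f"
    and pos: "\<And>n. circle_coeff f n = 0" and neg: "\<And>n. n \<ge> 1 \<Longrightarrow> (\<integral>\<zeta>. f \<zeta> * \<zeta> ^ n \<partial>circle_measure) = 0"
  shows "AE \<zeta> in circle_measure. f \<zeta> = 0"
proof (rule AE_circle_zeroI[OF f])
  fix i j :: nat
  have pos': "(\<integral>\<zeta>. f \<zeta> \<partial>circle_measure) = 0" using pos[of 0] by (simp add: circle_coeff_def)
  show "(\<integral>\<zeta>. f \<zeta> * (\<zeta> ^ i * cnj \<zeta> ^ j) \<partial>circle_measure) = 0"
  proof (cases "j \<le> i")
    case True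
    then have "(\<integral>\<zeta>. f \<zeta> * (\<zeta> ^ i * cnj \<zeta> ^ j) \<partial>circle_measure) = (\<integral>\<zeta>. f \<zeta> * \<zeta> ^ (i - j) \<partial>circle_measure)"
      by (intro integral_circle_cong) (simp add: circle_monomial)
    then show ?thesis using neg[of "i - j"] pos' by (cases "i - j = 0") simp_all
  next
    case False
    then have "(\<integral>\<zeta>. f \<zeta> * (\<zeta> ^ i * cnj \<zeta> ^ j) \<partial>circle_measure) = circle_coeff f (j - i)"
      unfolding circle_coeff_def by (intro integral_circle_cong) (simp add: circle_monomial)
    then show ?thesis using pos by simp
  qed
qed

lemma integrable_circle_power:
  assumes "integrable circle_measure f"
  shows "integrable circle_measure (\<lambda>\<zeta>. f \<zeta> * \<zeta> ^ n)" "integrable circle_measure (\<lambda>\<zeta>. f \<zeta> * cnj \<zeta> ^ n)"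
  using integrable_circle_monomial[OF assms, of n 0] integrable_circle_monomial[OF assms, of 0 n] by simp_all

text \<open>Termwise integration, used with \<open>e n\<close> a power of \<open>cnj \<zeta>\<close>
  for the Cauchy formula and with a power of \<open>\<zeta>\<close> for dilates of power
  series.\<close>

lemma circle_series:
  fixes e :: "nat \<Rightarrow> complex \<Rightarrow> complex" and c :: "nat \<Rightarrow> complex"
  assumes k: "integrable circle_measure k" and c: "summable (\<lambda>n. cmod (c n))"
    and em: "\<And>n. e n \<in> borel_measurable circle_measure"
    and eb: "\<And>n \<zeta>. cmod \<zeta> = 1 \<Longrightarrow> cmod (e n \<zeta>) \<le> 1"
  shows "(\<lambda>n. c n * (\<integral>\<zeta>. k \<zeta> * e n \<zeta> \<partial>circle_measure)) sums (\<integral>\<zeta>. k \<zeta> * (\<Sum>n. c n * e n \<zeta>) \<partial>circle_measure)"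
proof -
  have b: "cmod (c n * (k \<zeta> * e n \<zeta>)) \<le> cmod (c n) * cmod (k \<zeta>)" if "cmod \<zeta> = 1" for n \<zeta>
    using eb[OF that, of n] by (simp add: norm_mult mult_left_mono mult_left_le)
  have i: "integrable circle_measure (\<lambda>\<zeta>. c n * (k \<zeta> * e n \<zeta>))" for n
    by (intro integrable_mult_right integrable_circle_mult_bounded[OF k em, where B=1] AE_I2) (simp add: eb)
  have sm: "summable (\<lambda>n. cmod (c n) * cmod (k \<zeta>))" for \<zeta>
    using c by (rule summable_mult2)
  have s: "summable (\<lambda>n. cmod (c n * (k \<zeta> * e n \<zeta>)))" if "cmod \<zeta> = 1" for \<zeta>
    by (rule summable_comparison_test'[OF sm, of 0]) (use b[OF that] in simp)
  have "(\<lambda>n. \<integral>\<zeta>. c n * (k \<zeta> * e n \<zeta>) \<partial>circle_measure) sums (\<integral>\<zeta>. (\<Sum>n. c n * (k \<zeta> * e n \<zeta>)) \<partial>circle_measure)"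
  proof (rule sums_integral[OF i])
    show "AE \<zeta> in circle_measure. summable (\<lambda>n. cmod (c n * (k \<zeta> * e n \<zeta>)))"
      using AE_circle_norm by eventually_elim (rule s)
    show "summable (\<lambda>n. \<integral>\<zeta>. cmod (c n * (k \<zeta> * e n \<zeta>)) \<partial>circle_measure)"
    proof (rule summable_comparison_test'[of "\<lambda>n. cmod (c n) * (\<integral>\<zeta>. cmod (k \<zeta>) \<partial>circle_measure)" 0])
      show "summable (\<lambda>n. cmod (c n) * (\<integral>\<zeta>. cmod (k \<zeta>) \<partial>circle_measure))"
        using c by (rule summable_mult2)
      fix n
      have "(\<integral>\<zeta>. cmod (c n * (k \<zeta> * e n \<zeta>)) \<partial>circle_measure) \<le> (\<integral>\<zeta>. cmod (c n) * cmod (k \<zeta>) \<partial>circle_measure)"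
        by (intro integral_mono integrable_norm[OF i] integrable_mult_right integrable_norm[OF k] b) simp
      then show "norm (\<integral>\<zeta>. cmod (c n * (k \<zeta> * e n \<zeta>)) \<partial>circle_measure) \<le> cmod (c n) * (\<integral>\<zeta>. cmod (k \<zeta>) \<partial>circle_measure)"
        by simp
    qed
  qed
  moreover have "(\<integral>\<zeta>. (\<Sum>n. c n * (k \<zeta> * e n \<zeta>)) \<partial>circle_measure) = (\<integral>\<zeta>. k \<zeta> * (\<Sum>n. c n * e n \<zeta>) \<partial>circle_measure)"
  proof (rule integral_circle_cong)
    fix \<zeta> :: complex assume "cmod \<zeta> = 1"
    have "summable (\<lambda>n. cmod (c n * e n \<zeta>))"
      by (rule summable_comparison_test'[OF c, of 0]) (use eb[OF \<open>cmod \<zeta> = 1\<close>] in \<open>simp add: norm_mult mult_left_le\<close>)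
    then have "summable (\<lambda>n. c n * e n \<zeta>)" by (rule summable_norm_cancel)
    then show "(\<Sum>n. c n * (k \<zeta> * e n \<zeta>)) = k \<zeta> * (\<Sum>n. c n * e n \<zeta>)"
      by (subst suminf_mult[symmetric]) (simp_all add: mult_ac)
  qed
  ultimately show ?thesis by simp
qed

lemma cnj_szego_kernel_series:
  assumes "cmod z < 1" "cmod \<zeta> = 1"
  shows "cnj (szego_kernel z \<zeta>) = (\<Sum>n. z ^ n * cnj \<zeta> ^ n)"
proof -
  have "cmod (z * cnj \<zeta>) < 1" using assms by (simp add: norm_mult)
  from suminf_geometric[OF this] show ?thesis
    by (simp add: szego_kernel_def power_mult_distrib)
qed

lemma disk_extension_sums:
  assumes f: "integrable circle_measure f" and z: "z \<in> ball 0 1"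
  shows "(\<lambda>n. circle_coeff f n * z ^ n) sums disk_extension f z"
proof -
  have c: "summable (\<lambda>n. cmod (z ^ n))"
    using z by (simp add: norm_power)
  have "(\<lambda>n. z ^ n * (\<integral>\<zeta>. f \<zeta> * cnj \<zeta> ^ n \<partial>circle_measure)) sums (\<integral>\<zeta>. f \<zeta> * (\<Sum>n. z ^ n * cnj \<zeta> ^ n) \<partial>circle_measure)"
    by (rule circle_series[OF f c])
      (auto simp: norm_power intro!: measurable_circle_continuous_on continuous_intros)
  moreover have "(\<integral>\<zeta>. f \<zeta> * (\<Sum>n. z ^ n * cnj \<zeta> ^ n) \<partial>circle_measure) = disk_extension f z"
    unfolding disk_extension_def circle_inner_def
    using z by (intro integral_circle_cong) (simp add: cnj_szego_kernel_series)
  ultimately show ?thesis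
    by (simp add: circle_coeff_def mult.commute)
qed

lemma disk_extension_holomorphic:
  assumes "integrable circle_measure f"
  shows "disk_extension f holomorphic_on ball 0 1"
  using disk_extension_sums[OF assms] by (intro power_series_holomorphic) simp

lemma disk_extension_0: "disk_extension f 0 = (\<integral>\<zeta>. f \<zeta> \<partial>circle_measure)"
  by (simp add: disk_extension_def circle_inner_def szego_kernel_def)

lemma hardy2_L2: "f \<in> hardy2 \<Longrightarrow> f \<in> L2_circle"
  and hardy2_neg: "f \<in> hardy2 \<Longrightarrow> n \<ge> 1 \<Longrightarrow> (\<integral>\<zeta>. f \<zeta> * \<zeta> ^ n \<partial>circle_measure) = 0"
  by (auto simp: hardy2_def)

lemma hardy2_integrable: "f \<in> hardy2 \<Longrightarrow> integrable circle_measure f"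
  by (intro L2_integrable hardy2_L2)

lemma hardy2_diff:
  assumes "f \<in> hardy2" "g \<in> hardy2"
  shows "(\<lambda>\<zeta>. f \<zeta> - g \<zeta>) \<in> hardy2"
  using assms integrable_circle_power[OF hardy2_integrable[OF assms(1)]]
    integrable_circle_power[OF hardy2_integrable[OF assms(2)]]
  by (simp add: hardy2_def L2_diff left_diff_distrib)

lemma hardy2_add:
  assumes "f \<in> hardy2" "g \<in> hardy2"
  shows "(\<lambda>\<zeta>. f \<zeta> + g \<zeta>) \<in> hardy2"
  using assms integrable_circle_power[OF hardy2_integrable[OF assms(1)]]
    integrable_circle_power[OF hardy2_integrable[OF assms(2)]]
  by (simp add: hardy2_def L2_add distrib_right)

lemma hardy2_cmult: "f \<in> hardy2 \<Longrightarrow> (\<lambda>\<zeta>. c * f \<zeta>) \<in> hardy2"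
  by (simp add: hardy2_def L2_cmult mult.assoc)

lemma circle_coeff_diff:
  assumes "integrable circle_measure f" "integrable circle_measure g"
  shows "circle_coeff (\<lambda>\<zeta>. f \<zeta> - g \<zeta>) n = circle_coeff f n - circle_coeff g n"
  using integrable_circle_power[OF assms(1)] integrable_circle_power[OF assms(2)]
  by (simp add: circle_coeff_def left_diff_distrib)

lemma hardy2_AE_eq:
  assumes "f \<in> hardy2" "g \<in> hardy2" "\<And>n. circle_coeff f n = circle_coeff g n"
  shows "AE \<zeta> in circle_measure. f \<zeta> = g \<zeta>"
proof -
  have "AE \<zeta> in circle_measure. f \<zeta> - g \<zeta> = 0"
  proof (rule circle_fourier_unique)
    show "integrable circle_measure (\<lambda>\<zeta>. f \<zeta> - g \<zeta>)"
      by (intro hardy2_integrable hardy2_diff assms)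
    show "circle_coeff (\<lambda>\<zeta>. f \<zeta> - g \<zeta>) n = 0" for n
      by (simp add: circle_coeff_diff hardy2_integrable assms)
  qed (rule hardy2_neg[OF hardy2_diff[OF assms(1,2)]])
  then show ?thesis by simp
qed

section \<open>Bessel, Riesz-Fischer and Parseval on the nonnegative frequencies\<close>

lemma integral_cmod_square:
  assumes "f \<in> L2_circle"
  shows "of_real (\<integral>\<zeta>. (cmod (f \<zeta>))\<^sup>2 \<partial>circle_measure) = (\<integral>\<zeta>. f \<zeta> * cnj (f \<zeta>) \<partial>circle_measure)"
  using integral_of_real[OF L2_integrable_square[OF assms], where 'a=complex]
  by (simp only: complex_norm_square)

lemma L2_trig_sum:
  "(\<lambda>\<zeta>. \<Sum>n\<in>I. a n * \<zeta> ^ n) \<in> L2_circle"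
  by (intro L2_continuous continuous_intros)

lemma integral_trig_sum:
  assumes "integrable circle_measure f" "finite I"
  shows "(\<integral>\<zeta>. f \<zeta> * cnj (\<Sum>n\<in>I. a n * \<zeta> ^ n) \<partial>circle_measure) = (\<Sum>n\<in>I. cnj (a n) * circle_coeff f n)"
proof -
  have "f \<zeta> * cnj (\<Sum>n\<in>I. a n * \<zeta> ^ n) = (\<Sum>n\<in>I. cnj (a n) * (f \<zeta> * cnj \<zeta> ^ n))" for \<zeta>
    by (simp add: sum_distrib_left mult_ac)
  then show ?thesis
    using integrable_circle_power[OF assms(1)] by (simp add: circle_coeff_def)
qed

lemma circle_coeff_trig_sum:
  assumes "finite I"
  shows "circle_coeff (\<lambda>\<zeta>. \<Sum>n\<in>I. a n * \<zeta> ^ n) m = (if m \<in> I then a m else 0)"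
proof -
  have i: "integrable circle_measure (\<lambda>\<zeta>. \<zeta> ^ n * cnj \<zeta> ^ m)" for n
    by (intro L2_integrable L2_continuous continuous_intros)
  have "circle_coeff (\<lambda>\<zeta>. \<Sum>n\<in>I. a n * \<zeta> ^ n) m = (\<integral>\<zeta>. (\<Sum>n\<in>I. a n * (\<zeta> ^ n * cnj \<zeta> ^ m)) \<partial>circle_measure)"
    by (simp add: circle_coeff_def sum_distrib_right mult.assoc)
  also have "\<dots> = (\<Sum>n\<in>I. a n * (if n = m then 1 else 0))"
    using i by (simp add: integral_circle_monomial)
  also have "\<dots> = (if m \<in> I then a m else 0)"
    using assms by (simp add: sum.delta if_distrib[where f="(*) _"] cong: if_cong)
  finally show ?thesis .
qed

lemma integral_cmod_square_trig_sum:
  assumes "finite I"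
  shows "(\<integral>\<zeta>. (cmod (\<Sum>n\<in>I. a n * \<zeta> ^ n))\<^sup>2 \<partial>circle_measure) = (\<Sum>n\<in>I. (cmod (a n))\<^sup>2)"
proof -
  have "complex_of_real (\<integral>\<zeta>. (cmod (\<Sum>n\<in>I. a n * \<zeta> ^ n))\<^sup>2 \<partial>circle_measure) = (\<Sum>n\<in>I. cnj (a n) * a n)"
    using assms by (simp only: integral_cmod_square[OF L2_trig_sum] integral_trig_sum[OF L2_integrable[OF L2_trig_sum] assms]
        circle_coeff_trig_sum) simp
  also have "\<dots> = complex_of_real (\<Sum>n\<in>I. (cmod (a n))\<^sup>2)"
    by (simp add: complex_norm_square[symmetric] mult.commute[of "cnj _"])
  finally show ?thesis by (simp only: of_real_eq_iff)
qed

text \<open>Pairing \<open>f\<close> with its own partial sum \<open>S\<close> gives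
  \<open>A\<close>, which is also the squared norm of \<open>S\<close>; Cauchy-Schwarz then reads
  \<open>A\<^sup>2 \<le> (norm of f)\<^sup>2 * A\<close>, and one \<open>A\<close> cancels.\<close>

lemma bessel_circle:
  assumes f: "f \<in> L2_circle"
  shows "(\<Sum>n<N. (cmod (circle_coeff f n))\<^sup>2) \<le> (\<integral>\<zeta>. (cmod (f \<zeta>))\<^sup>2 \<partial>circle_measure)"
proof -
  define S where "S \<zeta> = (\<Sum>n<N. circle_coeff f n * \<zeta> ^ n)" for \<zeta>
  define A where "A = (\<Sum>n<N. (cmod (circle_coeff f n))\<^sup>2)"
  have "A \<ge> 0" by (simp add: A_def sum_nonneg)
  have S: "S \<in> L2_circle" unfolding S_def by (rule L2_trig_sum)
  have "(\<integral>\<zeta>. f \<zeta> * cnj (S \<zeta>) \<partial>circle_measure) = complex_of_real A"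
    unfolding S_def integral_trig_sum[OF L2_integrable[OF f] finite_lessThan]
    by (simp add: A_def complex_norm_square[symmetric] mult.commute[of "cnj _"])
  moreover have "(\<integral>\<zeta>. (cmod (cnj (S \<zeta>)))\<^sup>2 \<partial>circle_measure) = A"
    unfolding complex_mod_cnj by (simp only: S_def A_def integral_cmod_square_trig_sum finite_lessThan)
  ultimately have "A\<^sup>2 \<le> (\<integral>\<zeta>. (cmod (f \<zeta>))\<^sup>2 \<partial>circle_measure) * A"
    using L2_cauchy_schwarz[OF f L2_cnj[OF S]] by simp
  then have "A \<le> (\<integral>\<zeta>. (cmod (f \<zeta>))\<^sup>2 \<partial>circle_measure)" if "A > 0"
    using that by (simp add: power2_eq_square)
  then show ?thesis
    using \<open>A \<ge> 0\<close> unfolding A_def[symmetric] by (cases "A = 0") auto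
qed

lemma L2_tendsto_cnj: "L2_tendsto u f \<Longrightarrow> L2_tendsto (\<lambda>k \<zeta>. cnj (u k \<zeta>)) (\<lambda>\<zeta>. cnj (f \<zeta>))"
  by (simp add: L2_tendsto_def flip: complex_cnj_diff)

text \<open>The partial sums are L2-Cauchy. Coefficients of either sign pass to the limit by pairing
  with monomials, and the norm by pairing the partial sums with themselves.\<close>

lemma hardy2_riesz_fischer:
  assumes a: "summable (\<lambda>n. (cmod (a n))\<^sup>2)"
  obtains f where "f \<in> hardy2" "\<And>n. circle_coeff f n = a n"
    "(\<lambda>n. (cmod (a n))\<^sup>2) sums (\<integral>\<zeta>. (cmod (f \<zeta>))\<^sup>2 \<partial>circle_measure)"
proof -
  define S where "S N \<zeta> = (\<Sum>n<N. a n * \<zeta> ^ n)" for N :: nat and \<zeta>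
  have S: "S N \<in> L2_circle" for N unfolding S_def by (rule L2_trig_sum)
  have diff: "(\<integral>\<zeta>. (cmod (S m \<zeta> - S n \<zeta>))\<^sup>2 \<partial>circle_measure) = (\<Sum>k=n..<m. (cmod (a k))\<^sup>2)" if "n \<le> m" for m n
  proof -
    have "S m \<zeta> - S n \<zeta> = (\<Sum>k=n..<m. a k * \<zeta> ^ k)" for \<zeta>
      using sum_diff_nat_ivl[of 0 n m "\<lambda>k. a k * \<zeta> ^ k"] that
      by (simp add: S_def atLeast0LessThan)
    then show ?thesis by (simp add: integral_cmod_square_trig_sum)
  qed
  obtain f where f: "f \<in> L2_circle" and lim: "L2_tendsto S f"
  proof (rule L2_complete[OF S])
    fix e :: real assume "e > 0"
    with a obtain N where N: "\<And>m n. m \<ge> N \<Longrightarrow> norm (\<Sum>k=m..<n. (cmod (a k))\<^sup>2) < e"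
      unfolding summable_Cauchy by blast
    have sym: "(\<integral>\<zeta>. (cmod (S m \<zeta> - S n \<zeta>))\<^sup>2 \<partial>circle_measure) = (\<integral>\<zeta>. (cmod (S n \<zeta> - S m \<zeta>))\<^sup>2 \<partial>circle_measure)" for m n
      by (simp add: norm_minus_commute)
    have "(\<integral>\<zeta>. (cmod (S m \<zeta> - S n \<zeta>))\<^sup>2 \<partial>circle_measure) < e" if "m \<ge> N" "n \<ge> N" "n \<le> m" for m n
      unfolding diff[OF that(3)] using N[OF that(2), of m] by simp
    then show "\<exists>N. \<forall>m\<ge>N. \<forall>n\<ge>N. (\<integral>\<zeta>. (cmod (S m \<zeta> - S n \<zeta>))\<^sup>2 \<partial>circle_measure) < e"
      using sym by (metis nle_le)
  qed
  have int: "(\<lambda>N. \<integral>\<zeta>. S N \<zeta> * k \<zeta> \<partial>circle_measure) \<longlonglongrightarrow> (\<integral>\<zeta>. f \<zeta> * k \<zeta> \<partial>circle_measure)" if "k \<in> L2_circle" for k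
    by (intro L2_tendsto_integral_mult[OF S f lim]) (simp_all add: that)
  have coeff: "circle_coeff f n = a n" for n
  proof (rule LIMSEQ_unique)
    show "(\<lambda>N. circle_coeff (S N) n) \<longlonglongrightarrow> circle_coeff f n"
      unfolding circle_coeff_def by (intro int L2_continuous continuous_intros)
    have "circle_coeff (S N) n = a n" if "N > n" for N
      unfolding S_def by (simp add: circle_coeff_trig_sum that)
    then show "(\<lambda>N. circle_coeff (S N) n) \<longlonglongrightarrow> a n"
      by (intro tendsto_eventually eventually_mono[OF eventually_gt_at_top[of n]])
  qed
  have neg: "(\<integral>\<zeta>. f \<zeta> * \<zeta> ^ n \<partial>circle_measure) = 0" if "n \<ge> 1" for n
  proof (rule LIMSEQ_unique)
    show "(\<lambda>N. \<integral>\<zeta>. S N \<zeta> * \<zeta> ^ n \<partial>circle_measure) \<longlonglongrightarrow> (\<integral>\<zeta>. f \<zeta> * \<zeta> ^ n \<partial>circle_measure)"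
      by (intro int L2_continuous continuous_intros)
    have i: "integrable circle_measure (\<lambda>\<zeta>. \<zeta> ^ k)" for k
      by (intro L2_integrable L2_continuous continuous_intros)
    have "(\<integral>\<zeta>. S N \<zeta> * \<zeta> ^ n \<partial>circle_measure) = (\<integral>\<zeta>. (\<Sum>k<N. a k * \<zeta> ^ (k + n)) \<partial>circle_measure)" for N
      by (simp add: S_def sum_distrib_right power_add mult.assoc)
    also have "\<dots> N = (\<Sum>k<N. a k * 0)" for N
      using that i by (simp add: integral_circle_power)
    finally show "(\<lambda>N. \<integral>\<zeta>. S N \<zeta> * \<zeta> ^ n \<partial>circle_measure) \<longlonglongrightarrow> 0"
      by simp
  qed
  have "(\<lambda>N. \<integral>\<zeta>. S N \<zeta> * cnj (S N \<zeta>) \<partial>circle_measure) \<longlonglongrightarrow> (\<integral>\<zeta>. f \<zeta> * cnj (f \<zeta>) \<partial>circle_measure)"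
    by (intro L2_tendsto_integral_mult S f lim L2_cnj L2_tendsto_cnj)
  then have "(\<lambda>N. complex_of_real (\<Sum>n<N. (cmod (a n))\<^sup>2)) \<longlonglongrightarrow> of_real (\<integral>\<zeta>. (cmod (f \<zeta>))\<^sup>2 \<partial>circle_measure)"
    by (simp only: integral_cmod_square[OF f, symmetric] integral_cmod_square[OF S, symmetric])
       (simp only: S_def integral_cmod_square_trig_sum finite_lessThan)
  then have "(\<lambda>n. (cmod (a n))\<^sup>2) sums (\<integral>\<zeta>. (cmod (f \<zeta>))\<^sup>2 \<partial>circle_measure)"
    unfolding sums_def tendsto_of_real_iff .
  with f neg coeff show ?thesis by (intro that[of f]) (simp_all add: hardy2_def)
qed

lemma L2_summable_coeff:
  assumes "f \<in> L2_circle"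
  shows "summable (\<lambda>n. (cmod (circle_coeff f n))\<^sup>2)"
  by (rule bounded_imp_summable[where B="\<integral>\<zeta>. (cmod (f \<zeta>))\<^sup>2 \<partial>circle_measure"])
     (use bessel_circle[OF assms, of "Suc _"] in \<open>simp_all add: lessThan_Suc_atMost\<close>)

text \<open>Riesz-Fischer applied to the coefficients of \<open>f\<close> returns a function whose
  norm is known; by uniqueness of coefficients it is \<open>f\<close> almost everywhere.\<close>

lemma hardy2_parseval:
  assumes f: "f \<in> hardy2"
  shows "(\<lambda>n. (cmod (circle_coeff f n))\<^sup>2) sums (\<integral>\<zeta>. (cmod (f \<zeta>))\<^sup>2 \<partial>circle_measure)"
proof -
  obtain g where g: "g \<in> hardy2" "\<And>n. circle_coeff g n = circle_coeff f n"
    and sums: "(\<lambda>n. (cmod (circle_coeff f n))\<^sup>2) sums (\<integral>\<zeta>. (cmod (g \<zeta>))\<^sup>2 \<partial>circle_measure)"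
    using hardy2_riesz_fischer[OF L2_summable_coeff[OF hardy2_L2[OF f]]] by metis
  have "AE \<zeta> in circle_measure. g \<zeta> = f \<zeta>"
    by (rule hardy2_AE_eq[OF g(1) f g(2)])
  then have ae: "AE \<zeta> in circle_measure. (cmod (g \<zeta>))\<^sup>2 = (cmod (f \<zeta>))\<^sup>2"
    by eventually_elim simp
  have "(\<integral>\<zeta>. (cmod (g \<zeta>))\<^sup>2 \<partial>circle_measure) = (\<integral>\<zeta>. (cmod (f \<zeta>))\<^sup>2 \<partial>circle_measure)"
    by (intro integral_cong_AE ae borel_measurable_integrable L2_integrable_square hardy2_L2 f g)
  with sums show ?thesis by simp
qed

section \<open>Radial limits\<close>

lemma holomorphic_disk_series:
  assumes "G holomorphic_on ball 0 1"
  obtains a where "\<And>w. w \<in> ball 0 1 \<Longrightarrow> (\<lambda>n. a n * w ^ n) sums G w"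
    "\<And>w. w \<in> ball 0 1 \<Longrightarrow> summable (\<lambda>n. cmod (a n * w ^ n))"
proof
  define a where "a n = (deriv ^^ n) G 0 / fact n" for n
  show sums: "(\<lambda>n. a n * w ^ n) sums G w" if "w \<in> ball 0 1" for w
    using holomorphic_power_series[OF assms that] by (simp add: a_def)
  show "summable (\<lambda>n. cmod (a n * w ^ n))" if w: "w \<in> ball 0 1" for w
  proof -
    obtain r where r: "cmod w < r" "r < 1" using dense[of "cmod w" 1] w unfolding mem_ball_0 by blast
    have r0: "cmod (of_real r) = r"
      using order_trans[OF norm_ge_zero less_imp_le[OF r(1)]] by simp
    then have "complex_of_real r \<in> ball 0 1" using r by simp
    from powser_insidea[OF sums_summable[OF sums[OF this]], of w] show ?thesis
      using r r0 by simp
  qed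
qed

section \<open>Dilates of holomorphic functions on the disk\<close>

lemma dilate_series:
  assumes sums: "\<And>w. w \<in> ball 0 1 \<Longrightarrow> (\<lambda>n. a n * w ^ n) sums G w" and r: "0 \<le> r" "r < 1"
  shows "summable (\<lambda>n. cmod (a n * of_real r ^ n))"
    and "cmod \<zeta> = 1 \<Longrightarrow> G (of_real r * \<zeta>) = (\<Sum>n. (a n * of_real r ^ n) * \<zeta> ^ n)"
proof -
  obtain s where s: "r < s" "s < 1" using dense[OF r(2)] by auto
  then have "complex_of_real s \<in> ball 0 1" using r by simp
  from powser_insidea[OF sums_summable[OF sums[OF this]], of "of_real r"]
  show "summable (\<lambda>n. cmod (a n * of_real r ^ n))"
    using r s by simp
  show "G (of_real r * \<zeta>) = (\<Sum>n. (a n * of_real r ^ n) * \<zeta> ^ n)" if "cmod \<zeta> = 1"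
    using sums_unique[OF sums, of "of_real r * \<zeta>"] r that
    by (simp add: norm_mult power_mult_distrib mult.assoc)
qed

lemma dilate_integral_monomial:
  assumes sums: "\<And>w. w \<in> ball 0 1 \<Longrightarrow> (\<lambda>n. a n * w ^ n) sums G w" and r: "0 \<le> r" "r < 1"
  shows "(\<lambda>n. (a n * of_real r ^ n) * (\<integral>\<zeta>. (\<zeta> ^ i * cnj \<zeta> ^ j) * \<zeta> ^ n \<partial>circle_measure))
    sums (\<integral>\<zeta>. G (of_real r * \<zeta>) * (\<zeta> ^ i * cnj \<zeta> ^ j) \<partial>circle_measure)"
proof -
  have "(\<lambda>n. (a n * of_real r ^ n) * (\<integral>\<zeta>. (\<zeta> ^ i * cnj \<zeta> ^ j) * \<zeta> ^ n \<partial>circle_measure))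
    sums (\<integral>\<zeta>. (\<zeta> ^ i * cnj \<zeta> ^ j) * (\<Sum>n. (a n * of_real r ^ n) * \<zeta> ^ n) \<partial>circle_measure)"
    by (rule circle_series[OF _ dilate_series(1)[OF sums r]])
       (auto simp: norm_power intro!: L2_integrable L2_continuous measurable_circle_continuous_on continuous_intros)
  moreover have "(\<integral>\<zeta>. (\<zeta> ^ i * cnj \<zeta> ^ j) * (\<Sum>n. (a n * of_real r ^ n) * \<zeta> ^ n) \<partial>circle_measure)
    = (\<integral>\<zeta>. G (of_real r * \<zeta>) * (\<zeta> ^ i * cnj \<zeta> ^ j) \<partial>circle_measure)"
  proof (rule integral_circle_cong)
    fix \<zeta> :: complex assume "cmod \<zeta> = 1"
    have "G (of_real r * \<zeta>) = (\<Sum>n. (a n * of_real r ^ n) * \<zeta> ^ n)"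
      by (rule dilate_series(2)[OF sums r]) (simp_all add: \<open>cmod \<zeta> = 1\<close>)
    then show "(\<zeta> ^ i * cnj \<zeta> ^ j) * (\<Sum>n. (a n * of_real r ^ n) * \<zeta> ^ n)
      = G (of_real r * \<zeta>) * (\<zeta> ^ i * cnj \<zeta> ^ j)"
      by (simp only: mult.commute)
  qed
  ultimately show ?thesis by simp
qed

lemma dilate_coeff:
  assumes sums: "\<And>w. w \<in> ball 0 1 \<Longrightarrow> (\<lambda>n. a n * w ^ n) sums G w" and r: "0 \<le> r" "r < 1"
  shows "circle_coeff (\<lambda>\<zeta>. G (of_real r * \<zeta>)) m = a m * of_real r ^ m"
proof -
  have "(\<lambda>n. (a n * of_real r ^ n) * (\<integral>\<zeta>. (\<zeta> ^ 0 * cnj \<zeta> ^ m) * \<zeta> ^ n \<partial>circle_measure))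
    = (\<lambda>n. if n = m then a n * of_real r ^ n else 0)"
    by (simp add: fun_eq_iff mult.commute[of "cnj _ ^ _"] integral_circle_monomial)
  then show ?thesis
    using dilate_integral_monomial[OF sums r, of 0 m] sums_single[of m "\<lambda>n. a n * of_real r ^ n"]
    by (simp add: circle_coeff_def sums_unique2)
qed

lemma dilate_continuous_on:
  assumes "G holomorphic_on ball 0 1" "0 \<le> r" "r < 1"
  shows "continuous_on (sphere 0 1) (\<lambda>\<zeta>. G (of_real r * \<zeta>))"
  by (rule continuous_on_compose2[OF holomorphic_on_imp_continuous_on[OF assms(1)]])
     (use assms in \<open>auto simp: norm_mult intro!: continuous_intros\<close>)

lemma dilate_hardy2:
  assumes G: "G holomorphic_on ball 0 1" and r: "0 \<le> r" "r < 1"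
  shows "(\<lambda>\<zeta>. G (of_real r * \<zeta>)) \<in> hardy2"
proof -
  obtain a where sums: "\<And>w. w \<in> ball 0 1 \<Longrightarrow> (\<lambda>n. a n * w ^ n) sums G w"
    using holomorphic_disk_series[OF G] by blast
  have "(\<integral>\<zeta>. G (of_real r * \<zeta>) * \<zeta> ^ n \<partial>circle_measure) = 0" if "n \<ge> 1" for n
  proof -
    have "(\<lambda>k. (a k * of_real r ^ k) * (\<integral>\<zeta>. (\<zeta> ^ n * cnj \<zeta> ^ 0) * \<zeta> ^ k \<partial>circle_measure)) = (\<lambda>k. 0)"
      using that by (simp add: fun_eq_iff integral_circle_power flip: power_add)
    then show ?thesis
      using dilate_integral_monomial[OF sums r, of n 0] by (simp add: sums_unique2[OF _ sums_zero])
  qed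
  then show ?thesis
    by (simp add: hardy2_def L2_continuous dilate_continuous_on G r)
qed

lemma dilate_disk_extension:
  assumes G: "G holomorphic_on ball 0 1" and r: "0 \<le> r" "r < 1" and z: "z \<in> ball 0 1"
  shows "disk_extension (\<lambda>\<zeta>. G (of_real r * \<zeta>)) z = G (of_real r * z)"
proof -
  obtain a where sums: "\<And>w. w \<in> ball 0 1 \<Longrightarrow> (\<lambda>n. a n * w ^ n) sums G w"
    using holomorphic_disk_series[OF G] by blast
  have "cmod (of_real r * z) < 1"
    using r z mult_le_one[of r "cmod z"] by (cases "r = 0") (auto simp: norm_mult intro: le_less_trans[OF mult_left_le_one_le])
  then have "(\<lambda>n. a n * (of_real r * z) ^ n) sums G (of_real r * z)"
    by (intro sums) simp
  moreover have "circle_coeff (\<lambda>\<zeta>. G (of_real r * \<zeta>)) n = a n * of_real r ^ n" for n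
    by (rule dilate_coeff[OF sums r])
  then have "(\<lambda>n. a n * (of_real r * z) ^ n) sums disk_extension (\<lambda>\<zeta>. G (of_real r * \<zeta>)) z"
    using disk_extension_sums[OF hardy2_integrable[OF dilate_hardy2[OF G r]] z]
    by (simp add: power_mult_distrib mult.assoc)
  ultimately show ?thesis by (rule sums_unique2[symmetric])
qed

text \<open>Bessel for the dilates bounds each finite sum of the squares of
  \<open>cmod (a n) * r ^ n\<close> by \<open>C\<close>; letting \<open>r\<close> tend to 1 with
  \<open>N\<close> fixed makes the Taylor coefficients square summable, and Riesz-Fischer supplies
  the boundary function. Products with exponentials of Herglotz integrals enter
  \<open>hardy2\<close> this way.\<close>

lemma hardy2_of_bounded_means:
  assumes G: "G holomorphic_on ball 0 1"
    and bound: "\<And>r. 0 < r \<Longrightarrow> r < 1 \<Longrightarrow> (\<integral>\<zeta>. (cmod (G (of_real r * \<zeta>)))\<^sup>2 \<partial>circle_measure) \<le> C"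
  obtains f where "f \<in> hardy2" "\<And>z. z \<in> ball 0 1 \<Longrightarrow> disk_extension f z = G z"
proof -
  obtain a where sums: "\<And>w. w \<in> ball 0 1 \<Longrightarrow> (\<lambda>n. a n * w ^ n) sums G w"
    using holomorphic_disk_series[OF G] by blast
  have "(\<Sum>n<N. (cmod (a n))\<^sup>2) \<le> C" for N
  proof (rule tendsto_upperbound)
    show "((\<lambda>r. \<Sum>n<N. (cmod (a n) * r ^ n)\<^sup>2) \<longlongrightarrow> (\<Sum>n<N. (cmod (a n))\<^sup>2)) (at_left 1)"
      by (auto intro!: tendsto_eq_intros)
    have "\<forall>\<^sub>F r in at_left (1::real). r \<in> {0<..<1}"
      by (rule eventually_at_left_real) simp
    then show "\<forall>\<^sub>F r in at_left 1. (\<Sum>n<N. (cmod (a n) * r ^ n)\<^sup>2) \<le> C"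
    proof eventually_elim
      case (elim r)
      then have r: "0 \<le> r" "r < 1" "0 < r" by auto
      have "circle_coeff (\<lambda>\<zeta>. G (of_real r * \<zeta>)) n = a n * of_real r ^ n" for n
        by (rule dilate_coeff[OF sums r(1,2)])
      then have "(\<Sum>n<N. (cmod (a n) * r ^ n)\<^sup>2) = (\<Sum>n<N. (cmod (circle_coeff (\<lambda>\<zeta>. G (of_real r * \<zeta>)) n))\<^sup>2)"
        using r by (simp add: norm_mult norm_power)
      also have "\<dots> \<le> C"
        using bessel_circle[OF hardy2_L2[OF dilate_hardy2[OF G r(1,2)]]] bound[OF r(3,2)] by (rule order_trans)
      finally show ?case .
    qed
  qed simp
  then have "summable (\<lambda>n. (cmod (a n))\<^sup>2)"
    by (intro bounded_imp_summable[where B=C], simp, simp only: lessThan_Suc_atMost[symmetric])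
  then obtain f where f: "f \<in> hardy2" "\<And>n. circle_coeff f n = a n"
    using hardy2_riesz_fischer by metis
  have "disk_extension f z = G z" if "z \<in> ball 0 1" for z
    using sums_unique2[OF disk_extension_sums[OF hardy2_integrable[OF f(1)] that]] sums[OF that]
    by (simp add: f(2))
  with f(1) show ?thesis by (rule that)
qed

text \<open>Parseval turns the squared distance into the sum of
  \<open>(cmod (circle_coeff f n))\<^sup>2 * (1 - r k ^ n)\<^sup>2\<close>, dominated termwise by
  the summable squares of the coefficients, so Tannery's theorem applies.\<close>

lemma hardy2_dilate_tendsto:
  assumes f: "f \<in> hardy2" and r: "\<And>k. 0 < r k" "\<And>k. r k < 1" "r \<longlonglongrightarrow> 1"
  shows "L2_tendsto (\<lambda>k \<zeta>. disk_extension f (of_real (r k) * \<zeta>)) f"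
proof -
  let ?F = "\<lambda>k \<zeta>. disk_extension f (of_real (r k) * \<zeta>)"
  note hol = disk_extension_holomorphic[OF hardy2_integrable[OF f]]
  have r0: "0 \<le> r k" for k using r(1)[of k] by simp
  have D: "(\<lambda>\<zeta>. ?F k \<zeta> - f \<zeta>) \<in> hardy2" for k
    by (intro hardy2_diff f dilate_hardy2 hol r0 r)
  have coeff: "circle_coeff (\<lambda>\<zeta>. ?F k \<zeta> - f \<zeta>) n = circle_coeff f n * (of_real (r k) ^ n - 1)" for k n
  proof -
    have "circle_coeff (?F k) n = circle_coeff f n * of_real (r k) ^ n"
      by (rule dilate_coeff[OF disk_extension_sums[OF hardy2_integrable[OF f]] r0 r(2)])
    then show ?thesis
      by (simp add: circle_coeff_diff hardy2_integrable f dilate_hardy2[OF hol r0 r(2)] right_diff_distrib)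
  qed
  have eq: "(\<integral>\<zeta>. (cmod (?F k \<zeta> - f \<zeta>))\<^sup>2 \<partial>circle_measure) = (\<Sum>n. (cmod (circle_coeff f n))\<^sup>2 * (1 - r k ^ n)\<^sup>2)" for k
  proof -
    have "(cmod (circle_coeff f n * (of_real (r k) ^ n - 1)))\<^sup>2 = (cmod (circle_coeff f n))\<^sup>2 * (1 - r k ^ n)\<^sup>2" for n
      using norm_of_real[of "r k ^ n - 1", where 'a=complex]
      by (simp add: norm_mult power_mult_distrib power2_commute)
    then show ?thesis
      using sums_unique[OF hardy2_parseval[OF D[of k]]] by (simp add: coeff)
  qed
  have "((\<lambda>k. \<Sum>n. (cmod (circle_coeff f n))\<^sup>2 * (1 - r k ^ n)\<^sup>2) \<longlongrightarrow> (\<Sum>n. 0)) sequentially"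
  proof (rule tannerys_theorem[THEN conjunct2, THEN conjunct2])
    show "(\<lambda>k. (cmod (circle_coeff f n))\<^sup>2 * (1 - r k ^ n)\<^sup>2) \<longlonglongrightarrow> 0" for n
      by (rule tendsto_eq_intros r(3) refl)+ simp
    show "\<forall>\<^sub>F (n, k) in sequentially \<times>\<^sub>F sequentially.
      norm ((cmod (circle_coeff f n))\<^sup>2 * (1 - r k ^ n)\<^sup>2) \<le> (cmod (circle_coeff f n))\<^sup>2"
    proof (intro always_eventually allI, clarify)
      fix n k
      have "(1 - r k ^ n)\<^sup>2 \<le> 1"
        using r0[of k] r(2)[of k] by (intro power_le_one) (simp_all add: power_le_one)
      then show "norm ((cmod (circle_coeff f n))\<^sup>2 * (1 - r k ^ n)\<^sup>2) \<le> (cmod (circle_coeff f n))\<^sup>2"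
        by (simp add: mult_left_le)
    qed
  qed (simp_all add: L2_summable_coeff hardy2_L2 f)
  then show ?thesis by (simp add: L2_tendsto_def eq)
qed

text \<open>L2 convergence of dilates gives almost everywhere convergence along a subsequence of
  radii. The induction refines the radii once per function, so an identity between finitely many
  functions in the disk can be carried to the circle along a single sequence.\<close>

lemma hardy2_radial_limits:
  assumes "finite A" "A \<subseteq> hardy2"
  obtains r where "\<And>k. 0 < r k" "\<And>k. r k < 1" "r \<longlonglongrightarrow> 1"
    "AE \<zeta> in circle_measure. \<forall>f\<in>A. (\<lambda>k. disk_extension f (of_real (r k) * \<zeta>)) \<longlonglongrightarrow> f \<zeta>"
proof -
  have "\<exists>r. (\<forall>k. 0 < r k \<and> r k < 1) \<and> r \<longlonglongrightarrow> 1 \<and>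
    (AE \<zeta> in circle_measure. \<forall>f\<in>A. (\<lambda>k. disk_extension f (of_real (r k) * \<zeta>)) \<longlonglongrightarrow> f \<zeta>)"
    using assms
  proof (induction A)
    case empty
    \<comment> \<open>The summand 2 keeps the radius at \<open>k = 0\<close> strictly
      positive.\<close>
    have "(\<lambda>k. 1 - 1 / (of_nat k + 2)) \<longlonglongrightarrow> (1::real)"
      by real_asymp
    moreover have "0 < 1 - 1 / (of_nat k + 2 :: real)" "1 - 1 / (of_nat k + 2 :: real) < 1" for k
      by (simp_all add: field_simps)
    ultimately show ?case by (intro exI[of _ "\<lambda>k. 1 - 1 / (of_nat k + 2)"]) simp
  next
    case (insert f A)
    then obtain r where r: "\<And>k. 0 < r k" "\<And>k. r k < 1" "r \<longlonglongrightarrow> 1"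
      and ae: "AE \<zeta> in circle_measure. \<forall>f\<in>A. (\<lambda>k. disk_extension f (of_real (r k) * \<zeta>)) \<longlonglongrightarrow> f \<zeta>"
      by auto
    have f: "f \<in> hardy2" using insert by simp
    define d where "d k \<zeta> = disk_extension f (of_real (r k) * \<zeta>) - f \<zeta>" for k \<zeta>
    have d: "d k \<in> L2_circle" for k
      unfolding d_def using r(1,2)[of k]
      by (intro L2_diff hardy2_L2 f dilate_hardy2 disk_extension_holomorphic hardy2_integrable) simp_all
    have "(\<lambda>k. (\<integral>\<zeta>. cmod (d k \<zeta>) \<partial>circle_measure)\<^sup>2) \<longlonglongrightarrow> 0"
      by (rule tendsto_sandwich[OF _ _ tendsto_const hardy2_dilate_tendsto[OF f r, unfolded L2_tendsto_def]])
         (use L2_norm_le[OF d] in \<open>simp_all add: d_def\<close>)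
    then have "(\<lambda>k. \<integral>\<zeta>. cmod (d k \<zeta>) \<partial>circle_measure) \<longlonglongrightarrow> 0"
      using tendsto_real_sqrt by fastforce
    then obtain s where s: "strict_mono s" "AE \<zeta> in circle_measure. (\<lambda>k. d (s k) \<zeta>) \<longlonglongrightarrow> 0"
      using tendsto_L1_AE_subseq[of circle_measure d] L2_integrable[OF d] by blast
    have "AE \<zeta> in circle_measure. \<forall>g\<in>insert f A. (\<lambda>k. disk_extension g (of_real (r (s k)) * \<zeta>)) \<longlonglongrightarrow> g \<zeta>"
      using ae s(2)
    proof eventually_elim
      case (elim \<zeta>)
      have "(\<lambda>k. disk_extension g (of_real (r (s k)) * \<zeta>)) \<longlonglongrightarrow> g \<zeta>" if "g \<in> A" for g
        using LIMSEQ_subseq_LIMSEQ[OF bspec[OF elim(1) that] s(1)] by (simp add: o_def)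
      moreover have "(\<lambda>k. disk_extension f (of_real (r (s k)) * \<zeta>)) \<longlonglongrightarrow> f \<zeta>"
        using elim(2) unfolding d_def by (simp add: LIM_zero_iff)
      ultimately show ?case by simp
    qed
    moreover have "(\<lambda>k. r (s k)) \<longlonglongrightarrow> 1"
      using LIMSEQ_subseq_LIMSEQ[OF r(3) s(1)] by (simp add: o_def)
    ultimately show ?case
      using r by (intro exI[of _ "\<lambda>k. r (s k)"]) simp
  qed
  then show ?thesis using that by blast
qed

lemma szego_kernel_nonzero:
  assumes "cmod u < 1" "cmod w \<le> 1"
  shows "1 - cnj u * w \<noteq> 0"
proof
  assume "1 - cnj u * w = 0"
  then have "cmod u * cmod w = 1" by (metis complex_mod_cnj eq_iff_diff_eq_0 norm_mult norm_one)
  then show False using assms mult_left_le[of "cmod w" "cmod u"] by simp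
qed

lemma szego_kernel_continuous: "u \<in> ball 0 1 \<Longrightarrow> continuous_on (sphere 0 1) (szego_kernel u)"
  unfolding szego_kernel_def by (intro continuous_intros) (use szego_kernel_nonzero in auto)

text \<open>The product \<open>u v\<close> is only integrable, so it need not lie in
  \<open>hardy2\<close>. For dilates the formula is exact, because their product is the dilate of a
  holomorphic function; L2 convergence of both factors carries it to the limit.\<close>

lemma hardy2_product_inner:
  assumes u: "u \<in> hardy2" and v: "v \<in> hardy2" and z: "z \<in> ball 0 1"
  shows "(\<integral>\<zeta>. u \<zeta> * v \<zeta> * cnj (szego_kernel z \<zeta>) \<partial>circle_measure) = disk_extension u z * disk_extension v z"
proof -
  define r where "r k = 1 - 1 / (of_nat k + 2 :: real)" for k :: nat
  have r: "0 < r k" "r k < 1" "r \<longlonglongrightarrow> 1" for k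
    unfolding r_def by (simp_all add: field_simps) real_asymp
  have r0: "0 \<le> r k" for k using r(1)[of k] by simp
  let ?U = "\<lambda>k \<zeta>. disk_extension u (of_real (r k) * \<zeta>)" and ?V = "\<lambda>k \<zeta>. disk_extension v (of_real (r k) * \<zeta>)"
  note hu = disk_extension_holomorphic[OF hardy2_integrable[OF u]]
  note hv = disk_extension_holomorphic[OF hardy2_integrable[OF v]]
  have kc: "continuous_on (sphere 0 1) (\<lambda>\<zeta>. cnj (szego_kernel z \<zeta>))"
    by (intro continuous_intros szego_kernel_continuous z)
  obtain B where kb: "AE \<zeta> in circle_measure. cmod (cnj (szego_kernel z \<zeta>)) \<le> B"
    using AE_circle_bounded[OF kc] .
  have km: "(\<lambda>\<zeta>. cnj (szego_kernel z \<zeta>)) \<in> borel_measurable circle_measure"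
    by (rule measurable_circle_continuous_on[OF kc])
  have vk: "(\<lambda>\<zeta>. g \<zeta> * cnj (szego_kernel z \<zeta>)) \<in> L2_circle" if "g \<in> hardy2" for g
    by (rule L2_mult_bounded[OF hardy2_L2[OF that] km kb])
  have Vh: "?V k \<in> hardy2" and Uh: "?U k \<in> hardy2" for k
    by (intro dilate_hardy2 hu hv r0 r(2))+
  have "L2_tendsto (\<lambda>k \<zeta>. ?V k \<zeta> * cnj (szego_kernel z \<zeta>)) (\<lambda>\<zeta>. v \<zeta> * cnj (szego_kernel z \<zeta>))"
    unfolding L2_tendsto_def
  proof (rule tendsto_sandwich[OF _ _ tendsto_const])
    have "(\<lambda>k. B\<^sup>2 * (\<integral>\<zeta>. (cmod (?V k \<zeta> - v \<zeta>))\<^sup>2 \<partial>circle_measure)) \<longlonglongrightarrow> B\<^sup>2 * 0"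
      using hardy2_dilate_tendsto[OF v r] by (intro tendsto_mult tendsto_const) (simp add: L2_tendsto_def)
    then show "(\<lambda>k. B\<^sup>2 * (\<integral>\<zeta>. (cmod (?V k \<zeta> - v \<zeta>))\<^sup>2 \<partial>circle_measure)) \<longlonglongrightarrow> 0" by simp
    show "\<forall>\<^sub>F k in sequentially. (\<integral>\<zeta>. (cmod (?V k \<zeta> * cnj (szego_kernel z \<zeta>) - v \<zeta> * cnj (szego_kernel z \<zeta>)))\<^sup>2 \<partial>circle_measure)
      \<le> B\<^sup>2 * (\<integral>\<zeta>. (cmod (?V k \<zeta> - v \<zeta>))\<^sup>2 \<partial>circle_measure)"
    proof (intro always_eventually allI)
      fix k
      have "(\<integral>\<zeta>. (cmod (?V k \<zeta> * cnj (szego_kernel z \<zeta>) - v \<zeta> * cnj (szego_kernel z \<zeta>)))\<^sup>2 \<partial>circle_measure)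
        \<le> (\<integral>\<zeta>. B\<^sup>2 * (cmod (?V k \<zeta> - v \<zeta>))\<^sup>2 \<partial>circle_measure)"
      proof (intro integral_mono_AE integrable_mult_right L2_integrable_square L2_diff vk hardy2_L2 v Vh)
        show "AE \<zeta> in circle_measure. (cmod (?V k \<zeta> * cnj (szego_kernel z \<zeta>) - v \<zeta> * cnj (szego_kernel z \<zeta>)))\<^sup>2
          \<le> B\<^sup>2 * (cmod (?V k \<zeta> - v \<zeta>))\<^sup>2"
          using kb
        proof eventually_elim
          case (elim \<zeta>)
          then have "(cmod (cnj (szego_kernel z \<zeta>)))\<^sup>2 \<le> B\<^sup>2"
            by (intro power_mono) simp_all
          then show ?case
            unfolding left_diff_distrib[symmetric] norm_mult power_mult_distrib mult.commute[of "B\<^sup>2"]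
            by (rule mult_left_mono) simp
        qed
      qed
      then show "(\<integral>\<zeta>. (cmod (?V k \<zeta> * cnj (szego_kernel z \<zeta>) - v \<zeta> * cnj (szego_kernel z \<zeta>)))\<^sup>2 \<partial>circle_measure)
        \<le> B\<^sup>2 * (\<integral>\<zeta>. (cmod (?V k \<zeta> - v \<zeta>))\<^sup>2 \<partial>circle_measure)"
        by simp
    qed
  qed simp
  then have "(\<lambda>k. \<integral>\<zeta>. ?U k \<zeta> * (?V k \<zeta> * cnj (szego_kernel z \<zeta>)) \<partial>circle_measure)
    \<longlonglongrightarrow> (\<integral>\<zeta>. u \<zeta> * (v \<zeta> * cnj (szego_kernel z \<zeta>)) \<partial>circle_measure)"
    by (intro L2_tendsto_integral_mult vk hardy2_L2 Vh Uh v u hardy2_dilate_tendsto[OF u r])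
  moreover have "(\<integral>\<zeta>. ?U k \<zeta> * (?V k \<zeta> * cnj (szego_kernel z \<zeta>)) \<partial>circle_measure)
    = disk_extension u (of_real (r k) * z) * disk_extension v (of_real (r k) * z)" for k
    using dilate_disk_extension[OF holomorphic_on_mult[OF hu hv] r0 r(2) z, of k]
    by (simp add: disk_extension_def circle_inner_def mult.assoc)
  moreover have "(\<lambda>k. disk_extension g (of_real (r k) * z)) \<longlonglongrightarrow> disk_extension g z" if "g \<in> hardy2" for g
  proof -
    have "(\<lambda>k. of_real (r k) * z) \<longlonglongrightarrow> of_real 1 * z"
      by (intro tendsto_intros r(3))
    moreover have "isCont (disk_extension g) z"
      using holomorphic_on_imp_continuous_on[OF disk_extension_holomorphic[OF hardy2_integrable[OF that]]] z
      by (simp add: continuous_on_eq_continuous_at)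
    ultimately show ?thesis
      by (metis isCont_tendsto_compose mult_1 of_real_1)
  qed
  ultimately have "(\<integral>\<zeta>. u \<zeta> * (v \<zeta> * cnj (szego_kernel z \<zeta>)) \<partial>circle_measure) = disk_extension u z * disk_extension v z"
    using u v by (intro LIMSEQ_unique[OF _ tendsto_mult]) simp_all
  then show ?thesis by (simp add: mult.assoc)
qed

section \<open>Herglotz integrals and outer functions\<close>

text \<open>For \<open>cmod u < r < 1\<close> the kernel at \<open>u\<close> is the
  \<open>r\<close>-dilate of the kernel at \<open>u / r\<close>, which is still holomorphic in the
  disk.\<close>

lemma szego_kernel_hardy2:
  assumes u: "u \<in> ball 0 1"
  shows "szego_kernel u \<in> hardy2"
    and "w \<in> ball 0 1 \<Longrightarrow> disk_extension (szego_kernel u) w = szego_kernel u w"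
proof -
  obtain r where r: "cmod u < r" "r < 1" using u dense[of "cmod u" 1] unfolding mem_ball_0 by blast
  then have r0: "0 < r" using norm_ge_zero[of u] by linarith
  have "cmod (u / of_real r) < 1" using r r0 by (simp add: norm_divide)
  then have hol: "szego_kernel (u / of_real r) holomorphic_on ball 0 1"
    unfolding szego_kernel_def using szego_kernel_nonzero[of "u / of_real r"]
    by (intro holomorphic_intros) (simp add: less_imp_le)
  have eq: "szego_kernel (u / of_real r) (of_real r * \<zeta>) = szego_kernel u \<zeta>" for \<zeta>
    using r0 by (simp add: szego_kernel_def)
  show "szego_kernel u \<in> hardy2"
    using dilate_hardy2[OF hol less_imp_le[OF r0] r(2)] unfolding eq .
  show "disk_extension (szego_kernel u) w = szego_kernel u w" if "w \<in> ball 0 1"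
    using dilate_disk_extension[OF hol less_imp_le[OF r0] r(2) that] unfolding eq .
qed

lemma integrable_cnj_szego:
  assumes "integrable circle_measure f" "w \<in> ball 0 1"
  shows "integrable circle_measure (\<lambda>\<zeta>. f \<zeta> * cnj (szego_kernel w \<zeta>))"
proof -
  have kc: "continuous_on (sphere 0 1) (\<lambda>\<zeta>. cnj (szego_kernel w \<zeta>))"
    by (intro continuous_intros szego_kernel_continuous assms)
  obtain B where "AE \<zeta> in circle_measure. cmod (cnj (szego_kernel w \<zeta>)) \<le> B"
    using AE_circle_bounded[OF kc] .
  then show ?thesis
    by (intro integrable_circle_mult_bounded assms measurable_circle_continuous_on kc)
qed

lemma disk_extension_cmult:
  "disk_extension (\<lambda>\<zeta>. c * f \<zeta>) w = c * disk_extension f w"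
  by (simp add: disk_extension_def circle_inner_def mult.assoc)

lemma disk_extension_diff:
  assumes "integrable circle_measure f" "integrable circle_measure g" "w \<in> ball 0 1"
  shows "disk_extension (\<lambda>\<zeta>. f \<zeta> - g \<zeta>) w = disk_extension f w - disk_extension g w"
  using assms by (simp add: disk_extension_def circle_inner_def left_diff_distrib integrable_cnj_szego)

lemma const_hardy2: "(\<lambda>_. c) \<in> hardy2"
  and disk_extension_const: "w \<in> ball 0 1 \<Longrightarrow> disk_extension (\<lambda>_. c) w = c"
  using dilate_hardy2[of "\<lambda>_. c" 0] dilate_disk_extension[of "\<lambda>_. c" 0] by simp_all

text \<open>The density may be complex and enters linearly. Only for real densities is the real part
  of this integral the Poisson integral of the density.\<close>

definition herglotz :: "(complex \<Rightarrow> complex) \<Rightarrow> complex \<Rightarrow> complex" where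
  "herglotz L w = (\<integral>\<zeta>. L \<zeta> * herglotz_kernel (w * cnj \<zeta>) \<partial>circle_measure)"

lemma herglotz_kernel_szego:
  assumes "cmod w < 1" "cmod \<zeta> = 1"
  shows "herglotz_kernel (w * cnj \<zeta>) = 2 * cnj (szego_kernel w \<zeta>) - 1"
  using szego_kernel_nonzero[of "cnj w" "cnj \<zeta>"] assms
  by (simp add: herglotz_kernel_def szego_kernel_def divide_simps)

lemma integrable_herglotz:
  assumes "integrable circle_measure L" "w \<in> ball 0 1"
  shows "integrable circle_measure (\<lambda>\<zeta>. L \<zeta> * herglotz_kernel (w * cnj \<zeta>))"
proof -
  have "integrable circle_measure (\<lambda>\<zeta>. 2 * (L \<zeta> * cnj (szego_kernel w \<zeta>)) - L \<zeta>)"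
    by (intro Bochner_Integration.integrable_diff integrable_mult_right integrable_cnj_szego assms)
  then show ?thesis
    by (rule iffD1[OF Bochner_Integration.integrable_cong, rotated 2])
       (use assms in \<open>simp_all add: herglotz_kernel_szego algebra_simps\<close>)
qed

lemma herglotz_eq:
  assumes "integrable circle_measure L" "w \<in> ball 0 1"
  shows "herglotz L w = 2 * disk_extension L w - (\<integral>\<zeta>. L \<zeta> \<partial>circle_measure)"
proof -
  have "herglotz L w = (\<integral>\<zeta>. 2 * (L \<zeta> * cnj (szego_kernel w \<zeta>)) - L \<zeta> \<partial>circle_measure)"
    unfolding herglotz_def using assms
    by (intro integral_circle_cong) (simp add: herglotz_kernel_szego algebra_simps)
  then show ?thesis
    using assms by (simp add: integrable_cnj_szego disk_extension_def circle_inner_def)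
qed

lemma herglotz_holomorphic:
  assumes "integrable circle_measure L"
  shows "herglotz L holomorphic_on ball 0 1"
proof -
  have "(\<lambda>w. 2 * disk_extension L w - (\<integral>\<zeta>. L \<zeta> \<partial>circle_measure)) holomorphic_on ball 0 1"
    by (intro holomorphic_intros disk_extension_holomorphic assms)
  then show ?thesis
    by (rule holomorphic_transform) (simp add: herglotz_eq assms)
qed

lemma herglotz_const: "w \<in> ball 0 1 \<Longrightarrow> herglotz (\<lambda>_. c) w = c"
  using circle.prob_space by (subst herglotz_eq) (simp_all add: disk_extension_const)

lemma herglotz_cmult: "herglotz (\<lambda>\<zeta>. c * L \<zeta>) w = c * herglotz L w"
  by (simp add: herglotz_def mult.assoc)

lemma herglotz_add:
  assumes "integrable circle_measure f" "integrable circle_measure g" "w \<in> ball 0 1"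
  shows "herglotz (\<lambda>\<zeta>. f \<zeta> + g \<zeta>) w = herglotz f w + herglotz g w"
  using assms by (simp add: herglotz_def distrib_right integrable_herglotz)

lemma herglotz_diff:
  assumes "integrable circle_measure f" "integrable circle_measure g" "w \<in> ball 0 1"
  shows "herglotz (\<lambda>\<zeta>. f \<zeta> - g \<zeta>) w = herglotz f w - herglotz g w"
  using assms by (simp add: herglotz_def left_diff_distrib integrable_herglotz)

lemma Re_herglotz_kernel_pos:
  assumes "cmod x < 1"
  shows "Re (herglotz_kernel x) > 0"
proof -
  have x: "1 - x \<noteq> 0" using assms by auto
  have "herglotz_kernel x = (1 + x) * cnj (1 - x) / (of_real ((cmod (1 - x))\<^sup>2))"
    using x unfolding herglotz_kernel_def complex_norm_square by simp
  then have "Re (herglotz_kernel x) = Re ((1 + x) * cnj (1 - x)) / (cmod (1 - x))\<^sup>2"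
    by (simp only: Re_divide_of_real)
  also have "Re ((1 + x) * cnj (1 - x)) = 1 - (cmod x)\<^sup>2"
    unfolding cmod_power2 by (simp add: algebra_simps power2_eq_square)
  finally show ?thesis
    using assms x by (simp add: abs_square_less_1)
qed

lemma Re_herglotz_real:
  assumes "integrable circle_measure \<beta>" "w \<in> ball 0 1"
  shows "integrable circle_measure (\<lambda>\<zeta>. \<beta> \<zeta> * Re (herglotz_kernel (w * cnj \<zeta>)))"
    and "Re (herglotz (\<lambda>\<zeta>. of_real (\<beta> \<zeta>)) w) = (\<integral>\<zeta>. \<beta> \<zeta> * Re (herglotz_kernel (w * cnj \<zeta>)) \<partial>circle_measure)"
proof -
  have i: "integrable circle_measure (\<lambda>\<zeta>. of_real (\<beta> \<zeta>) * herglotz_kernel (w * cnj \<zeta>))"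
    by (intro integrable_herglotz integrable_of_real assms)
  show "integrable circle_measure (\<lambda>\<zeta>. \<beta> \<zeta> * Re (herglotz_kernel (w * cnj \<zeta>)))"
    using integrable_Re[OF i] by simp
  show "Re (herglotz (\<lambda>\<zeta>. of_real (\<beta> \<zeta>)) w) = (\<integral>\<zeta>. \<beta> \<zeta> * Re (herglotz_kernel (w * cnj \<zeta>)) \<partial>circle_measure)"
    unfolding herglotz_def integral_Re[OF i, symmetric] by simp
qed

text \<open>Maximum principle for the Poisson integral: the kernel is positive and, by
  \<open>herglotz_const\<close>, reproduces constants.\<close>

lemma Re_herglotz_le:
  assumes "integrable circle_measure \<beta>" "w \<in> ball 0 1" "AE \<zeta> in circle_measure. \<beta> \<zeta> \<le> M"
  shows "Re (herglotz (\<lambda>\<zeta>. of_real (\<beta> \<zeta>)) w) \<le> M"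
proof -
  have "Re (herglotz (\<lambda>\<zeta>. of_real (\<beta> \<zeta>)) w) \<le> Re (herglotz (\<lambda>\<zeta>. of_real M) w)"
    unfolding Re_herglotz_real(2)[OF assms(1,2)] Re_herglotz_real(2)[OF circle.integrable_const assms(2)]
  proof (intro integral_mono_AE Re_herglotz_real assms circle.integrable_const)
    show "AE \<zeta> in circle_measure. \<beta> \<zeta> * Re (herglotz_kernel (w * cnj \<zeta>)) \<le> M * Re (herglotz_kernel (w * cnj \<zeta>))"
      using assms(3) AE_circle_norm
    proof eventually_elim
      case (elim \<zeta>)
      then have "Re (herglotz_kernel (w * cnj \<zeta>)) > 0"
        using assms(2) by (intro Re_herglotz_kernel_pos) (simp add: norm_mult)
      with elim(1) show ?case by (simp add: mult_right_mono)
    qed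
  qed
  then show ?thesis using assms(2) by (simp add: herglotz_const)
qed

text \<open>Let \<open>p\<close> carry the nonnegative frequencies of \<open>L\<close> and
  \<open>p'\<close> those of its conjugate. Then \<open>p + cnj p'\<close> counts the mean
  \<open>c\<close> twice and equals \<open>L + c\<close>. By \<open>herglotz_eq\<close> the boundary
  functions are \<open>2 p - c\<close> and \<open>2 p' - cnj c\<close>. This is the additive
  splitting whose exponential factors the symbol.\<close>

lemma herglotz_boundary:
  assumes L: "L \<in> L2_circle"
  obtains h h' where "h \<in> hardy2" "h' \<in> hardy2"
    "\<And>w. w \<in> ball 0 1 \<Longrightarrow> disk_extension h w = herglotz L w"
    "\<And>w. w \<in> ball 0 1 \<Longrightarrow> disk_extension h' w = herglotz (\<lambda>\<zeta>. cnj (L \<zeta>)) w"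
    "AE \<zeta> in circle_measure. h \<zeta> + cnj (h' \<zeta>) = 2 * L \<zeta>"
proof -
  have L': "(\<lambda>\<zeta>. cnj (L \<zeta>)) \<in> L2_circle" by (rule L2_cnj[OF L])
  obtain p where p: "p \<in> hardy2" "\<And>n. circle_coeff p n = circle_coeff L n"
    using hardy2_riesz_fischer[OF L2_summable_coeff[OF L]] by metis
  obtain p' where p': "p' \<in> hardy2" "\<And>n. circle_coeff p' n = circle_coeff (\<lambda>\<zeta>. cnj (L \<zeta>)) n"
    using hardy2_riesz_fischer[OF L2_summable_coeff[OF L']] by metis
  note Li = L2_integrable[OF L] and L'i = L2_integrable[OF L'] and pi = hardy2_integrable[OF p(1)]
    and p'i = hardy2_integrable[OF p'(1)]
  define c where "c = (\<integral>\<zeta>. L \<zeta> \<partial>circle_measure)"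
  have c': "(\<integral>\<zeta>. cnj (L \<zeta>) \<partial>circle_measure) = cnj c" by (simp add: c_def)
  have ext: "disk_extension f w = disk_extension g w"
    if "integrable circle_measure f" "integrable circle_measure g" "\<And>n. circle_coeff f n = circle_coeff g n" "w \<in> ball 0 1" for f g w
    using sums_unique2[OF disk_extension_sums[OF that(1,4)]] disk_extension_sums[OF that(2,4)] that(3) by simp
  define h h' where "h \<zeta> = 2 * p \<zeta> - c" and "h' \<zeta> = 2 * p' \<zeta> - cnj c" for \<zeta>
  have h: "h \<in> hardy2" "h' \<in> hardy2"
    unfolding h_def h'_def by (intro hardy2_diff hardy2_cmult const_hardy2 p p')+
  have 1: "disk_extension h w = herglotz L w" if "w \<in> ball 0 1" for w
    using that pi ext[OF pi Li p(2) that] unfolding h_def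
    by (simp add: disk_extension_diff disk_extension_cmult disk_extension_const herglotz_eq[OF Li that] c_def)
  have 2: "disk_extension h' w = herglotz (\<lambda>\<zeta>. cnj (L \<zeta>)) w" if "w \<in> ball 0 1" for w
    using that p'i ext[OF p'i L'i p'(2) that] unfolding h'_def
    by (simp add: disk_extension_diff disk_extension_cmult disk_extension_const herglotz_eq[OF L'i that] c_def)
  have "AE \<zeta> in circle_measure. (L \<zeta> - p \<zeta>) - (cnj (p' \<zeta>) - c) = 0"
  proof (rule circle_fourier_unique)
    show "integrable circle_measure (\<lambda>\<zeta>. (L \<zeta> - p \<zeta>) - (cnj (p' \<zeta>) - c))"
      by (intro Bochner_Integration.integrable_diff Li pi integrable_cnj p'i circle.integrable_const)
    have p'0: "(\<integral>\<zeta>. p' \<zeta> \<partial>circle_measure) = cnj c"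
      using p'(2)[of 0] c' by (simp add: circle_coeff_def)
    show "circle_coeff (\<lambda>\<zeta>. (L \<zeta> - p \<zeta>) - (cnj (p' \<zeta>) - c)) n = 0" for n
    proof -
      have "circle_coeff (\<lambda>\<zeta>. cnj (p' \<zeta>)) n = cnj (\<integral>\<zeta>. p' \<zeta> * \<zeta> ^ n \<partial>circle_measure)"
        unfolding circle_coeff_def by (simp flip: complex_cnj_power complex_cnj_mult)
      also have "\<dots> = (if n = 0 then c else 0)"
        using hardy2_neg[OF p'(1), of n] p'0 by simp
      finally have "circle_coeff (\<lambda>\<zeta>. cnj (p' \<zeta>)) n = (if n = 0 then c else 0)" .
      moreover have "circle_coeff (\<lambda>\<zeta>. c) n = (if n = 0 then c else 0)"
        by (simp add: circle_coeff_def integral_circle_cnj_power)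
      ultimately show ?thesis
        by (simp add: circle_coeff_diff Li pi p'i p(2))
    qed
    show "(\<integral>\<zeta>. ((L \<zeta> - p \<zeta>) - (cnj (p' \<zeta>) - c)) * \<zeta> ^ n \<partial>circle_measure) = 0" if "n \<ge> 1" for n
    proof -
      have "(\<integral>\<zeta>. cnj (p' \<zeta>) * \<zeta> ^ n \<partial>circle_measure) = cnj (circle_coeff p' n)"
        unfolding circle_coeff_def Bochner_Integration.integral_cnj[symmetric] by simp
      also have "\<dots> = (\<integral>\<zeta>. L \<zeta> * \<zeta> ^ n \<partial>circle_measure)"
        unfolding p'(2) unfolding circle_coeff_def Bochner_Integration.integral_cnj[symmetric] by simp
      finally have "(\<integral>\<zeta>. cnj (p' \<zeta>) * \<zeta> ^ n \<partial>circle_measure) = (\<integral>\<zeta>. L \<zeta> * \<zeta> ^ n \<partial>circle_measure)" .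
      moreover have "integrable circle_measure (\<lambda>\<zeta>. c * \<zeta> ^ n)"
        by (intro L2_integrable L2_continuous continuous_intros)
      ultimately show ?thesis
        using that hardy2_neg[OF p(1) that] integrable_circle_power(1)[OF Li, of n] integrable_circle_power(1)[OF pi, of n]
          integrable_circle_power(1)[OF integrable_cnj[OF p'i], of n]
        by (simp add: left_diff_distrib integral_circle_power)
    qed
  qed
  then have "AE \<zeta> in circle_measure. h \<zeta> + cnj (h' \<zeta>) = 2 * L \<zeta>"
  proof eventually_elim
    case (elim \<zeta>)
    then have "p \<zeta> + cnj (p' \<zeta>) = L \<zeta> + c" by (simp add: algebra_simps)
    moreover have "h \<zeta> + cnj (h' \<zeta>) = 2 * (p \<zeta> + cnj (p' \<zeta>)) - 2 * c"
      by (simp add: h_def h'_def algebra_simps)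
    ultimately show ?case by (simp add: algebra_simps)
  qed
  with h 1 2 show ?thesis by (rule that)
qed

text \<open>The function \<open>E = exp (i h)\<close>, with \<open>h\<close> the Herglotz integral of \<open>Im L - c\<close>, has argument in
  \<open>[-\<kappa>, \<kappa>]\<close>, so \<open>|E| \<le> Re E / cos \<kappa>\<close>, and the circular means of \<open>Re E\<close> all equal \<open>Re (E 0)\<close>.\<close>

lemma hardy2_exp_herglotz:
  assumes L: "integrable circle_measure L"
    and Re: "AE \<zeta> in circle_measure. Re (L \<zeta>) \<le> M"
    and Im: "AE \<zeta> in circle_measure. \<bar>Im (L \<zeta>) - c\<bar> \<le> \<kappa>" and \<kappa>: "\<kappa> < pi / 2"
    and G: "G holomorphic_on ball 0 1" "\<And>w. w \<in> ball 0 1 \<Longrightarrow> cmod (G w) \<le> B"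
  obtains f where "f \<in> hardy2" "\<And>w. w \<in> ball 0 1 \<Longrightarrow> disk_extension f w = G w * exp (herglotz L w / 2)"
proof -
  define \<alpha> \<beta> where "\<alpha> \<zeta> = Re (L \<zeta>)" and "\<beta> \<zeta> = Im (L \<zeta>) - c" for \<zeta>
  have \<alpha>i: "integrable circle_measure \<alpha>" and \<beta>i: "integrable circle_measure \<beta>"
    unfolding \<alpha>_def \<beta>_def
    by (intro integrable_Re L Bochner_Integration.integrable_diff integrable_Im circle.integrable_const)+
  define E where "E w = exp (\<i> * herglotz (\<lambda>\<zeta>. of_real (\<beta> \<zeta>)) w)" for w
  have Eh: "E holomorphic_on ball 0 1"
    unfolding E_def by (intro holomorphic_intros herglotz_holomorphic integrable_of_real \<beta>i)
  have "\<kappa> \<ge> 0"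
  proof -
    have "AE \<zeta> in circle_measure. \<kappa> \<ge> 0"
      using Im by eventually_elim linarith
    then show ?thesis by (simp only: circle.AE_const)
  qed
  have cos\<kappa>: "cos \<kappa> > 0" using \<kappa> \<open>\<kappa> \<ge> 0\<close> by (intro cos_gt_zero_pi) simp_all
  have E1: "cmod (E w) * cos \<kappa> \<le> Re (E w)" if w: "w \<in> ball 0 1" for w
  proof -
    define \<theta> where "\<theta> = Re (herglotz (\<lambda>\<zeta>. of_real (\<beta> \<zeta>)) w)"
    have "\<theta> \<le> \<kappa>"
      unfolding \<theta>_def using Im by (intro Re_herglotz_le \<beta>i w) (auto simp: \<beta>_def elim!: eventually_mono)
    moreover have "- \<theta> \<le> \<kappa>"
    proof -
      have "Re (herglotz (\<lambda>\<zeta>. of_real (- \<beta> \<zeta>)) w) \<le> \<kappa>"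
        using Im by (intro Re_herglotz_le \<beta>i integrable_minus w) (auto simp: \<beta>_def elim!: eventually_mono)
      then show ?thesis using herglotz_cmult[of "-1" "\<lambda>\<zeta>. of_real (\<beta> \<zeta>)" w] by (simp add: \<theta>_def)
    qed
    ultimately have "cos \<kappa> \<le> cos \<theta>"
      using cos_monotone_0_pi_le[of "\<bar>\<theta>\<bar>" \<kappa>] \<kappa> pi_gt_zero by simp
    then show ?thesis
      by (simp add: E_def Re_exp \<theta>_def mult_left_mono)
  qed
  \<comment> \<open>At 0 the Herglotz kernel is 1, so the exponent of \<open>E 0\<close> is purely
    imaginary.\<close>
  have E0: "cmod (E 0) = 1"
    using Re_herglotz_real(2)[OF \<beta>i, of 0]
    by (simp add: E_def herglotz_def herglotz_kernel_def)
  \<comment> \<open>Squaring removes the half in the exponent. In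
    \<open>L = \<alpha> + i \<beta> + i c\<close> the part \<open>\<alpha>\<close> contributes at
    most \<open>exp M\<close>, the part \<open>i \<beta>\<close> gives exactly \<open>E\<close>, and
    \<open>i c\<close> has modulus one.\<close>
  have key: "(cmod (G w * exp (herglotz L w / 2)))\<^sup>2 \<le> B\<^sup>2 * exp M / cos \<kappa> * Re (E w)" if w: "w \<in> ball 0 1" for w
  proof -
    have "herglotz L w = herglotz (\<lambda>\<zeta>. of_real (\<alpha> \<zeta>) + (\<i> * of_real (\<beta> \<zeta>) + \<i> * of_real c)) w"
      by (rule arg_cong[where f="\<lambda>L. herglotz L w"]) (simp add: fun_eq_iff complex_eq_iff \<alpha>_def \<beta>_def)
    also have "\<dots> = herglotz (\<lambda>\<zeta>. of_real (\<alpha> \<zeta>)) w + (\<i> * herglotz (\<lambda>\<zeta>. of_real (\<beta> \<zeta>)) w + \<i> * of_real c)"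
      using \<alpha>i \<beta>i w by (simp add: herglotz_add herglotz_cmult herglotz_const)
    finally have eq: "cmod (exp (herglotz L w)) = exp (Re (herglotz (\<lambda>\<zeta>. of_real (\<alpha> \<zeta>)) w)) * cmod (E w)"
      by (simp add: E_def norm_exp_eq_Re flip: exp_add)
    have "(cmod (exp (herglotz L w / 2)))\<^sup>2 = cmod (exp (herglotz L w))"
      by (simp add: norm_power[symmetric] exp_double[symmetric])
    also have "\<dots> \<le> exp M * cmod (E w)"
      unfolding eq using Re_herglotz_le[OF \<alpha>i w, of M] Re by (simp add: \<alpha>_def mult_right_mono)
    also have "\<dots> \<le> exp M * (Re (E w) / cos \<kappa>)"
      using E1[OF w] cos\<kappa> by (simp add: field_simps)
    finally have "(cmod (exp (herglotz L w / 2)))\<^sup>2 \<le> exp M * (Re (E w) / cos \<kappa>)" .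
    moreover have "(cmod (G w))\<^sup>2 \<le> B\<^sup>2" using G(2)[OF w] by (simp add: power_mono)
    ultimately have "(cmod (G w))\<^sup>2 * (cmod (exp (herglotz L w / 2)))\<^sup>2 \<le> B\<^sup>2 * (exp M * (Re (E w) / cos \<kappa>))"
      by (intro mult_mono) simp_all
    then show ?thesis unfolding norm_mult power_mult_distrib by (simp add: mult.assoc)
  qed
  have Fh: "(\<lambda>w. G w * exp (herglotz L w / 2)) holomorphic_on ball 0 1"
    by (intro holomorphic_intros G herglotz_holomorphic L) simp
  have "(\<integral>\<zeta>. (cmod (G (of_real r * \<zeta>) * exp (herglotz L (of_real r * \<zeta>) / 2)))\<^sup>2 \<partial>circle_measure)
    \<le> B\<^sup>2 * exp M / cos \<kappa>" if r: "0 < r" "r < 1" for r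
  proof -
    note r' = less_imp_le[OF r(1)]
    have Ei: "integrable circle_measure (\<lambda>\<zeta>. E (of_real r * \<zeta>))"
      by (intro hardy2_integrable dilate_hardy2 Eh r r')
    have rb: "of_real r * \<zeta> \<in> ball 0 1" if "cmod \<zeta> = 1" for \<zeta>
      using that r by (simp add: norm_mult)
    have "(\<integral>\<zeta>. E (of_real r * \<zeta>) \<partial>circle_measure) = E 0"
      using dilate_disk_extension[OF Eh r' r(2), of 0] by (simp add: disk_extension_0)
    then have "(\<integral>\<zeta>. Re (E (of_real r * \<zeta>)) \<partial>circle_measure) \<le> 1"
      using complex_Re_le_cmod[of "E 0"] by (simp add: integral_Re[OF Ei] E0)
    moreover have "(\<integral>\<zeta>. (cmod (G (of_real r * \<zeta>) * exp (herglotz L (of_real r * \<zeta>) / 2)))\<^sup>2 \<partial>circle_measure)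
      \<le> (\<integral>\<zeta>. B\<^sup>2 * exp M / cos \<kappa> * Re (E (of_real r * \<zeta>)) \<partial>circle_measure)"
    proof (rule integral_mono)
      show "integrable circle_measure (\<lambda>\<zeta>. (cmod (G (of_real r * \<zeta>) * exp (herglotz L (of_real r * \<zeta>) / 2)))\<^sup>2)"
        by (rule L2_integrable_square[OF hardy2_L2[OF dilate_hardy2[OF Fh r' r(2)]]])
      show "integrable circle_measure (\<lambda>\<zeta>. B\<^sup>2 * exp M / cos \<kappa> * Re (E (of_real r * \<zeta>)))"
        by (intro integrable_mult_right integrable_Re Ei)
      show "(cmod (G (of_real r * \<zeta>) * exp (herglotz L (of_real r * \<zeta>) / 2)))\<^sup>2
        \<le> B\<^sup>2 * exp M / cos \<kappa> * Re (E (of_real r * \<zeta>))" if "\<zeta> \<in> space circle_measure" for \<zeta>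
        using that by (intro key rb) simp
    qed
    ultimately show ?thesis
      using mult_left_mono[of "\<integral>\<zeta>. Re (E (of_real r * \<zeta>)) \<partial>circle_measure" 1 "B\<^sup>2 * exp M / cos \<kappa>"] cos\<kappa>
      by simp
  qed
  from hardy2_of_bounded_means[OF Fh this] show ?thesis using that by blast
qed

section \<open>The quadratic form of the Toeplitz operator\<close>

text \<open>The exponential lies above its tangent at the weighted mean \<open>m\<close>;
  multiplying by \<open>W\<close> and integrating, the linear term vanishes by the choice of
  \<open>m\<close>.\<close>

lemma weighted_jensen_exp:
  fixes x W :: "'a \<Rightarrow> real"
  assumes W: "integrable M W" "AE s in M. 0 \<le> W s" and w: "0 < (\<integral>s. W s \<partial>M)"
    and x: "integrable M (\<lambda>s. x s * W s)" "integrable M (\<lambda>s. exp (x s) * W s)"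
  shows "exp ((\<integral>s. x s * W s \<partial>M) / (\<integral>s. W s \<partial>M)) \<le> (\<integral>s. exp (x s) * W s \<partial>M) / (\<integral>s. W s \<partial>M)"
proof -
  define w where "w = (\<integral>s. W s \<partial>M)"
  define m where "m = (\<integral>s. x s * W s \<partial>M) / w"
  have "w > 0" using w by (simp add: w_def)
  have "exp m * w = exp m * (w + (\<integral>s. x s * W s \<partial>M) - m * w)"
    using \<open>w > 0\<close> by (simp add: m_def)
  also have "\<dots> = (\<integral>s. exp m * (W s + x s * W s - m * W s) \<partial>M)"
    using W(1) x(1) by (simp add: w_def)
  also have "\<dots> \<le> (\<integral>s. exp (x s) * W s \<partial>M)"
  proof (rule integral_mono_AE)
    show "AE s in M. exp m * (W s + x s * W s - m * W s) \<le> exp (x s) * W s"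
      using W(2)
    proof eventually_elim
      case (elim s)
      have "exp m * (1 + (x s - m)) \<le> exp m * exp (x s - m)"
        using exp_ge_add_one_self[of "x s - m"] by (intro mult_left_mono) simp_all
      also have "\<dots> = exp (x s)" by (simp flip: exp_add)
      finally have "exp m * (1 + (x s - m)) * W s \<le> exp (x s) * W s"
        using elim by (rule mult_right_mono)
      then show ?case by (simp add: algebra_simps)
    qed
  qed (use W(1) x in simp_all)
  finally show ?thesis
    using \<open>w > 0\<close> unfolding w_def[symmetric] m_def[symmetric] by (simp add: field_simps)
qed

text \<open>For large \<open>y\<close> this is
  \<open>ln y = 2 * ln (sqrt y) \<le> 2 * sqrt y\<close>. It makes the logarithm of an integrable
  function with a positive lower bound square integrable.\<close>

lemma ln_square_le:
  assumes "0 < \<eta>" "\<eta> \<le> (y::real)"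
  shows "(ln y)\<^sup>2 \<le> (ln \<eta>)\<^sup>2 + 4 * y"
proof (cases "y \<ge> 1")
  case True
  have "ln y = 2 * ln (sqrt y)" using True by (simp add: ln_sqrt)
  also have "\<dots> \<le> 2 * sqrt y"
    using True by (intro mult_left_mono order_trans[OF ln_le_minus_one]) simp_all
  finally have "(ln y)\<^sup>2 \<le> (2 * sqrt y)\<^sup>2"
    using True by (intro power_mono) simp_all
  also have "\<dots> = 4 * y" using True by (simp add: power_mult_distrib)
  finally show ?thesis using zero_le_power2[of "ln \<eta>"] by linarith
next
  case False
  then have "(- ln y)\<^sup>2 \<le> (- ln \<eta>)\<^sup>2"
    using assms by (intro power_mono) simp_all
  then show ?thesis using assms by simp
qed

lemma L2_ln:
  assumes g: "integrable circle_measure g" and \<eta>: "0 < \<eta>" "AE \<zeta> in circle_measure. \<eta> \<le> g \<zeta>"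
  shows "(\<lambda>\<zeta>. complex_of_real (ln (g \<zeta>))) \<in> L2_circle"
proof (rule L2_bound)
  show "(\<lambda>\<zeta>. complex_of_real (ln (g \<zeta>))) \<in> borel_measurable circle_measure"
    using borel_measurable_integrable[OF g] by simp
  show "integrable circle_measure (\<lambda>\<zeta>. (ln \<eta>)\<^sup>2 + 4 * g \<zeta>)"
    using g by simp
  show "AE \<zeta> in circle_measure. (cmod (complex_of_real (ln (g \<zeta>))))\<^sup>2 \<le> (ln \<eta>)\<^sup>2 + 4 * g \<zeta>"
    using \<eta>(2) by eventually_elim (use ln_square_le[OF \<eta>(1)] in simp)
qed

lemma less_ess_inf:
  assumes \<omega>: "\<omega> \<in> borel_measurable circle_measure" and t: "ereal t < ess_inf \<omega>"
  obtains \<eta> where "0 < \<eta>" "AE \<zeta> in circle_measure. \<eta> \<le> \<omega> \<zeta> - t"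
proof -
  have "esssup circle_measure (\<lambda>\<zeta>. - ereal (\<omega> \<zeta>)) < ereal (- t)"
    using t by (metis ess_inf_def ereal_less_uminus_reorder uminus_ereal.simps(1))
  then obtain s where s: "esssup circle_measure (\<lambda>\<zeta>. - ereal (\<omega> \<zeta>)) < ereal s" "s < - t"
    using ereal_dense2 by (metis ereal_less_eq(3) less_ereal.simps(1))
  have "AE \<zeta> in circle_measure. - ereal (\<omega> \<zeta>) \<le> esssup circle_measure (\<lambda>\<zeta>. - ereal (\<omega> \<zeta>))"
    by (rule esssup_AE)
  then have "AE \<zeta> in circle_measure. - t - s \<le> \<omega> \<zeta> - t"
  proof eventually_elim
    case (elim \<zeta>)
    from order_trans[OF elim less_imp_le[OF s(1)]] show ?case by simp
  qed
  with s(2) show ?thesis by (intro that[of "- t - s"]) simp_all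
qed

lemma outer_function_herglotz:
  "outer_function \<omega> t w = exp (herglotz (\<lambda>\<zeta>. of_real (ln (\<omega> \<zeta> - t))) w / 2)"
  by (simp add: outer_function_def herglotz_def)

lemma szego_kernel_bound:
  assumes "cmod z < 1" "cmod w \<le> 1"
  shows "cmod (szego_kernel z w) \<le> 1 / (1 - cmod z)"
proof -
  have "cmod (cnj z * w) \<le> cmod z" using assms by (simp add: norm_mult mult_left_le)
  then have "1 - cmod z \<le> cmod (1 - cnj z * w)"
    using norm_triangle_ineq2[of 1 "cnj z * w"] by simp
  then show ?thesis using assms by (simp add: szego_kernel_def norm_divide frac_le)
qed

lemma szego_kernel_holomorphic: "z \<in> ball 0 1 \<Longrightarrow> szego_kernel z holomorphic_on ball 0 1"
  unfolding szego_kernel_def by (intro holomorphic_intros) (use szego_kernel_nonzero in auto)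

text \<open>Jensen for the Poisson kernel bounds the squared modulus of the outer function by the
  Poisson integral of \<open>\<omega> - t\<close>, whose circular means all equal its value at 0.
  Integrability of \<open>\<omega>\<close> thus suffices although \<open>\<omega>\<close> may be
  unbounded above.\<close>

lemma outer_function_szego_hardy2:
  assumes \<omega>: "integrable circle_measure \<omega>" and t: "ereal t < ess_inf \<omega>" and u: "u \<in> ball 0 1"
  obtains g where "g \<in> hardy2" "\<And>w. w \<in> ball 0 1 \<Longrightarrow> disk_extension g w = outer_function \<omega> t w * szego_kernel u w"
proof -
  obtain \<eta> where \<eta>: "0 < \<eta>" "AE \<zeta> in circle_measure. \<eta> \<le> \<omega> \<zeta> - t"
    using less_ess_inf[OF borel_measurable_integrable[OF \<omega>] t] .
  have \<omega>t: "integrable circle_measure (\<lambda>\<zeta>. \<omega> \<zeta> - t)" using \<omega> by simp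
  define l where "l \<zeta> = ln (\<omega> \<zeta> - t)" for \<zeta>
  have li: "integrable circle_measure (\<lambda>\<zeta>. complex_of_real (l \<zeta>))"
    unfolding l_def by (rule L2_integrable[OF L2_ln[OF \<omega>t \<eta>]])
  have lr: "integrable circle_measure l"
    using integrable_Re[OF li] by simp
  define B where "B = 1 / (1 - cmod u)"
  have jensen: "(cmod (outer_function \<omega> t w * szego_kernel u w))\<^sup>2 \<le> B\<^sup>2 * Re (herglotz (\<lambda>\<zeta>. of_real (\<omega> \<zeta> - t)) w)"
    if w: "w \<in> ball 0 1" for w
  proof -
    define P where "P \<zeta> = Re (herglotz_kernel (w * cnj \<zeta>))" for \<zeta>
    have P: "AE \<zeta> in circle_measure. 0 \<le> P \<zeta>"
      unfolding P_def using AE_circle_norm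
      by eventually_elim (use w in \<open>simp add: norm_mult less_imp_le Re_herglotz_kernel_pos\<close>)
    have P1: "integrable circle_measure P" "(\<integral>\<zeta>. P \<zeta> \<partial>circle_measure) = 1"
      using Re_herglotz_real[OF circle.integrable_const w, of 1] herglotz_const[OF w, of 1] by (simp_all add: P_def[abs_def])
    have e: "AE \<zeta> in circle_measure. exp (l \<zeta>) * P \<zeta> = (\<omega> \<zeta> - t) * P \<zeta>"
      using \<eta>(2) by eventually_elim (use \<eta>(1) in \<open>simp add: l_def\<close>)
    note i\<omega> = Re_herglotz_real(1)[OF \<omega>t w, folded P_def] and il = Re_herglotz_real(1)[OF lr w, folded P_def]
    have m: "(\<lambda>\<zeta>. exp (l \<zeta>) * P \<zeta>) \<in> borel_measurable circle_measure"
      using borel_measurable_integrable[OF lr] borel_measurable_integrable[OF P1(1)] by measurable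
    have ie: "integrable circle_measure (\<lambda>\<zeta>. exp (l \<zeta>) * P \<zeta>)"
      using i\<omega> by (rule iffD2[OF integrable_cong_AE[OF m borel_measurable_integrable[OF i\<omega>] e]])
    have "exp (\<integral>\<zeta>. l \<zeta> * P \<zeta> \<partial>circle_measure) \<le> (\<integral>\<zeta>. exp (l \<zeta>) * P \<zeta> \<partial>circle_measure)"
      using weighted_jensen_exp[OF P1(1) P _ il ie] P1(2) by simp
    also have "\<dots> = (\<integral>\<zeta>. (\<omega> \<zeta> - t) * P \<zeta> \<partial>circle_measure)"
      by (rule integral_cong_AE[OF m borel_measurable_integrable[OF i\<omega>] e])
    finally have 1: "exp (Re (herglotz (\<lambda>\<zeta>. of_real (l \<zeta>)) w)) \<le> Re (herglotz (\<lambda>\<zeta>. of_real (\<omega> \<zeta> - t)) w)"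
      unfolding Re_herglotz_real(2)[OF lr w] Re_herglotz_real(2)[OF \<omega>t w] P_def .
    have "(cmod (outer_function \<omega> t w))\<^sup>2 = exp (Re (herglotz (\<lambda>\<zeta>. of_real (l \<zeta>)) w))"
      by (simp add: outer_function_herglotz l_def norm_exp_eq_Re flip: exp_double)
    with 1 have "(cmod (outer_function \<omega> t w))\<^sup>2 \<le> Re (herglotz (\<lambda>\<zeta>. of_real (\<omega> \<zeta> - t)) w)" by simp
    moreover have "(cmod (szego_kernel u w))\<^sup>2 \<le> B\<^sup>2"
      using szego_kernel_bound[of u w] u w by (intro power_mono) (simp_all add: B_def)
    ultimately have "(cmod (szego_kernel u w))\<^sup>2 * (cmod (outer_function \<omega> t w))\<^sup>2 \<le> B\<^sup>2 * Re (herglotz (\<lambda>\<zeta>. of_real (\<omega> \<zeta> - t)) w)"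
      by (intro mult_mono) simp_all
    then show ?thesis by (simp add: norm_mult power_mult_distrib mult.commute)
  qed
  have \<omega>c: "integrable circle_measure (\<lambda>\<zeta>. complex_of_real (\<omega> \<zeta> - t))"
    using \<omega>t by (rule integrable_of_real)
  have Hh: "herglotz (\<lambda>\<zeta>. of_real (\<omega> \<zeta> - t)) holomorphic_on ball 0 1"
    by (rule herglotz_holomorphic[OF \<omega>c])
  have Fh: "(\<lambda>w. outer_function \<omega> t w * szego_kernel u w) holomorphic_on ball 0 1"
    unfolding outer_function_herglotz using li
    by (intro holomorphic_intros herglotz_holomorphic szego_kernel_holomorphic u) (simp_all add: l_def)
  have "(\<integral>\<zeta>. (cmod (outer_function \<omega> t (of_real r * \<zeta>) * szego_kernel u (of_real r * \<zeta>)))\<^sup>2 \<partial>circle_measure)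
    \<le> B\<^sup>2 * Re (herglotz (\<lambda>\<zeta>. of_real (\<omega> \<zeta> - t)) 0)" if r: "0 < r" "r < 1" for r
  proof -
    note r' = less_imp_le[OF r(1)]
    let ?H = "\<lambda>\<zeta>. herglotz (\<lambda>\<zeta>. of_real (\<omega> \<zeta> - t)) (of_real r * \<zeta>)"
    have Hi: "integrable circle_measure ?H"
      by (intro hardy2_integrable dilate_hardy2 Hh r r')
    have "(\<integral>\<zeta>. (cmod (outer_function \<omega> t (of_real r * \<zeta>) * szego_kernel u (of_real r * \<zeta>)))\<^sup>2 \<partial>circle_measure)
      \<le> (\<integral>\<zeta>. B\<^sup>2 * Re (?H \<zeta>) \<partial>circle_measure)"
    proof (rule integral_mono)
      show "integrable circle_measure (\<lambda>\<zeta>. (cmod (outer_function \<omega> t (of_real r * \<zeta>) * szego_kernel u (of_real r * \<zeta>)))\<^sup>2)"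
        by (rule L2_integrable_square[OF hardy2_L2[OF dilate_hardy2[OF Fh r' r(2)]]])
      show "integrable circle_measure (\<lambda>\<zeta>. B\<^sup>2 * Re (?H \<zeta>))"
        by (intro integrable_mult_right integrable_Re Hi)
      show "(cmod (outer_function \<omega> t (of_real r * \<zeta>) * szego_kernel u (of_real r * \<zeta>)))\<^sup>2 \<le> B\<^sup>2 * Re (?H \<zeta>)"
        if "\<zeta> \<in> space circle_measure" for \<zeta>
        using that r by (intro jensen) (simp add: norm_mult)
    qed
    also have "\<dots> = B\<^sup>2 * Re (\<integral>\<zeta>. ?H \<zeta> \<partial>circle_measure)"
      using integral_Re[OF Hi] by simp
    also have "(\<integral>\<zeta>. ?H \<zeta> \<partial>circle_measure) = herglotz (\<lambda>\<zeta>. of_real (\<omega> \<zeta> - t)) 0"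
      using dilate_disk_extension[OF Hh r' r(2), of 0] by (simp add: disk_extension_0)
    finally show ?thesis .
  qed
  from hardy2_of_bounded_means[OF Fh this] show ?thesis using that by blast
qed

lemma szego_kernel_form_domain:
  assumes "integrable circle_measure \<omega>" "ess_inf \<omega> > -\<infinity>" "u \<in> ball 0 1"
  shows "szego_kernel u \<in> toeplitz_form_domain \<omega>"
proof -
  obtain t where t: "ereal t < ess_inf \<omega>"
    using ereal_dense2[OF assms(2)] by auto
  obtain g where "g \<in> hardy2" "\<And>w. w \<in> ball 0 1 \<Longrightarrow> disk_extension g w = outer_function \<omega> t w * szego_kernel u w"
    using outer_function_szego_hardy2[OF assms(1) t assms(3)] by blast
  with t show ?thesis
    using szego_kernel_hardy2[OF assms(3)] by (force simp: toeplitz_form_domain_def)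
qed

section \<open>Uniqueness of images and of solutions\<close>

lemma hardy2_zeroI:
  assumes f: "f \<in> hardy2" and 0: "\<And>w. w \<in> ball 0 1 \<Longrightarrow> disk_extension f w = 0"
  shows "AE \<zeta> in circle_measure. f \<zeta> = 0"
proof -
  obtain r where r: "\<And>k. 0 < r k" "\<And>k. r k < 1" "r \<longlonglongrightarrow> 1"
    and ae: "AE \<zeta> in circle_measure. \<forall>g\<in>{f}. (\<lambda>k. disk_extension g (of_real (r k) * \<zeta>)) \<longlonglongrightarrow> g \<zeta>"
    using hardy2_radial_limits[of "{f}"] f by blast
  from ae AE_circle_norm show ?thesis
  proof eventually_elim
    case (elim \<zeta>)
    have "disk_extension f (of_real (r k) * \<zeta>) = 0" for k
      using r(1,2)[of k] elim(2) by (intro 0) (simp add: norm_mult)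
    then show ?case using elim(1) by (simp add: LIMSEQ_const_iff)
  qed
qed

text \<open>Szego kernels belong to the form domain, and pairing with them evaluates the disk
  extension; so testing on them alone determines a represented function.\<close>

lemma toeplitz_represents_unique:
  assumes \<omega>: "integrable circle_measure \<omega>" "ess_inf \<omega> > -\<infinity>"
    and h: "toeplitz_represents \<omega> f h" "toeplitz_represents \<omega> f h'"
  shows "AE \<zeta> in circle_measure. h \<zeta> = h' \<zeta>"
proof -
  have hh: "h \<in> hardy2" "h' \<in> hardy2" using h by (simp_all add: toeplitz_represents_def)
  have "AE \<zeta> in circle_measure. h \<zeta> - h' \<zeta> = 0"
  proof (rule hardy2_zeroI[OF hardy2_diff[OF hh]])
    fix u :: complex assume u: "u \<in> ball 0 1"
    have "circle_inner h (szego_kernel u) = circle_inner h' (szego_kernel u)"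
      using h szego_kernel_form_domain[OF \<omega> u] by (simp add: toeplitz_represents_def)
    then show "disk_extension (\<lambda>\<zeta>. h \<zeta> - h' \<zeta>) u = 0"
      using u hh by (simp add: disk_extension_diff hardy2_integrable) (simp add: disk_extension_def)
  qed
  then show ?thesis by simp
qed

lemma circle_inner_cnj: "circle_inner g f = cnj (circle_inner f g)"
  unfolding circle_inner_def Bochner_Integration.integral_cnj[symmetric] by (simp add: mult.commute)

lemma toeplitz_form_cnj: "toeplitz_form \<omega> g f = cnj (toeplitz_form \<omega> f g)"
  unfolding toeplitz_form_def Bochner_Integration.integral_cnj[symmetric] by (simp add: mult_ac)

text \<open>Hermitian symmetry of the form determines all inner products of two solutions, so their
  difference vanishes; this avoids showing that the form domain is a linear space.\<close>

lemma toeplitz_equation_unique: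
  assumes dom: "f1 \<in> toeplitz_form_domain \<omega>" "f2 \<in> toeplitz_form_domain \<omega>"
    and 1: "\<And>g. g \<in> toeplitz_form_domain \<omega> \<Longrightarrow> toeplitz_form \<omega> f1 g = circle_inner k g + \<mu> * circle_inner f1 g"
    and 2: "\<And>g. g \<in> toeplitz_form_domain \<omega> \<Longrightarrow> toeplitz_form \<omega> f2 g = circle_inner k g + \<mu> * circle_inner f2 g"
    and \<mu>: "Im \<mu> \<noteq> 0"
  shows "AE \<zeta> in circle_measure. f1 \<zeta> = f2 \<zeta>"
proof -
  have L2: "f1 \<in> L2_circle" "f2 \<in> L2_circle"
    using dom by (simp_all add: toeplitz_form_domain_def hardy2_L2)
  have sym: "(\<mu> - cnj \<mu>) * circle_inner f g = cnj (circle_inner k f) - circle_inner k g"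
    if "toeplitz_form \<omega> f g = circle_inner k g + \<mu> * circle_inner f g"
      "toeplitz_form \<omega> g f = circle_inner k f + \<mu> * circle_inner g f" for f g
  proof -
    have "circle_inner k g + \<mu> * circle_inner f g = cnj (circle_inner k f + \<mu> * circle_inner g f)"
      using that toeplitz_form_cnj[of \<omega> f g] by simp
    then show ?thesis using circle_inner_cnj[of f g] by (simp add: algebra_simps)
  qed
  \<comment> \<open>Each right-hand side of \<open>sym\<close> is a term in \<open>f\<close> alone
    minus a term in \<open>g\<close> alone, so the alternating sum of its four instances
    cancels.\<close>
  have "(\<mu> - cnj \<mu>) * (circle_inner f1 f1 - circle_inner f1 f2 - circle_inner f2 f1 + circle_inner f2 f2) = 0"
    using sym[OF 1 1, OF dom(1) dom(1)] sym[OF 1 2, OF dom(2) dom(1)] sym[OF 2 1, OF dom(1) dom(2)] sym[OF 2 2, OF dom(2) dom(2)]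
    by (simp add: right_diff_distrib distrib_left)
  moreover have "\<mu> - cnj \<mu> \<noteq> 0" using \<mu> by (simp add: complex_eq_iff)
  ultimately have "circle_inner f1 f1 - circle_inner f1 f2 - circle_inner f2 f1 + circle_inner f2 f2 = 0"
    by simp
  moreover have "circle_inner f1 f1 - circle_inner f1 f2 - circle_inner f2 f1 + circle_inner f2 f2
    = (\<integral>\<zeta>. (f1 \<zeta> - f2 \<zeta>) * cnj (f1 \<zeta> - f2 \<zeta>) \<partial>circle_measure)"
    using L2 by (simp add: circle_inner_def left_diff_distrib right_diff_distrib L2_mult_integrable L2_cnj)
  ultimately have "(\<integral>\<zeta>. (cmod (f1 \<zeta> - f2 \<zeta>))\<^sup>2 \<partial>circle_measure) = 0"
    using integral_cmod_square[OF L2_diff[OF L2]] by (simp only: of_real_eq_0_iff)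
  then have "AE \<zeta> in circle_measure. (cmod (f1 \<zeta> - f2 \<zeta>))\<^sup>2 = 0"
    by (rule iffD1[OF integral_nonneg_eq_0_iff_AE[OF L2_integrable_square[OF L2_diff[OF L2]]], rotated]) simp
  then show ?thesis by simp
qed

section \<open>The resolvent on Szego kernels\<close>

text \<open>A logarithm of \<open>i (\<omega> - (t + i \<epsilon>))\<close>, which has real part \<open>\<epsilon> > 0\<close>.\<close>

definition log_symbol :: "(complex \<Rightarrow> real) \<Rightarrow> real \<Rightarrow> real \<Rightarrow> complex \<Rightarrow> complex" where
  "log_symbol \<omega> t \<epsilon> \<zeta> =
     of_real (ln (cmod (Complex \<epsilon> (\<omega> \<zeta> - t)))) + \<i> * of_real (arctan ((\<omega> \<zeta> - t) / \<epsilon>))"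

lemma exp_log_symbol:
  assumes "\<epsilon> > 0"
  shows "exp (log_symbol \<omega> t \<epsilon> \<zeta>) = \<i> * (of_real (\<omega> \<zeta>) - (of_real t + \<i> * of_real \<epsilon>))"
proof -
  define y where "y = (\<omega> \<zeta> - t) / \<epsilon>"
  have x: "\<omega> \<zeta> - t = \<epsilon> * y" using assms by (simp add: y_def)
  have c: "cmod (Complex \<epsilon> (\<omega> \<zeta> - t)) = \<epsilon> * sqrt (1 + y\<^sup>2)"
  proof -
    have "\<epsilon>\<^sup>2 + (\<epsilon> * y)\<^sup>2 = \<epsilon>\<^sup>2 * (1 + y\<^sup>2)"
      by (simp add: power_mult_distrib distrib_left)
    then show ?thesis
      unfolding x cmod_def complex.sel using assms by (simp only: real_sqrt_mult real_sqrt_abs abs_of_pos)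
  qed
  have s: "sqrt (1 + y\<^sup>2) > 0" by (simp add: add_pos_nonneg)
  have "exp (log_symbol \<omega> t \<epsilon> \<zeta>) = of_real (\<epsilon> * sqrt (1 + y\<^sup>2)) * exp (\<i> * of_real (arctan y))"
    unfolding log_symbol_def c y_def[symmetric] exp_add using assms s
    by (simp add: exp_of_real del: of_real_mult)
  also have "\<dots> = Complex \<epsilon> (\<omega> \<zeta> - t)"
    using s by (simp add: complex_eq_iff Re_exp Im_exp cos_arctan sin_arctan x)
  also have "\<dots> = \<i> * (of_real (\<omega> \<zeta>) - (of_real t + \<i> * of_real \<epsilon>))"
    by (simp add: complex_eq_iff)
  finally show ?thesis .
qed

lemma Re_log_symbol: "Re (log_symbol \<omega> t \<epsilon> \<zeta>) = ln (cmod (Complex \<epsilon> (\<omega> \<zeta> - t)))"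
  and Im_log_symbol: "Im (log_symbol \<omega> t \<epsilon> \<zeta>) = arctan ((\<omega> \<zeta> - t) / \<epsilon>)"
  by (simp_all add: log_symbol_def)

lemma cmod_Complex_ge:
  "\<epsilon> > 0 \<Longrightarrow> \<epsilon> \<le> cmod (Complex \<epsilon> x)" "\<bar>x\<bar> \<le> cmod (Complex \<epsilon> x)"
  using abs_Re_le_cmod[of "Complex \<epsilon> x"] abs_Im_le_cmod[of "Complex \<epsilon> x"] by simp_all

lemma integrable_cmod_Complex:
  assumes "integrable circle_measure \<omega>"
  shows "integrable circle_measure (\<lambda>\<zeta>. cmod (Complex \<epsilon> (\<omega> \<zeta> - t)))"
proof -
  have "integrable circle_measure (\<lambda>\<zeta>. of_real \<epsilon> + \<i> * of_real (\<omega> \<zeta> - t))"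
    by (intro Bochner_Integration.integrable_add circle.integrable_const integrable_mult_right integrable_of_real
        Bochner_Integration.integrable_diff assms)
  from integrable_norm[OF this] show ?thesis
    by (simp add: Complex_eq)
qed

lemma log_symbol_L2:
  assumes \<omega>: "integrable circle_measure \<omega>" and "\<epsilon> > 0"
  shows "log_symbol \<omega> t \<epsilon> \<in> L2_circle"
proof -
  have "(\<lambda>\<zeta>. complex_of_real (ln (cmod (Complex \<epsilon> (\<omega> \<zeta> - t))))) \<in> L2_circle"
    by (rule L2_ln[OF integrable_cmod_Complex[OF \<omega>] \<open>\<epsilon> > 0\<close>]) (simp add: cmod_Complex_ge \<open>\<epsilon> > 0\<close>)
  moreover have "(\<lambda>\<zeta>. complex_of_real (arctan ((\<omega> \<zeta> - t) / \<epsilon>))) \<in> L2_circle"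
  proof (rule L2_bounded)
    have "(\<lambda>x. complex_of_real (arctan ((x - t) / \<epsilon>))) \<in> borel_measurable borel"
      using \<open>\<epsilon> > 0\<close> by (intro borel_measurable_continuous_onI continuous_intros) auto
    then show "(\<lambda>\<zeta>. complex_of_real (arctan ((\<omega> \<zeta> - t) / \<epsilon>))) \<in> borel_measurable circle_measure"
      by (rule measurable_compose[OF borel_measurable_integrable[OF \<omega>]])
    show "AE \<zeta> in circle_measure. cmod (complex_of_real (arctan ((\<omega> \<zeta> - t) / \<epsilon>))) \<le> pi / 2"
    proof (rule AE_I2)
      fix \<zeta>
      have "\<bar>arctan ((\<omega> \<zeta> - t) / \<epsilon>)\<bar> \<le> pi / 2"
        using arctan_bounded[of "(\<omega> \<zeta> - t) / \<epsilon>"] unfolding abs_le_iff by linarith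
      then show "cmod (complex_of_real (arctan ((\<omega> \<zeta> - t) / \<epsilon>))) \<le> pi / 2" by simp
    qed
  qed
  ultimately show ?thesis
    unfolding log_symbol_def[abs_def] by (intro L2_add L2_cmult)
qed

text \<open>The solution is \<open>f = c * K\<^sub>z / F\<close>. Multiplied by
  \<open>F * cnj F'\<close> it leaves \<open>c * K\<^sub>z * cnj F'\<close>, and integration against
  \<open>cnj g\<close> evaluates the conjugate of \<open>F' g\<close> at \<open>z\<close>. Each of
  the three memberships in \<open>hardy2\<close> comes from \<open>hardy2_exp_herglotz\<close>, with
  a density whose imaginary part is minus that of \<open>lam\<close>.\<close>

lemma toeplitz_equation_solution:
  fixes t \<epsilon> :: real
  assumes \<omega>: "integrable circle_measure \<omega>" "ess_inf \<omega> > -\<infinity>" and z: "z \<in> ball 0 1" and \<epsilon>: "\<epsilon> > 0"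
  defines "\<mu> \<equiv> of_real t + \<i> * of_real \<epsilon>"
  obtains f where "f \<in> toeplitz_form_domain \<omega>"
    "\<And>g. g \<in> toeplitz_form_domain \<omega> \<Longrightarrow>
      toeplitz_form \<omega> f g = circle_inner (szego_kernel z) g + \<mu> * circle_inner f g"
    "cmod (disk_extension f z) = cmod (szego_kernel z z) *
      exp (- (\<integral>\<zeta>. ln (cmod (Complex \<epsilon> (\<omega> \<zeta> - t))) * Re (herglotz_kernel (z * cnj \<zeta>)) \<partial>circle_measure))"
proof -
  define lam where "lam = log_symbol \<omega> t \<epsilon>"
  have lam: "lam \<in> L2_circle" "(\<lambda>\<zeta>. cnj (lam \<zeta>)) \<in> L2_circle"
    unfolding lam_def by (intro log_symbol_L2 L2_cnj \<omega> \<epsilon>)+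
  have lami: "integrable circle_measure lam" "integrable circle_measure (\<lambda>\<zeta>. cnj (lam \<zeta>))"
    using lam by (auto intro: L2_integrable)
  note \<omega>m = borel_measurable_integrable[OF \<omega>(1)]
  obtain t0 where t0: "ereal t0 < ess_inf \<omega>"
    using ereal_dense2[OF \<omega>(2)] by auto
  obtain \<eta> where \<eta>: "0 < \<eta>" "AE \<zeta> in circle_measure. \<eta> \<le> \<omega> \<zeta> - t0"
    using less_ess_inf[OF \<omega>m t0] .
  have loglow: "ln \<epsilon> \<le> Re (lam \<zeta>)" for \<zeta>
    unfolding lam_def Re_log_symbol by (rule ln_mono[OF cmod_Complex_ge(1)[OF \<epsilon>] \<epsilon>])
  \<comment> \<open>Since \<open>\<omega>\<close> exceeds \<open>t0\<close> almost everywhere,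
    \<open>Im (lam \<zeta>)\<close> lies in \<open>[a, pi / 2]\<close>. This interval has centre
    \<open>c\<^sub>0\<close> and half-length \<open>\<kappa>\<close>, which is below
    \<open>pi / 2\<close> because \<open>a > - pi / 2\<close>.\<close>
  define a where "a = arctan ((t0 - t) / \<epsilon>)"
  define c\<^sub>0 where "c\<^sub>0 = (pi / 2 + a) / 2"
  define \<kappa> where "\<kappa> = (pi / 2 - a) / 2"
  have \<kappa>: "\<kappa> < pi / 2" using arctan_lbound[of "(t0 - t) / \<epsilon>"] by (simp add: \<kappa>_def a_def)
  have Im: "AE \<zeta> in circle_measure. \<bar>Im (lam \<zeta>) - c\<^sub>0\<bar> \<le> \<kappa>"
    using \<eta>(2)
  proof eventually_elim
    case (elim \<zeta>)
    then have "(t0 - t) / \<epsilon> \<le> (\<omega> \<zeta> - t) / \<epsilon>" using \<eta>(1) \<epsilon> by (simp add: divide_right_mono)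
    then have "a \<le> Im (lam \<zeta>)" by (simp add: a_def lam_def Im_log_symbol arctan_monotone')
    moreover have "Im (lam \<zeta>) \<le> pi / 2"
      using arctan_ubound by (simp add: lam_def Im_log_symbol less_imp_le)
    ultimately show ?case by (simp add: c\<^sub>0_def \<kappa>_def abs_le_iff field_simps)
  qed
  define F where "F w = exp (herglotz lam w / 2)" for w
  define F' where "F' w = exp (herglotz (\<lambda>\<zeta>. cnj (lam \<zeta>)) w / 2)" for w
  \<comment> \<open>Normalized so that \<open>- \<i> * c * cnj (F' z) = 1\<close>; the factor
    \<open>- \<i>\<close> undoes the rotation of the symbol.\<close>
  define c where "c = \<i> / cnj (F' z)"
  have F'z: "F' z \<noteq> 0" by (simp add: F'_def)
  define K where "K w = c * szego_kernel z w" for w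
  have Kh: "K holomorphic_on ball 0 1"
    unfolding K_def by (intro holomorphic_intros szego_kernel_holomorphic z)
  define B where "B = cmod c * (1 / (1 - cmod z))"
  have Kb: "cmod (K w) \<le> B" if "w \<in> ball 0 1" for w
    unfolding K_def B_def norm_mult using szego_kernel_bound[of z w] that z
    by (intro mult_left_mono) simp_all
  obtain f where f: "f \<in> hardy2" and fw: "\<And>w. w \<in> ball 0 1 \<Longrightarrow> disk_extension f w = K w * exp (herglotz (\<lambda>\<zeta>. - lam \<zeta>) w / 2)"
  proof (rule hardy2_exp_herglotz)
    show "integrable circle_measure (\<lambda>\<zeta>. - lam \<zeta>)" using lami(1) by simp
    show "AE \<zeta> in circle_measure. Re (- lam \<zeta>) \<le> - ln \<epsilon>" using loglow by (intro AE_I2) simp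
    show "AE \<zeta> in circle_measure. \<bar>Im (- lam \<zeta>) - (- c\<^sub>0)\<bar> \<le> \<kappa>"
      using Im by eventually_elim (simp add: abs_minus_commute)
  qed (use \<kappa> Kh Kb in auto)
  have fF: "disk_extension f w * F w = K w" if "w \<in> ball 0 1" for w
  proof -
    have "herglotz (\<lambda>\<zeta>. - lam \<zeta>) w = - herglotz lam w"
      using herglotz_cmult[of "-1" lam w] by simp
    then show ?thesis using fw[OF that] by (simp add: F_def flip: exp_add)
  qed
  have lnint: "(\<lambda>\<zeta>. complex_of_real (ln (\<omega> \<zeta> - s))) \<in> L2_circle"
    if "0 < \<eta>" "AE \<zeta> in circle_measure. \<eta> \<le> \<omega> \<zeta> - s" for s \<eta>
    by (rule L2_ln[OF _ that]) (use \<omega>(1) in simp)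
  have fdom: "f \<in> toeplitz_form_domain \<omega>"
  proof -
    let ?l = "\<lambda>\<zeta>. complex_of_real (ln (\<omega> \<zeta> - t0))"
    have li: "integrable circle_measure ?l" by (rule L2_integrable[OF lnint[OF \<eta>]])
    obtain g where g: "g \<in> hardy2" and gw: "\<And>w. w \<in> ball 0 1 \<Longrightarrow> disk_extension g w = K w * exp (herglotz (\<lambda>\<zeta>. ?l \<zeta> - lam \<zeta>) w / 2)"
    proof (rule hardy2_exp_herglotz)
      show "integrable circle_measure (\<lambda>\<zeta>. ?l \<zeta> - lam \<zeta>)" using li lami(1) by simp
      \<comment> \<open>This is a bound for the quotient of \<open>\<omega> - t0\<close> by the
        modulus \<open>q\<close> of \<open>\<omega> - \<mu>\<close>: as
        \<open>q \<ge> \<epsilon>\<close>, the shift \<open>\<bar>t - t0\<bar>\<close> is at most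
        \<open>\<bar>t - t0\<bar> / \<epsilon>\<close> times \<open>q\<close>.\<close>
      show "AE \<zeta> in circle_measure. Re (?l \<zeta> - lam \<zeta>) \<le> ln (1 + \<bar>t - t0\<bar> / \<epsilon>)"
        using \<eta>(2)
      proof eventually_elim
        case (elim \<zeta>)
        define q where "q = cmod (Complex \<epsilon> (\<omega> \<zeta> - t))"
        have q: "q \<ge> \<epsilon>" "\<bar>\<omega> \<zeta> - t\<bar> \<le> q" using cmod_Complex_ge \<epsilon> by (simp_all add: q_def)
        have "\<omega> \<zeta> - t0 \<le> q + \<bar>t - t0\<bar> * 1" using q(2) by simp
        also have "\<dots> \<le> q + \<bar>t - t0\<bar> * (q / \<epsilon>)"
          using q \<epsilon> by (intro add_left_mono mult_left_mono) simp_all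
        also have "\<dots> = (1 + \<bar>t - t0\<bar> / \<epsilon>) * q" by (simp add: algebra_simps)
        finally have "ln (\<omega> \<zeta> - t0) \<le> ln ((1 + \<bar>t - t0\<bar> / \<epsilon>) * q)"
          using elim \<eta>(1) by simp
        also have "\<dots> = ln (1 + \<bar>t - t0\<bar> / \<epsilon>) + ln q"
          using q \<epsilon> by (intro ln_mult_pos) (auto intro: add_pos_nonneg)
        finally show ?case by (simp add: lam_def Re_log_symbol q_def)
      qed
      show "AE \<zeta> in circle_measure. \<bar>Im (?l \<zeta> - lam \<zeta>) - (- c\<^sub>0)\<bar> \<le> \<kappa>"
        using Im by eventually_elim (simp add: abs_minus_commute)
    qed (use \<kappa> Kh Kb in auto)
    have "disk_extension g w = outer_function \<omega> t0 w * disk_extension f w" if w: "w \<in> ball 0 1" for w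
    proof -
      have "herglotz (\<lambda>\<zeta>. ?l \<zeta> - lam \<zeta>) w = herglotz ?l w - herglotz lam w"
        by (rule herglotz_diff[OF li lami(1) w])
      then have "disk_extension g w * F w = K w * outer_function \<omega> t0 w"
        using gw[OF w] by (simp add: F_def outer_function_herglotz flip: exp_add add: diff_divide_distrib)
      also have "\<dots> = outer_function \<omega> t0 w * disk_extension f w * F w"
        using fF[OF w] by (simp add: mult_ac)
      finally show ?thesis by (simp add: F_def)
    qed
    with f g t0 show ?thesis unfolding toeplitz_form_domain_def by blast
  qed
  obtain h h' where h: "h \<in> hardy2" "h' \<in> hardy2"
    and hw: "\<And>w. w \<in> ball 0 1 \<Longrightarrow> disk_extension h w = herglotz lam w"
      "\<And>w. w \<in> ball 0 1 \<Longrightarrow> disk_extension h' w = herglotz (\<lambda>\<zeta>. cnj (lam \<zeta>)) w"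
    and hlam: "AE \<zeta> in circle_measure. h \<zeta> + cnj (h' \<zeta>) = 2 * lam \<zeta>"
    using herglotz_boundary[OF lam(1)] by blast
  note Kz = szego_kernel_hardy2[OF z]
  have form: "toeplitz_form \<omega> f g = circle_inner (szego_kernel z) g + \<mu> * circle_inner f g"
    if gdom: "g \<in> toeplitz_form_domain \<omega>" for g
  proof -
    \<comment> \<open>The parameter \<open>s\<close> comes with \<open>g\<close> and may differ from
      \<open>t0\<close>, so the comparison of moduli is redone for it.\<close>
    obtain s \<psi> where g: "g \<in> hardy2" and s: "ereal s < ess_inf \<omega>" and \<psi>: "\<psi> \<in> hardy2"
      and \<psi>w: "\<And>w. w \<in> ball 0 1 \<Longrightarrow> disk_extension \<psi> w = outer_function \<omega> s w * disk_extension g w"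
      using gdom by (auto simp: toeplitz_form_domain_def)
    obtain \<eta>' where \<eta>': "0 < \<eta>'" "AE \<zeta> in circle_measure. \<eta>' \<le> \<omega> \<zeta> - s"
      using less_ess_inf[OF \<omega>m s] .
    let ?l = "\<lambda>\<zeta>. complex_of_real (ln (\<omega> \<zeta> - s))"
    have li: "integrable circle_measure ?l" by (rule L2_integrable[OF lnint[OF \<eta>']])
    \<comment> \<open>Chosen so that the modulus of \<open>\<omega> - \<mu>\<close> is at most
      \<open>Q * (\<omega> - s)\<close>: the excess \<open>\<epsilon> + \<bar>s - t\<bar>\<close> is
      absorbed by \<open>\<omega> - s \<ge> \<eta>'\<close>.\<close>
    define Q where "Q = 1 + (\<epsilon> + \<bar>s - t\<bar>) / \<eta>'"
    obtain k where k: "k \<in> hardy2" and kw: "\<And>w. w \<in> ball 0 1 \<Longrightarrow> disk_extension k w = 1 * exp (herglotz (\<lambda>\<zeta>. cnj (lam \<zeta>) - ?l \<zeta>) w / 2)"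
    proof (rule hardy2_exp_herglotz[where G="\<lambda>_. 1" and B=1])
      show "integrable circle_measure (\<lambda>\<zeta>. cnj (lam \<zeta>) - ?l \<zeta>)" using li lami(2) by simp
      show "AE \<zeta> in circle_measure. Re (cnj (lam \<zeta>) - ?l \<zeta>) \<le> ln Q"
        using \<eta>'(2)
      proof eventually_elim
        case (elim \<zeta>)
        have "cmod (Complex \<epsilon> (\<omega> \<zeta> - t)) \<le> \<epsilon> + \<bar>\<omega> \<zeta> - t\<bar>"
          using cmod_le[of "Complex \<epsilon> (\<omega> \<zeta> - t)"] \<epsilon> by simp
        also have "\<dots> \<le> (\<omega> \<zeta> - s) + (\<epsilon> + \<bar>s - t\<bar>) * 1"
          using abs_triangle_ineq[of "\<omega> \<zeta> - s" "s - t"] elim \<eta>'(1) by simp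
        also have "\<dots> \<le> (\<omega> \<zeta> - s) + (\<epsilon> + \<bar>s - t\<bar>) * ((\<omega> \<zeta> - s) / \<eta>')"
          using elim \<eta>'(1) \<epsilon> by (intro add_left_mono mult_left_mono) simp_all
        also have "\<dots> = Q * (\<omega> \<zeta> - s)" by (simp add: Q_def algebra_simps)
        finally have "cmod (Complex \<epsilon> (\<omega> \<zeta> - t)) \<le> Q * (\<omega> \<zeta> - s)" .
        then have "ln (cmod (Complex \<epsilon> (\<omega> \<zeta> - t))) \<le> ln (Q * (\<omega> \<zeta> - s))"
          using cmod_Complex_ge(1)[OF \<epsilon>, of "\<omega> \<zeta> - t"] \<epsilon> by (intro ln_mono) linarith+
        also have "\<dots> = ln Q + ln (\<omega> \<zeta> - s)"
          using elim \<eta>'(1) \<epsilon> by (intro ln_mult_pos) (auto simp: Q_def intro!: add_pos_nonneg)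
        finally show ?case by (simp add: lam_def Re_log_symbol)
      qed
      show "AE \<zeta> in circle_measure. \<bar>Im (cnj (lam \<zeta>) - ?l \<zeta>) - (- c\<^sub>0)\<bar> \<le> \<kappa>"
        using Im by eventually_elim (simp add: abs_minus_commute)
    qed (use \<kappa> in auto)
    \<comment> \<open>\<open>k\<close> is \<open>F'\<close> divided by the outer function and
      \<open>\<psi>\<close> is \<open>g\<close> multiplied by it, so \<open>F' g\<close> becomes a
      product of two Hardy functions, as \<open>hardy2_product_inner\<close> requires.\<close>
    have k\<psi>: "disk_extension k w * disk_extension \<psi> w = F' w * disk_extension g w" if w: "w \<in> ball 0 1" for w
    proof -
      have "herglotz (\<lambda>\<zeta>. cnj (lam \<zeta>) - ?l \<zeta>) w = herglotz (\<lambda>\<zeta>. cnj (lam \<zeta>)) w - herglotz ?l w"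
        by (rule herglotz_diff[OF lami(2) li w])
      then have "disk_extension k w * outer_function \<omega> s w = F' w"
        using kw[OF w] by (simp add: F'_def outer_function_herglotz diff_divide_distrib flip: exp_add)
      then show ?thesis using \<psi>w[OF w] by (simp add: mult.assoc[symmetric])
    qed
    obtain r where r: "\<And>k. 0 < r k" "\<And>k. r k < 1" "r \<longlonglongrightarrow> 1"
      and lim: "AE \<zeta> in circle_measure. \<forall>u\<in>{f, g, \<psi>, k, h, h', szego_kernel z}.
        (\<lambda>k. disk_extension u (of_real (r k) * \<zeta>)) \<longlonglongrightarrow> u \<zeta>"
      using hardy2_radial_limits[of "{f, g, \<psi>, k, h, h', szego_kernel z}"] f g \<psi> k h Kz(1) by blast
    have bd: "AE \<zeta> in circle_measure. f \<zeta> * exp (h \<zeta> / 2) = c * szego_kernel z \<zeta> \<and> k \<zeta> * \<psi> \<zeta> = exp (h' \<zeta> / 2) * g \<zeta>"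
      using lim AE_circle_norm
    proof eventually_elim
      case (elim \<zeta>)
      let ?r = "\<lambda>n. of_real (r n) * \<zeta>"
      have rb: "?r n \<in> ball 0 1" for n using r(1,2)[of n] elim(2) by (simp add: norm_mult)
      have "(\<lambda>n. disk_extension f (?r n) * exp (disk_extension h (?r n) / 2)) \<longlonglongrightarrow> f \<zeta> * exp (h \<zeta> / 2)"
        using elim(1) by (intro tendsto_intros) simp_all
      moreover have "(\<lambda>n. c * disk_extension (szego_kernel z) (?r n)) \<longlonglongrightarrow> c * szego_kernel z \<zeta>"
        using elim(1) by (intro tendsto_intros) simp_all
      moreover have "disk_extension f (?r n) * exp (disk_extension h (?r n) / 2) = c * disk_extension (szego_kernel z) (?r n)" for n
        using fF[OF rb] by (simp only: hw(1)[OF rb] Kz(2)[OF rb] F_def K_def)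
      ultimately have 1: "f \<zeta> * exp (h \<zeta> / 2) = c * szego_kernel z \<zeta>"
        by (simp only: LIMSEQ_unique)
      have "(\<lambda>n. disk_extension k (?r n) * disk_extension \<psi> (?r n)) \<longlonglongrightarrow> k \<zeta> * \<psi> \<zeta>"
        using elim(1) by (intro tendsto_intros) simp_all
      moreover have "(\<lambda>n. exp (disk_extension h' (?r n) / 2) * disk_extension g (?r n)) \<longlonglongrightarrow> exp (h' \<zeta> / 2) * g \<zeta>"
        using elim(1) by (intro tendsto_intros) simp_all
      moreover have "disk_extension k (?r n) * disk_extension \<psi> (?r n) = exp (disk_extension h' (?r n) / 2) * disk_extension g (?r n)" for n
        using k\<psi>[OF rb] by (simp only: hw(2)[OF rb] F'_def)
      ultimately have "k \<zeta> * \<psi> \<zeta> = exp (h' \<zeta> / 2) * g \<zeta>"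
        by (simp only: LIMSEQ_unique)
      with 1 show ?case by simp
    qed
    have eq: "AE \<zeta> in circle_measure. of_real (\<omega> \<zeta>) * f \<zeta> * cnj (g \<zeta>)
      = - (\<i> * c) * cnj (k \<zeta> * \<psi> \<zeta> * cnj (szego_kernel z \<zeta>)) + \<mu> * (f \<zeta> * cnj (g \<zeta>))"
      using bd hlam
    proof eventually_elim
      case (elim \<zeta>)
      have "\<i> * (of_real (\<omega> \<zeta>) - \<mu>) = exp (lam \<zeta>)"
        by (simp add: lam_def exp_log_symbol[OF \<epsilon>] \<mu>_def)
      also have "lam \<zeta> = h \<zeta> / 2 + cnj (h' \<zeta> / 2)"
        using elim(2) by (simp add: field_simps)
      also have "exp \<dots> = exp (h \<zeta> / 2) * cnj (exp (h' \<zeta> / 2))"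
        by (simp only: exp_add exp_cnj)
      finally have "\<i> * (of_real (\<omega> \<zeta>) - \<mu>) * (f \<zeta> * cnj (g \<zeta>)) = (f \<zeta> * exp (h \<zeta> / 2)) * cnj (exp (h' \<zeta> / 2) * g \<zeta>)"
        by (simp add: mult_ac)
      also have "\<dots> = c * szego_kernel z \<zeta> * cnj (k \<zeta> * \<psi> \<zeta>)"
        using elim(1) by simp
      finally have "(- \<i>) * (\<i> * (of_real (\<omega> \<zeta>) - \<mu>) * (f \<zeta> * cnj (g \<zeta>))) = (- \<i>) * (c * szego_kernel z \<zeta> * cnj (k \<zeta> * \<psi> \<zeta>))"
        by simp
      moreover have "(- \<i>) * (\<i> * (of_real (\<omega> \<zeta>) - \<mu>) * (f \<zeta> * cnj (g \<zeta>))) = of_real (\<omega> \<zeta>) * f \<zeta> * cnj (g \<zeta>) - \<mu> * (f \<zeta> * cnj (g \<zeta>))"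
        by (simp add: left_diff_distrib right_diff_distrib mult.assoc[symmetric])
      ultimately show ?case by (simp add: algebra_simps)
    qed
    have i1: "integrable circle_measure (\<lambda>\<zeta>. k \<zeta> * \<psi> \<zeta> * cnj (szego_kernel z \<zeta>))"
      by (intro integrable_cnj_szego L2_mult_integrable hardy2_L2 k \<psi> z)
    have i2: "integrable circle_measure (\<lambda>\<zeta>. f \<zeta> * cnj (g \<zeta>))"
      by (intro L2_mult_integrable L2_cnj hardy2_L2 f g)
    have i3: "integrable circle_measure (\<lambda>\<zeta>. - (\<i> * c) * cnj (k \<zeta> * \<psi> \<zeta> * cnj (szego_kernel z \<zeta>)) + \<mu> * (f \<zeta> * cnj (g \<zeta>)))"
      by (intro Bochner_Integration.integrable_add integrable_mult_right integrable_cnj i1 i2)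
    have "toeplitz_form \<omega> f g = (\<integral>\<zeta>. - (\<i> * c) * cnj (k \<zeta> * \<psi> \<zeta> * cnj (szego_kernel z \<zeta>)) + \<mu> * (f \<zeta> * cnj (g \<zeta>)) \<partial>circle_measure)"
      unfolding toeplitz_form_def
    proof (rule integral_cong_AE[OF _ borel_measurable_integrable[OF i3] eq])
      have "f \<in> borel_measurable circle_measure" "(\<lambda>\<zeta>. cnj (g \<zeta>)) \<in> borel_measurable circle_measure"
        "(\<lambda>\<zeta>. complex_of_real (\<omega> \<zeta>)) \<in> borel_measurable circle_measure"
        using f g L2_cnj[of g] \<omega>m by (simp_all add: hardy2_L2 L2_measurable)
      then show "(\<lambda>\<zeta>. of_real (\<omega> \<zeta>) * f \<zeta> * cnj (g \<zeta>)) \<in> borel_measurable circle_measure"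
        by (intro borel_measurable_times)
    qed
    also have "\<dots> = (\<integral>\<zeta>. - (\<i> * c) * cnj (k \<zeta> * \<psi> \<zeta> * cnj (szego_kernel z \<zeta>)) \<partial>circle_measure)
      + (\<integral>\<zeta>. \<mu> * (f \<zeta> * cnj (g \<zeta>)) \<partial>circle_measure)"
      by (intro Bochner_Integration.integral_add integrable_mult_right integrable_cnj i1 i2)
    also have "\<dots> = - (\<i> * c) * cnj (\<integral>\<zeta>. k \<zeta> * \<psi> \<zeta> * cnj (szego_kernel z \<zeta>) \<partial>circle_measure)
      + \<mu> * (\<integral>\<zeta>. f \<zeta> * cnj (g \<zeta>) \<partial>circle_measure)"
      by (simp only: integral_mult_right_zero Bochner_Integration.integral_cnj)
    also have "(\<integral>\<zeta>. k \<zeta> * \<psi> \<zeta> * cnj (szego_kernel z \<zeta>) \<partial>circle_measure) = F' z * disk_extension g z"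
      using hardy2_product_inner[OF k \<psi> z] k\<psi>[OF z] by simp
    also have "- (\<i> * c) * cnj (F' z * disk_extension g z) = cnj (disk_extension g z)"
      using F'z by (simp add: c_def)
    also have "\<dots> = circle_inner (szego_kernel z) g"
      unfolding disk_extension_def using circle_inner_cnj[of "szego_kernel z" g] by simp
    finally show ?thesis by (simp add: circle_inner_def)
  qed
  have "cmod (disk_extension f z) = cmod (szego_kernel z z) * (cmod c / cmod (F z))"
    using arg_cong[OF fF[OF z], of cmod] by (simp add: K_def norm_mult F_def field_simps)
  also have "cmod c / cmod (F z) = exp (- (Re (herglotz lam z + herglotz (\<lambda>\<zeta>. cnj (lam \<zeta>)) z) / 2))"
  proof -
    define x where "x = Re (herglotz lam z) / 2"
    define y where "y = Re (herglotz (\<lambda>\<zeta>. cnj (lam \<zeta>)) z) / 2"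
    have "cmod (F z) = exp x" "cmod (F' z) = exp y"
      by (simp_all add: F_def F'_def x_def y_def)
    then have "cmod c / cmod (F z) = 1 / (exp y * exp x)"
      by (simp add: c_def norm_divide)
    also have "\<dots> = exp (- (x + y))"
      unfolding exp_minus[of "x + y"] exp_add inverse_eq_divide by (simp add: mult.commute)
    also have "x + y = Re (herglotz lam z + herglotz (\<lambda>\<zeta>. cnj (lam \<zeta>)) z) / 2"
      by (simp add: x_def y_def add_divide_distrib)
    finally show ?thesis .
  qed
  also have "herglotz lam z + herglotz (\<lambda>\<zeta>. cnj (lam \<zeta>)) z = herglotz (\<lambda>\<zeta>. 2 * of_real (ln (cmod (Complex \<epsilon> (\<omega> \<zeta> - t))))) z"
    unfolding herglotz_add[OF lami z, symmetric]
    by (rule arg_cong[where f="\<lambda>L. herglotz L z"]) (simp add: fun_eq_iff complex_eq_iff lam_def Re_log_symbol)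
  also have "Re \<dots> / 2 = (\<integral>\<zeta>. ln (cmod (Complex \<epsilon> (\<omega> \<zeta> - t))) * Re (herglotz_kernel (z * cnj \<zeta>)) \<partial>circle_measure)"
  proof -
    have "integrable circle_measure (\<lambda>\<zeta>. Re (lam \<zeta>))" by (rule integrable_Re[OF lami(1)])
    from Re_herglotz_real(2)[OF this z] show ?thesis
      by (simp add: herglotz_cmult lam_def Re_log_symbol)
  qed
  finally show ?thesis using that[OF fdom form] by simp
qed

text \<open>The constructed solution shows that both \<open>SOME\<close> choices are satisfied. The
  chosen resolvent value solves the same form equation, hence agrees with it almost everywhere, and
  the inner product with the kernel is its disk extension at \<open>z\<close>.\<close>

lemma toeplitz_resolvent_value:
  assumes \<omega>: "integrable circle_measure \<omega>" "ess_inf \<omega> > -\<infinity>" and z: "z \<in> ball 0 1" and \<epsilon>: "\<epsilon> > 0"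
  shows "cmod (circle_inner (toeplitz_resolvent \<omega> (of_real t + \<i> * of_real \<epsilon>) (szego_kernel z)) (szego_kernel z))
    = cmod (szego_kernel z z) *
      exp (- (\<integral>\<zeta>. ln (cmod (Complex \<epsilon> (\<omega> \<zeta> - t))) * Re (herglotz_kernel (z * cnj \<zeta>)) \<partial>circle_measure))"
proof -
  define \<mu> where "\<mu> = complex_of_real t + \<i> * of_real \<epsilon>"
  let ?K = "szego_kernel z"
  obtain f where f: "f \<in> toeplitz_form_domain \<omega>"
    and form: "\<And>g. g \<in> toeplitz_form_domain \<omega> \<Longrightarrow> toeplitz_form \<omega> f g = circle_inner ?K g + \<mu> * circle_inner f g"
    and val: "cmod (disk_extension f z) = cmod (szego_kernel z z) *
      exp (- (\<integral>\<zeta>. ln (cmod (Complex \<epsilon> (\<omega> \<zeta> - t))) * Re (herglotz_kernel (z * cnj \<zeta>)) \<partial>circle_measure))"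
    using toeplitz_equation_solution[OF \<omega> z \<epsilon>, of t, folded \<mu>_def] by blast
  have hardy: "g \<in> hardy2" if "g \<in> toeplitz_form_domain \<omega>" for g
    using that by (simp add: toeplitz_form_domain_def)
  have inner: "circle_inner (\<lambda>\<zeta>. ?K \<zeta> + \<mu> * g \<zeta>) u = circle_inner ?K u + \<mu> * circle_inner g u"
    if "g \<in> hardy2" "u \<in> hardy2" for g u
  proof -
    have "integrable circle_measure (\<lambda>\<zeta>. ?K \<zeta> * cnj (u \<zeta>))" "integrable circle_measure (\<lambda>\<zeta>. g \<zeta> * cnj (u \<zeta>))"
      by (intro L2_mult_integrable L2_cnj hardy2_L2 that szego_kernel_hardy2(1)[OF z])+
    then show ?thesis by (simp add: circle_inner_def distrib_right mult.assoc)
  qed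
  have rep: "toeplitz_represents \<omega> f (\<lambda>\<zeta>. ?K \<zeta> + \<mu> * f \<zeta>)"
    unfolding toeplitz_represents_def
    using form inner[OF hardy[OF f] hardy] hardy2_add[OF szego_kernel_hardy2(1)[OF z] hardy2_cmult[OF hardy[OF f]]] by simp
  have fdom: "f \<in> toeplitz_domain \<omega>"
    using f rep by (auto simp: toeplitz_domain_def)
  have T: "toeplitz_represents \<omega> g (toeplitz \<omega> g)" if "g \<in> toeplitz_domain \<omega>" for g
    using that someI_ex[of "toeplitz_represents \<omega> g"] by (simp add: toeplitz_domain_def toeplitz_def)
  have "AE \<zeta> in circle_measure. toeplitz \<omega> f \<zeta> = ?K \<zeta> + \<mu> * f \<zeta>"
    by (rule toeplitz_represents_unique[OF \<omega> T[OF fdom] rep])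
  then have "AE \<zeta> in circle_measure. toeplitz \<omega> f \<zeta> - \<mu> * f \<zeta> = ?K \<zeta>"
    by eventually_elim simp
  with fdom have "\<exists>f. f \<in> toeplitz_domain \<omega> \<and> (AE \<zeta> in circle_measure. toeplitz \<omega> f \<zeta> - \<mu> * f \<zeta> = ?K \<zeta>)"
    by blast
  from someI_ex[OF this] obtain f1 where f1: "f1 = toeplitz_resolvent \<omega> \<mu> ?K" "f1 \<in> toeplitz_domain \<omega>"
    and ae: "AE \<zeta> in circle_measure. toeplitz \<omega> f1 \<zeta> - \<mu> * f1 \<zeta> = ?K \<zeta>"
    unfolding toeplitz_resolvent_def by blast
  have f1d: "f1 \<in> toeplitz_form_domain \<omega>" using f1(2) by (simp add: toeplitz_domain_def)
  have Th: "toeplitz \<omega> f1 \<in> hardy2" using T[OF f1(2)] by (simp add: toeplitz_represents_def)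
  have cong: "circle_inner u g = circle_inner v g"
    if "u \<in> hardy2" "v \<in> hardy2" "g \<in> hardy2" "AE \<zeta> in circle_measure. u \<zeta> = v \<zeta>" for u v g
    unfolding circle_inner_def
  proof (rule integral_cong_AE)
    show "AE \<zeta> in circle_measure. u \<zeta> * cnj (g \<zeta>) = v \<zeta> * cnj (g \<zeta>)"
      using that(4) by eventually_elim simp
  qed (intro borel_measurable_integrable L2_mult_integrable L2_cnj hardy2_L2 that)+
  have form1: "toeplitz_form \<omega> f1 g = circle_inner ?K g + \<mu> * circle_inner f1 g" if g: "g \<in> toeplitz_form_domain \<omega>" for g
  proof -
    have "toeplitz_form \<omega> f1 g = circle_inner (toeplitz \<omega> f1) g"
      using T[OF f1(2)] g by (simp add: toeplitz_represents_def)
    also have "\<dots> = circle_inner (\<lambda>\<zeta>. ?K \<zeta> + \<mu> * f1 \<zeta>) g"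
    proof (rule cong[OF Th _ hardy[OF g]])
      show "AE \<zeta> in circle_measure. toeplitz \<omega> f1 \<zeta> = ?K \<zeta> + \<mu> * f1 \<zeta>"
        using ae by eventually_elim (simp add: algebra_simps)
    qed (intro hardy2_add hardy2_cmult szego_kernel_hardy2 z hardy f1d)
    also have "\<dots> = circle_inner ?K g + \<mu> * circle_inner f1 g"
      by (rule inner[OF hardy[OF f1d] hardy[OF g]])
    finally show ?thesis .
  qed
  have "AE \<zeta> in circle_measure. f1 \<zeta> = f \<zeta>"
    by (rule toeplitz_equation_unique[OF f1d f form1 form]) (use \<epsilon> in \<open>simp_all add: \<mu>_def\<close>)
  from cong[OF hardy[OF f1d] hardy[OF f] szego_kernel_hardy2(1)[OF z] this]
  show ?thesis
    using val f1(1) by (simp add: \<mu>_def disk_extension_def)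
qed

section \<open>The uniform estimate\<close>

lemma nn_integral_powr_unit:
  assumes "q < 1"
  shows "(\<integral>\<^sup>+x. ennreal (indicator {0..1} x * x powr - q) \<partial>lborel) < \<infinity>"
proof -
  have "((\<lambda>x. x powr - q) has_integral (1 powr (- q + 1) / (- q + 1))) {0..1::real}"
    using assms by (intro has_integral_powr_from_0) simp_all
  then have "((\<lambda>x. indicator {0..1} x * x powr - q) has_integral (1 powr (- q + 1) / (- q + 1))) (UNIV :: real set)"
    unfolding has_integral_restrict_UNIV[symmetric, of _ _ "{0..1}"]
    by (rule has_integral_eq[rotated]) (simp add: indicator_def)
  from nn_integral_has_integral_lborel[OF _ _ this] show ?thesis
    by simp
qed

text \<open>At distance more than 1 from \<open>s\<close> the integrand is at most 1. Nearer to
  \<open>s\<close> it is covered by a translate and a reflected translate of the same power on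
  \<open>[0, 1]\<close>, whose integral \<open>J\<close> does not depend on
  \<open>s\<close>.\<close>

lemma nn_integral_powr_shift_bounded:
  assumes q: "0 \<le> q" "q < 1"
  obtains C where "C < \<infinity>" "\<And>s. (\<integral>\<^sup>+t\<in>{a..b}. ennreal (\<bar>s - t\<bar> powr - q) \<partial>lborel) \<le> (C :: ennreal)"
proof -
  define g :: "real \<Rightarrow> ennreal" where "g x = ennreal (indicator {0..1} x * x powr - q)" for x
  have gm [measurable]: "g \<in> borel_measurable borel" unfolding g_def by measurable
  define J where "J = (\<integral>\<^sup>+x. g x \<partial>lborel)"
  have J: "J < \<infinity>" unfolding J_def g_def by (rule nn_integral_powr_unit[OF q(2)])
  have "(\<integral>\<^sup>+t\<in>{a..b}. ennreal (\<bar>s - t\<bar> powr - q) \<partial>lborel) \<le> ennreal (b - a) + (J + J)" for s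
  proof -
    have "(\<integral>\<^sup>+t\<in>{a..b}. ennreal (\<bar>s - t\<bar> powr - q) \<partial>lborel)
      \<le> (\<integral>\<^sup>+t. indicator {a..b} t + (g (s + (-1) * t) + g (- s + 1 * t)) \<partial>lborel)"
    proof (rule nn_integral_mono)
      fix t
      have "\<bar>s - t\<bar> powr - q \<le> 1" if "\<bar>s - t\<bar> > 1"
        using that q powr_mono[of "- q" 0 "\<bar>s - t\<bar>"] by (simp split: if_splits)
      then have "ennreal (\<bar>s - t\<bar> powr - q) \<le> 1 + (g (s - t) + g (t - s))"
        by (cases "\<bar>s - t\<bar> > 1"; cases "s \<ge> t")
           (auto simp: g_def indicator_def abs_minus_commute add_increasing add_increasing2 ennreal_le_1 intro: order_trans[of _ 1])
      then show "ennreal (\<bar>s - t\<bar> powr - q) * indicator {a..b} t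
        \<le> indicator {a..b} t + (g (s + (-1) * t) + g (- s + 1 * t))"
        by (auto simp: indicator_def)
    qed
    also have "\<dots> = emeasure lborel {a..b} + ((\<integral>\<^sup>+t. g (s + (-1) * t) \<partial>lborel) + (\<integral>\<^sup>+t. g (- s + 1 * t) \<partial>lborel))"
      by (simp add: nn_integral_add)
    also have "(\<integral>\<^sup>+t. g (s + (-1) * t) \<partial>lborel) = J"
      using nn_integral_real_affine[of g "-1" s] gm by (simp add: J_def)
    also have "(\<integral>\<^sup>+t. g (- s + 1 * t) \<partial>lborel) = J"
      using nn_integral_real_affine[of g 1 "- s"] gm by (simp add: J_def)
    also have "emeasure lborel {a..b} \<le> ennreal (b - a)"
      by (cases "a \<le> b") simp_all
    finally show ?thesis by (simp add: add_right_mono)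
  qed
  moreover have "ennreal (b - a) + (J + J) < \<infinity>" using J by simp
  ultimately show ?thesis using that by blast
qed

text \<open>The constant is the supremum \<open>s\<close> of the almost sure strict lower bounds. A
  number slightly above \<open>s\<close> is no such bound, so the gap hypothesis makes any still
  larger number an almost sure upper bound. The contrapositive yields the two separated levels of a
  non-constant symbol.\<close>

lemma AE_const_of_no_gap:
  assumes M: "prob_space M" and m: "f \<in> borel_measurable M" and low: "AE x in M. l \<le> f x"
    and gap: "\<And>c d. c < d \<Longrightarrow> (AE x in M. c < f x) \<or> (AE x in M. f x < d)"
  shows "\<exists>c :: real. AE x in M. f x = c"
proof -
  interpret prob_space M by (rule M)
  define A where "A = {c. AE x in M. c < f x}"
  have down: "c \<in> A" if "d \<in> A" "c \<le> d" for c d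
    using that(1) unfolding A_def mem_Collect_eq by eventually_elim (use that(2) in simp)
  have "l - 1 \<in> A" unfolding A_def mem_Collect_eq using low by eventually_elim simp
  have bdd: "bdd_above A"
  proof (rule ccontr)
    assume "\<not> bdd_above A"
    have "real n \<in> A" for n
    proof -
      obtain y where "y \<in> A" "y > real n" using \<open>\<not> bdd_above A\<close> unfolding bdd_above_def by (meson not_le)
      then show ?thesis using down by simp
    qed
    then have "AE x in M. \<forall>n. real n < f x" by (simp add: A_def AE_all_countable)
    then have "AE x in M. False"
      by eventually_elim (meson less_asym reals_Archimedean2)
    then show False by simp
  qed
  define s where "s = Sup A"
  have 1: "s - 1 / real (Suc n) \<in> A" for n
  proof -
    obtain y where "y \<in> A" "s - 1 / real (Suc n) < y"
      using less_cSup_iff[OF _ bdd, of "s - 1 / real (Suc n)"] \<open>l - 1 \<in> A\<close> by (auto simp: s_def)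
    then show ?thesis using down by simp
  qed
  have 2: "AE x in M. f x < s + 1 / real (Suc n)" for n
  proof -
    define c where "c = s + 1 / real (Suc n) / 2"
    have "c \<notin> A"
    proof
      assume "c \<in> A"
      then have "c \<le> s" unfolding s_def by (rule cSup_upper[OF _ bdd])
      then show False by (simp add: c_def)
    qed
    moreover have "0 < 1 / real (Suc n)" by simp
    then have "1 / real (Suc n) / 2 < 1 / real (Suc n)" by (metis field_sum_of_halves half_gt_zero less_add_same_cancel2)
    then have "c < s + 1 / real (Suc n)" unfolding c_def by (rule add_strict_left_mono)
    ultimately show ?thesis using gap[of c "s + 1 / real (Suc n)"] by (auto simp: A_def)
  qed
  have "AE x in M. \<forall>n. s - 1 / real (Suc n) < f x \<and> f x < s + 1 / real (Suc n)"
    unfolding AE_all_countable using 1 2 by (simp add: A_def)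
  then have "AE x in M. f x = s"
  proof eventually_elim
    case (elim x)
    show ?case
    proof (rule ccontr)
      assume "f x \<noteq> s"
      then obtain n where "1 / real (Suc n) < \<bar>f x - s\<bar>"
        using nat_approx_posE[of "\<bar>f x - s\<bar>"] by auto
      moreover have "\<bar>f x - s\<bar> < 1 / real (Suc n)" using elim[rule_format, of n] by linarith
      ultimately show False by simp
    qed
  qed
  then show ?thesis by blast
qed

text \<open>Off \<open>S\<close> the bound \<open>- L\<close> costs at most the factor
  \<open>exp (p * L)\<close>. On \<open>S\<close> Jensen is applied to the normalized weight, and
  the integral over \<open>S\<close> is \<open>w\<close> times an average; so the exponent is
  \<open>p * w\<close> instead of \<open>p\<close>.\<close>

lemma weighted_log_estimate:
  fixes x W :: "'a \<Rightarrow> real"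
  assumes W: "integrable M W" "AE s in M. 0 \<le> W s" "(\<integral>s. W s \<partial>M) = 1"
    and S: "S \<in> sets M" and w: "w = (\<integral>s. indicator S s * W s \<partial>M)" "w > 0"
    and x: "integrable M (\<lambda>s. x s * W s)" "x \<in> borel_measurable M"
    and lower: "AE s in M. - B \<le> x s" and compl: "AE s in M. s \<notin> S \<longrightarrow> - L \<le> x s" and L: "L \<ge> 0"
    and p: "p > 0"
  shows "exp (- p * (\<integral>s. x s * W s \<partial>M))
    \<le> exp (p * L) / w * (\<integral>s. exp (- (p * w) * x s) * W s \<partial>M)"
proof -
  have Wm: "W \<in> borel_measurable M" using W(1) by (rule borel_measurable_integrable)
  define V where "V s = indicator S s * W s" for s
  have V: "integrable M V" "AE s in M. 0 \<le> V s"
    unfolding V_def using W(2) integrable_mult_indicator[OF S W(1)]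
    by (auto elim!: eventually_mono simp: mult.commute)
  have xV: "integrable M (\<lambda>s. x s * V s)"
    using integrable_mult_indicator[OF S x(1)] by (simp add: V_def mult_ac)
  have xC: "integrable M (\<lambda>s. x s * W s - x s * V s)" using x(1) xV by simp
  have em: "(\<lambda>s. exp (- (p * w) * x s)) \<in> borel_measurable M" using x(2) by measurable
  \<comment> \<open>\<open>B\<close> enters through integrability alone and is absent from the final
    bound; in the application it is \<open>- ln \<epsilon>\<close>, so the estimate stays uniform in
    \<open>\<epsilon>\<close>.\<close>
  have eint: "integrable M (\<lambda>s. exp (- (p * w) * x s) * U s)"
    if U: "integrable M U" "AE s in M. 0 \<le> U s" for U
  proof (rule Bochner_Integration.integrable_bound)
    show "integrable M (\<lambda>s. exp (p * w * B) * U s)" using U(1) by simp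
    show "(\<lambda>s. exp (- (p * w) * x s) * U s) \<in> borel_measurable M"
      by (intro borel_measurable_times em borel_measurable_integrable U(1))
    show "AE s in M. norm (exp (- (p * w) * x s) * U s) \<le> norm (exp (p * w * B) * U s)"
      using lower U(2)
    proof eventually_elim
      case (elim s)
      have "- (p * w) * x s = (p * w) * (- x s)" by simp
      also have "\<dots> \<le> (p * w) * B" using elim(1) p w(2) by (intro mult_left_mono) simp_all
      finally have "exp (- (p * w) * x s) \<le> exp (p * w * B)" by simp
      then show ?case using elim(2) by (simp add: mult_right_mono)
    qed
  qed
  have VW: "(\<integral>s. W s - V s \<partial>M) = 1 - w" "w \<le> 1"
  proof -
    show 1: "(\<integral>s. W s - V s \<partial>M) = 1 - w" using W V by (simp add: w(1) V_def[abs_def])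
    have "0 \<le> (\<integral>s. W s - V s \<partial>M)"
      by (rule integral_nonneg_AE) (use W(2) in \<open>auto elim!: eventually_mono simp: V_def indicator_def\<close>)
    with 1 show "w \<le> 1" by simp
  qed
  have "- L * (1 - w) = (\<integral>s. - L * (W s - V s) \<partial>M)"
    by (simp only: integral_mult_right_zero VW(1))
  also have "\<dots> \<le> (\<integral>s. x s * W s - x s * V s \<partial>M)"
  proof (rule integral_mono_AE)
    show "AE s in M. - L * (W s - V s) \<le> x s * W s - x s * V s"
      using compl W(2)
    proof eventually_elim
      case (elim s)
      then show ?case
        using mult_right_mono[of "- L" "x s" "W s"] by (cases "s \<in> S") (simp_all add: V_def)
    qed
  qed (use W V xC in simp_all)
  finally have "- L * (1 - w) \<le> (\<integral>s. x s * W s \<partial>M) - (\<integral>s. x s * V s \<partial>M)"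
    using x(1) xV by simp
  moreover have "L * (1 - w) \<le> L" using L VW(2) w(2) by (simp add: mult_left_le)
  ultimately have "- (\<integral>s. x s * W s \<partial>M) \<le> L - (\<integral>s. x s * V s \<partial>M)" by simp
  from mult_left_mono[OF this, of p] p
  have "- p * (\<integral>s. x s * W s \<partial>M) \<le> p * L + (- (p * (\<integral>s. x s * V s \<partial>M)))"
    by (simp add: algebra_simps)
  then have "exp (- p * (\<integral>s. x s * W s \<partial>M)) \<le> exp (p * L) * exp (- (p * (\<integral>s. x s * V s \<partial>M)))"
    by (simp flip: exp_add)
  also have "exp (- (p * (\<integral>s. x s * V s \<partial>M))) \<le> (\<integral>s. exp (- (p * w) * x s) * V s \<partial>M) / w"
  proof -
    have int: "(\<integral>s. V s \<partial>M) = w" by (simp add: w(1) V_def[abs_def])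
    have "(\<integral>s. (- (p * w) * x s) * V s \<partial>M) / w = - (p * (\<integral>s. x s * V s \<partial>M))"
      using w(2) by (simp add: mult.assoc)
    moreover have "integrable M (\<lambda>s. (- (p * w) * x s) * V s)" using xV by (simp add: mult.assoc)
    ultimately show ?thesis
      using weighted_jensen_exp[OF V, of "\<lambda>s. - (p * w) * x s"] eint[OF V] w(2) int by simp
  qed
  also have "(\<integral>s. exp (- (p * w) * x s) * V s \<partial>M) \<le> (\<integral>s. exp (- (p * w) * x s) * W s \<partial>M)"
  proof (rule integral_mono_AE[OF eint[OF V] eint[OF W(1,2)]])
    show "AE s in M. exp (- (p * w) * x s) * V s \<le> exp (- (p * w) * x s) * W s"
      using W(2) by eventually_elim (simp add: V_def indicator_def)
  qed
  finally show ?thesis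
    using w(2) by (simp add: divide_right_mono mult_left_mono)
qed

text \<open>Replacing the modulus by the smaller \<open>\<bar>\<omega> s - t\<bar>\<close> removes
  \<open>\<epsilon>\<close>. After exchanging the integrals, the inner one over \<open>t\<close> is
  at most \<open>C\<close> whatever the shift \<open>\<omega> s\<close>, and \<open>W\<close> has
  total mass 1.\<close>

lemma nn_integral_resolvent_bound:
  fixes \<omega> :: "'a \<Rightarrow> real"
  assumes M: "sigma_finite_measure M" and \<omega>: "\<omega> \<in> borel_measurable M"
    and W: "integrable M W" "AE s in M. 0 \<le> W s" "(\<integral>s. W s \<partial>M) = 1"
    and q: "0 \<le> q" and \<epsilon>: "\<epsilon> > 0"
    and C: "\<And>s. (\<integral>\<^sup>+t\<in>{a..b}. ennreal (\<bar>s - t\<bar> powr - q) \<partial>lborel) \<le> C"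
  shows "(\<lambda>t. \<integral>\<^sup>+s. ennreal (exp (- q * ln (cmod (Complex \<epsilon> (\<omega> s - t)))) * W s) \<partial>M) \<in> borel_measurable lborel"
    and "(\<integral>\<^sup>+t\<in>{a..b}. (\<integral>\<^sup>+s. ennreal (exp (- q * ln (cmod (Complex \<epsilon> (\<omega> s - t)))) * W s) \<partial>M) \<partial>lborel) \<le> C"
proof -
  interpret sigma_finite_measure M by (rule M)
  interpret pair_sigma_finite M lborel by unfold_locales
  have [measurable]: "\<omega> \<in> borel_measurable M" "W \<in> borel_measurable M"
    using \<omega> W(1) by simp_all
  have Cm: "(\<lambda>x. cmod (Complex \<epsilon> x)) \<in> borel_measurable borel"
    unfolding cmod_def complex.sel by measurable
  define f where "f s t = ennreal (exp (- q * ln (cmod (Complex \<epsilon> (\<omega> s - t)))) * W s)" for s t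
  have fm [measurable]: "case_prod f \<in> borel_measurable (M \<Otimes>\<^sub>M lborel)"
  proof -
    have "(\<lambda>p. \<omega> (fst p) - snd p) \<in> borel_measurable (M \<Otimes>\<^sub>M lborel)" by measurable
    from measurable_compose[OF this Cm] have [measurable]:
      "(\<lambda>p. cmod (Complex \<epsilon> (\<omega> (fst p) - snd p))) \<in> borel_measurable (M \<Otimes>\<^sub>M lborel)" .
    show ?thesis unfolding f_def case_prod_beta by measurable
  qed
  show "(\<lambda>t. \<integral>\<^sup>+s. ennreal (exp (- q * ln (cmod (Complex \<epsilon> (\<omega> s - t)))) * W s) \<partial>M) \<in> borel_measurable lborel"
    using sigma_finite_measure.borel_measurable_nn_integral[OF M, of "\<lambda>t s. f s t" lborel] measurable_pair_swap[OF fm]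
    by (simp add: f_def case_prod_beta)
  have fm': "case_prod (\<lambda>s t. f s t * indicator {a..b} t) \<in> borel_measurable (M \<Otimes>\<^sub>M lborel)"
    using fm unfolding case_prod_beta by measurable
  have "(\<integral>\<^sup>+t\<in>{a..b}. (\<integral>\<^sup>+s. f s t \<partial>M) \<partial>lborel) = (\<integral>\<^sup>+t. (\<integral>\<^sup>+s. f s t * indicator {a..b} t \<partial>M) \<partial>lborel)"
    using fm by (intro nn_integral_cong nn_integral_multc[symmetric]) (measurable)
  also have "\<dots> = (\<integral>\<^sup>+s. (\<integral>\<^sup>+t. f s t * indicator {a..b} t \<partial>lborel) \<partial>M)"
    by (rule Fubini'[OF fm'])
  also have "\<dots> \<le> (\<integral>\<^sup>+s. ennreal (W s) * C \<partial>M)"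
  proof (rule nn_integral_mono_AE)
    show "AE s in M. (\<integral>\<^sup>+t. f s t * indicator {a..b} t \<partial>lborel) \<le> ennreal (W s) * C"
      using W(2)
    proof eventually_elim
      case (elim s)
      have "(\<integral>\<^sup>+t. f s t * indicator {a..b} t \<partial>lborel)
        \<le> (\<integral>\<^sup>+t. ennreal (W s) * (ennreal (\<bar>\<omega> s - t\<bar> powr - q) * indicator {a..b} t) \<partial>lborel)"
      proof (rule nn_integral_mono_AE)
        \<comment> \<open>The bound fails at \<open>t = \<omega> s\<close>, where \<open>0 powr - q = 0\<close>.\<close>
        show "AE t in lborel. f s t * indicator {a..b} t
          \<le> ennreal (W s) * (ennreal (\<bar>\<omega> s - t\<bar> powr - q) * indicator {a..b} t)"
          using AE_lborel_singleton[of "\<omega> s"]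
        proof eventually_elim
          fix t assume "t \<noteq> \<omega> s"
          then have pos: "0 < \<bar>\<omega> s - t\<bar>" by simp
          then have "ln \<bar>\<omega> s - t\<bar> \<le> ln (cmod (Complex \<epsilon> (\<omega> s - t)))"
            by (intro ln_mono cmod_Complex_ge(2))
          then have "exp (- q * ln (cmod (Complex \<epsilon> (\<omega> s - t)))) \<le> exp (- q * ln \<bar>\<omega> s - t\<bar>)"
            using q by (simp add: mult_left_mono)
          also have "\<dots> = \<bar>\<omega> s - t\<bar> powr - q" using pos by (simp add: powr_def)
          finally have "exp (- q * ln (cmod (Complex \<epsilon> (\<omega> s - t)))) * W s \<le> \<bar>\<omega> s - t\<bar> powr - q * W s"
            using elim by (rule mult_right_mono)
          then have "f s t \<le> ennreal (W s) * ennreal (\<bar>\<omega> s - t\<bar> powr - q)"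
            using elim by (simp add: f_def ennreal_mult[symmetric] ennreal_leI mult.commute)
          then show "f s t * indicator {a..b} t \<le> ennreal (W s) * (ennreal (\<bar>\<omega> s - t\<bar> powr - q) * indicator {a..b} t)"
            by (simp add: mult.assoc[symmetric] mult_right_mono)
        qed
      qed
      also have "\<dots> = ennreal (W s) * (\<integral>\<^sup>+t\<in>{a..b}. ennreal (\<bar>\<omega> s - t\<bar> powr - q) \<partial>lborel)"
        by (rule nn_integral_cmult) measurable
      also have "\<dots> \<le> ennreal (W s) * C"
        by (intro mult_left_mono C) simp
      finally show ?case .
    qed
  qed
  also have "\<dots> = C"
    using nn_integral_eq_integral[OF W(1,2)] W(3) by (simp add: nn_integral_multc)
  finally show "(\<integral>\<^sup>+t\<in>{a..b}. (\<integral>\<^sup>+s. ennreal (exp (- q * ln (cmod (Complex \<epsilon> (\<omega> s - t)))) * W s) \<partial>M) \<partial>lborel) \<le> C"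
    unfolding f_def .
qed

theorem theorem3p4:
  fixes \<omega> :: "complex \<Rightarrow> real" and a b :: real and z :: complex
  assumes integrable: "integrable circle_measure \<omega>"
    and bounded_below: "ess_inf \<omega> > -\<infinity>"
    and nonconstant: "\<not> (\<exists>c. AE \<zeta> in circle_measure. \<omega> \<zeta> = c)"
    and z: "z \<in> ball 0 1"
  shows "\<exists>p>1. (SUP \<epsilon>\<in>{0<..1}. \<integral>\<^sup>+t\<in>{a..b}. ennreal (cmod (circle_inner
           (toeplitz_resolvent \<omega> (complex_of_real t + \<i> * complex_of_real \<epsilon>) (szego_kernel z))
           (szego_kernel z)) powr p) \<partial>lborel) < \<infinity>"
proof -
  note \<omega>m = borel_measurable_integrable[OF integrable]
  define P where "P \<zeta> = Re (herglotz_kernel (z * cnj \<zeta>))" for \<zeta>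
  have Ppos: "AE \<zeta> in circle_measure. 0 < P \<zeta>"
    unfolding P_def using AE_circle_norm
    by eventually_elim (use z in \<open>simp add: norm_mult Re_herglotz_kernel_pos\<close>)
  then have P0: "AE \<zeta> in circle_measure. 0 \<le> P \<zeta>" by eventually_elim simp
  have P1: "integrable circle_measure P" "(\<integral>\<zeta>. P \<zeta> \<partial>circle_measure) = 1"
    using Re_herglotz_real[OF circle.integrable_const z, of 1] herglotz_const[OF z, of 1] by (simp_all add: P_def[abs_def])
  obtain l where l: "AE \<zeta> in circle_measure. l \<le> \<omega> \<zeta>"
  proof -
    obtain t0 where "ereal t0 < ess_inf \<omega>" using ereal_dense2[OF bounded_below] by auto
    then obtain \<eta> where "0 < \<eta>" "AE \<zeta> in circle_measure. \<eta> \<le> \<omega> \<zeta> - t0"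
      by (rule less_ess_inf[OF \<omega>m])
    then have "AE \<zeta> in circle_measure. t0 + \<eta> \<le> \<omega> \<zeta>" by (auto elim!: eventually_mono)
    then show ?thesis by (rule that)
  qed
  obtain c d where "c < d" and nc: "\<not> (AE \<zeta> in circle_measure. c < \<omega> \<zeta>)" and nd: "\<not> (AE \<zeta> in circle_measure. \<omega> \<zeta> < d)"
    using AE_const_of_no_gap[OF prob_space_circle \<omega>m l] nonconstant by blast
  \<comment> \<open>The two sets overlap on purpose: \<open>S\<^sub>1\<close> contains
    \<open>\<omega> \<le> c\<close> and omits \<open>\<omega> \<ge> d\<close>, and the other way
    round for \<open>S\<^sub>2\<close>, so both masses lie strictly between 0 and 1.\<close>
  define S\<^sub>1 where "S\<^sub>1 = {\<zeta> \<in> space circle_measure. \<omega> \<zeta> < d}"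
  define S\<^sub>2 where "S\<^sub>2 = {\<zeta> \<in> space circle_measure. c < \<omega> \<zeta>}"
  have S: "S\<^sub>1 \<in> sets circle_measure" "S\<^sub>2 \<in> sets circle_measure"
    unfolding S\<^sub>1_def S\<^sub>2_def using \<omega>m by measurable
  define w where "w S = (\<integral>\<zeta>. indicator S \<zeta> * P \<zeta> \<partial>circle_measure)" for S
  have iP: "integrable circle_measure (\<lambda>\<zeta>. indicator S \<zeta> * P \<zeta>)" if "S \<in> sets circle_measure" for S
    using integrable_mult_indicator[OF that P1(1)] by simp
  have wpos: "w S > 0" if S: "S \<in> sets circle_measure" and "\<not> (AE \<zeta> in circle_measure. \<zeta> \<notin> S)" for S
  proof -
    have nn: "AE \<zeta> in circle_measure. 0 \<le> indicator S \<zeta> * P \<zeta>"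
      using P0 by eventually_elim simp
    have "w S \<noteq> 0"
    proof
      assume "w S = 0"
      then have "AE \<zeta> in circle_measure. indicator S \<zeta> * P \<zeta> = 0"
        using integral_nonneg_eq_0_iff_AE[OF iP[OF S] nn] by (simp add: w_def)
      then have "AE \<zeta> in circle_measure. \<zeta> \<notin> S"
        using Ppos by eventually_elim (auto simp: indicator_def split: if_splits)
      with that(2) show False by simp
    qed
    moreover have "w S \<ge> 0" unfolding w_def by (rule integral_nonneg_AE[OF nn])
    ultimately show ?thesis by simp
  qed
  have wlt: "w S < 1" if S: "S \<in> sets circle_measure" and "\<not> (AE \<zeta> in circle_measure. \<zeta> \<in> S)" for S
  proof -
    have "w (space circle_measure - S) > 0"
    proof (rule wpos)
      show "\<not> (AE \<zeta> in circle_measure. \<zeta> \<notin> space circle_measure - S)"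
      proof
        assume "AE \<zeta> in circle_measure. \<zeta> \<notin> space circle_measure - S"
        then have "AE \<zeta> in circle_measure. \<zeta> \<in> S"
          using AE_space by eventually_elim simp
        with that(2) show False by simp
      qed
    qed (rule sets.Diff[OF sets.top S])
    moreover have "w (space circle_measure - S) = 1 - w S"
    proof -
      have "w (space circle_measure - S) = (\<integral>\<zeta>. P \<zeta> - indicator S \<zeta> * P \<zeta> \<partial>circle_measure)"
        unfolding w_def by (rule Bochner_Integration.integral_cong) (simp_all add: indicator_def)
      then show ?thesis using P1 iP[OF S] by (simp add: w_def)
    qed
    ultimately show ?thesis by simp
  qed
  have w1: "0 < w S\<^sub>1" "w S\<^sub>1 < 1" and w2: "0 < w S\<^sub>2" "w S\<^sub>2 < 1"
  proof -
    have 1: "\<not> (AE \<zeta> in circle_measure. \<zeta> \<in> S\<^sub>1)" and 2: "\<not> (AE \<zeta> in circle_measure. \<zeta> \<in> S\<^sub>2)"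
      using nc nd by (auto simp: S\<^sub>1_def S\<^sub>2_def)
    have 3: "\<not> (AE \<zeta> in circle_measure. \<zeta> \<notin> S\<^sub>1)"
    proof
      assume "AE \<zeta> in circle_measure. \<zeta> \<notin> S\<^sub>1"
      then have "AE \<zeta> in circle_measure. c < \<omega> \<zeta>"
        using AE_space by eventually_elim (use \<open>c < d\<close> in \<open>simp add: S\<^sub>1_def\<close>)
      with nc show False by simp
    qed
    have 4: "\<not> (AE \<zeta> in circle_measure. \<zeta> \<notin> S\<^sub>2)"
    proof
      assume "AE \<zeta> in circle_measure. \<zeta> \<notin> S\<^sub>2"
      then have "AE \<zeta> in circle_measure. \<omega> \<zeta> < d"
        using AE_space by eventually_elim (use \<open>c < d\<close> in \<open>simp add: S\<^sub>2_def\<close>)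
      with nd show False by simp
    qed
    show "0 < w S\<^sub>1" "w S\<^sub>1 < 1" "0 < w S\<^sub>2" "w S\<^sub>2 < 1"
      using wpos[OF S(1) 3] wlt[OF S(1) 1] wpos[OF S(2) 4] wlt[OF S(2) 2] by simp_all
  qed
  define v where "v = max (w S\<^sub>1) (w S\<^sub>2)"
  have v: "0 < v" "v < 1" "w S\<^sub>1 \<le> v" "w S\<^sub>2 \<le> v" using w1 w2 by (simp_all add: v_def)
  \<comment> \<open>The midpoint of 1 and \<open>1 / v\<close>: then \<open>p > 1\<close>, while
    \<open>p * v = (1 + v) / 2 < 1\<close>.\<close>
  define p where "p = (1 + 1 / v) / 2"
  have p: "p > 1" using v by (simp add: p_def field_simps)
  have pv: "p * v < 1" using v by (simp add: p_def field_simps)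
  have q: "0 \<le> p * w S\<^sub>1" "p * w S\<^sub>1 < 1" "0 \<le> p * w S\<^sub>2" "p * w S\<^sub>2 < 1"
  proof -
    have "p * w S\<^sub>1 \<le> p * v" "p * w S\<^sub>2 \<le> p * v"
      using v p by (auto intro!: mult_left_mono)
    with pv show "p * w S\<^sub>1 < 1" "p * w S\<^sub>2 < 1" by linarith+
  qed (use p w1 w2 in simp_all)
  obtain C1 where C1: "C1 < \<infinity>" "\<And>s. (\<integral>\<^sup>+t\<in>{a..b}. ennreal (\<bar>s - t\<bar> powr - (p * w S\<^sub>1)) \<partial>lborel) \<le> C1"
    using nn_integral_powr_shift_bounded[OF q(1,2)] by metis
  obtain C2 where C2: "C2 < \<infinity>" "\<And>s. (\<integral>\<^sup>+t\<in>{a..b}. ennreal (\<bar>s - t\<bar> powr - (p * w S\<^sub>2)) \<partial>lborel) \<le> C2"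
    using nn_integral_powr_shift_bounded[OF q(3,4)] by metis
  \<comment> \<open>The distance of the midpoint of \<open>c\<close> and \<open>d\<close> to either
    of them: for \<open>t\<close> left of the midpoint \<open>\<omega> - t \<ge> \<delta>\<close>
    off \<open>S\<^sub>1\<close>, and for \<open>t\<close> right of it
    \<open>t - \<omega> \<ge> \<delta>\<close> off \<open>S\<^sub>2\<close>.\<close>
  define \<delta> where "\<delta> = (d - c) / 2"
  have \<delta>: "\<delta> > 0" using \<open>c < d\<close> by (simp add: \<delta>_def)
  define L where "L = \<bar>ln \<delta>\<bar>"
  define k where "k = cmod (szego_kernel z z) powr p"
  define D where "D S = k * (exp (p * L) / w S)" for S
  have D: "D S\<^sub>1 \<ge> 0" "D S\<^sub>2 \<ge> 0" using w1 w2 by (simp_all add: D_def k_def)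
  define U where "U \<epsilon> S t = (\<integral>\<^sup>+\<zeta>. ennreal (exp (- (p * w S) * ln (cmod (Complex \<epsilon> (\<omega> \<zeta> - t)))) * P \<zeta>) \<partial>circle_measure)" for \<epsilon> S t
  let ?R = "\<lambda>\<epsilon> t. cmod (circle_inner
    (toeplitz_resolvent \<omega> (complex_of_real t + \<i> * complex_of_real \<epsilon>) (szego_kernel z)) (szego_kernel z)) powr p"
  have piece: "ennreal (?R \<epsilon> t) \<le> ennreal (D S) * U \<epsilon> S t"
    if \<epsilon>: "\<epsilon> > 0" and S: "S \<in> sets circle_measure" "w S > 0"
      and far: "\<And>\<zeta>. \<zeta> \<in> space circle_measure \<Longrightarrow> \<zeta> \<notin> S \<Longrightarrow> \<delta> \<le> \<bar>\<omega> \<zeta> - t\<bar>" for \<epsilon> S t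
  proof -
    define x where "x \<zeta> = ln (cmod (Complex \<epsilon> (\<omega> \<zeta> - t)))" for \<zeta>
    have xi: "integrable circle_measure x"
      using integrable_Re[OF L2_integrable[OF log_symbol_L2[OF integrable \<epsilon>, of t]]] by (simp add: Re_log_symbol x_def[abs_def])
    have xP: "integrable circle_measure (\<lambda>\<zeta>. x \<zeta> * P \<zeta>)"
      unfolding P_def by (rule Re_herglotz_real(1)[OF xi z])
    have low: "- (- ln \<epsilon>) \<le> x \<zeta>" for \<zeta>
      using ln_mono[OF cmod_Complex_ge(1)[OF \<epsilon>] \<epsilon>] by (simp add: x_def)
    have compl: "- L \<le> x \<zeta>" if "\<zeta> \<in> space circle_measure" "\<zeta> \<notin> S" for \<zeta>
    proof -
      have "ln \<delta> \<le> x \<zeta>"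
        unfolding x_def using far[OF that] cmod_Complex_ge(2)[of "\<omega> \<zeta> - t" \<epsilon>] \<delta> by (intro ln_mono) linarith+
      then show ?thesis by (simp add: L_def)
    qed
    have est: "exp (- p * (\<integral>\<zeta>. x \<zeta> * P \<zeta> \<partial>circle_measure))
      \<le> exp (p * L) / w S * (\<integral>\<zeta>. exp (- (p * w S) * x \<zeta>) * P \<zeta> \<partial>circle_measure)"
      by (rule weighted_log_estimate[OF P1(1) P0 P1(2) S(1) w_def S(2) xP borel_measurable_integrable[OF xi]
            AE_I2[OF low] AE_I2])
        (use compl p in \<open>simp_all add: L_def\<close>)
    have "?R \<epsilon> t = k * exp (- p * (\<integral>\<zeta>. x \<zeta> * P \<zeta> \<partial>circle_measure))"
      unfolding toeplitz_resolvent_value[OF integrable bounded_below z \<epsilon>] k_def x_def P_def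
      by (simp add: powr_mult exp_powr_real mult.commute)
    also have "\<dots> \<le> k * (exp (p * L) / w S * (\<integral>\<zeta>. exp (- (p * w S) * x \<zeta>) * P \<zeta> \<partial>circle_measure))"
      using est by (rule mult_left_mono) (simp add: k_def)
    finally have "?R \<epsilon> t \<le> D S * (\<integral>\<zeta>. exp (- (p * w S) * x \<zeta>) * P \<zeta> \<partial>circle_measure)"
      by (simp add: D_def mult.assoc)
    moreover have nn: "AE \<zeta> in circle_measure. 0 \<le> exp (- (p * w S) * x \<zeta>) * P \<zeta>"
      using P0 by eventually_elim simp
    ultimately have "ennreal (?R \<epsilon> t) \<le> ennreal (D S) * ennreal (\<integral>\<zeta>. exp (- (p * w S) * x \<zeta>) * P \<zeta> \<partial>circle_measure)"
      by (subst ennreal_mult''[OF integral_nonneg_AE[OF nn], symmetric]) (rule ennreal_leI)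
    also have "ennreal (\<integral>\<zeta>. exp (- (p * w S) * x \<zeta>) * P \<zeta> \<partial>circle_measure) \<le> U \<epsilon> S t"
    \<comment> \<open>A non-integrable function has Bochner integral 0 by convention, so that case
      is immediate.\<close>
    proof (cases "integrable circle_measure (\<lambda>\<zeta>. exp (- (p * w S) * x \<zeta>) * P \<zeta>)")
      case True
      from nn_integral_eq_integral[OF True nn] show ?thesis by (simp add: U_def x_def)
    next
      case False
      then show ?thesis by (simp add: not_integrable_integral_eq)
    qed
    finally show ?thesis by (simp add: mult_left_mono)
  qed
  have bound: "(\<integral>\<^sup>+t\<in>{a..b}. ennreal (?R \<epsilon> t) \<partial>lborel) \<le> ennreal (D S\<^sub>1) * C1 + ennreal (D S\<^sub>2) * C2" if \<epsilon>: "\<epsilon> > 0" for \<epsilon>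
  proof -
    have sf: "sigma_finite_measure circle_measure" by unfold_locales
    note U1 = nn_integral_resolvent_bound[OF sf \<omega>m P1(1) P0 P1(2) q(1) \<epsilon> C1(2), folded U_def]
    note U2 = nn_integral_resolvent_bound[OF sf \<omega>m P1(1) P0 P1(2) q(3) \<epsilon> C2(2), folded U_def]
    have "(\<integral>\<^sup>+t\<in>{a..b}. ennreal (?R \<epsilon> t) \<partial>lborel)
      \<le> (\<integral>\<^sup>+t. ennreal (D S\<^sub>1) * (U \<epsilon> S\<^sub>1 t * indicator {a..b} t) + ennreal (D S\<^sub>2) * (U \<epsilon> S\<^sub>2 t * indicator {a..b} t) \<partial>lborel)"
    proof (rule nn_integral_mono)
      fix t
      \<comment> \<open>Only one summand is needed on each side of the midpoint; adding both for
        every \<open>t\<close> avoids cutting the interval there.\<close>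
      have "ennreal (?R \<epsilon> t) \<le> ennreal (D S\<^sub>1) * U \<epsilon> S\<^sub>1 t + ennreal (D S\<^sub>2) * U \<epsilon> S\<^sub>2 t"
      proof (cases "t \<le> (c + d) / 2")
        case True
        have "ennreal (?R \<epsilon> t) \<le> ennreal (D S\<^sub>1) * U \<epsilon> S\<^sub>1 t"
          by (rule piece[OF \<epsilon> S(1) w1(1)], rule order_trans[OF _ abs_ge_self]) (use True in \<open>simp add: S\<^sub>1_def \<delta>_def field_simps\<close>)
        then show ?thesis by (rule order_trans) simp
      next
        case False
        have "ennreal (?R \<epsilon> t) \<le> ennreal (D S\<^sub>2) * U \<epsilon> S\<^sub>2 t"
          by (rule piece[OF \<epsilon> S(2) w2(1)], rule order_trans[OF _ abs_ge_minus_self]) (use False in \<open>simp add: S\<^sub>2_def \<delta>_def field_simps\<close>)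
        then show ?thesis by (rule order_trans) simp
      qed
      then show "ennreal (?R \<epsilon> t) * indicator {a..b} t
        \<le> ennreal (D S\<^sub>1) * (U \<epsilon> S\<^sub>1 t * indicator {a..b} t) + ennreal (D S\<^sub>2) * (U \<epsilon> S\<^sub>2 t * indicator {a..b} t)"
        by (simp add: indicator_def)
    qed
    also have "\<dots> = ennreal (D S\<^sub>1) * (\<integral>\<^sup>+t\<in>{a..b}. U \<epsilon> S\<^sub>1 t \<partial>lborel) + ennreal (D S\<^sub>2) * (\<integral>\<^sup>+t\<in>{a..b}. U \<epsilon> S\<^sub>2 t \<partial>lborel)"
      using U1(1) U2(1) by (subst nn_integral_add) (simp_all add: nn_integral_cmult)
    also have "\<dots> \<le> ennreal (D S\<^sub>1) * C1 + ennreal (D S\<^sub>2) * C2"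
      by (intro add_mono mult_left_mono U1(2) U2(2)) simp_all
    finally show ?thesis .
  qed
  have "(SUP \<epsilon>\<in>{0<..1}. \<integral>\<^sup>+t\<in>{a..b}. ennreal (?R \<epsilon> t) \<partial>lborel) \<le> ennreal (D S\<^sub>1) * C1 + ennreal (D S\<^sub>2) * C2"
    by (rule SUP_least) (use bound in simp)
  also have "\<dots> < \<infinity>"
    using C1(1) C2(1) by (simp add: ennreal_mult_less_top)
  finally show ?thesis using p by blast
qed

end
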